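(* Let $X$ and $X'$ be geodesic metric spaces, let $\mathcal A=\{A_i\mid i\in I\}$ be a collection of subsets of $X$, let $\mathfrak q:X\to X'$ be a quasi-isometry, and let $\mathfrak q(\mathcal A)=\{\mathfrak q(A_i)\mid i\in I\}$. Then: (1) If $X$ satisfies properties $(\alpha_1)$ and $(\alpha_2')$ with respect to $\mathcal A$, then $X'$ satisfies properties $(\alpha_1)$ and $(\alpha_2^\epsilon)$, for a sufficiently small $\epsilon>0$, with respect to $\mathfrak q(\mathcal A)$. (2) If $X$ satisfies $(\alpha_3')$ with respect to $\mathcal A$, then $X'$ satisfies $(\alpha_3)$ with respect to $\mathfrak q(\mathcal A)$. (3) If $X$ is asymptotically tree-graded with respect to $\mathcal A$, then $X'$ is asymptotically tree-graded with respect to $\mathfrak q(\mathcal A)$.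
   Context: $\mathcal N_\delta(A)=\{x\mid\mathrm{dist}(x,A)<\delta\}$. An $(L,C)$-quasi-isometric embedding is a map $\mathfrak q$ with $\frac1L\mathrm{dist}(x,x')-C\le\mathrm{dist}(\mathfrak q(x),\mathfrak q(x'))\le L\,\mathrm{dist}(x,x')+C$; an $(L,C)$-quasi-geodesic is an $(L,C)$-quasi-isometric embedding of an interval of $\mathbb R$; a quasi-isometry is a quasi-isometric embedding having a quasi-inverse that is a quasi-isometric embedding (both compositions at finite distance from the identities). Properties of a space $X$ with a collection $\mathcal A=\{A_i\mid i\in I\}$ of subsets: $(\alpha_1)$ For every $\delta>0$ the diameters of $\mathcal N_\delta(A_i)\cap\mathcal N_\delta(A_j)$ are uniformly bounded for all $i\ne j$. $(\alpha_2^\epsilon)$ (where $0<\epsilon\le\frac12$) For every $\theta\in[0,\epsilon)$ there exists $M>0$ such that for every geodesic $\mathfrak c$ of length $\ell$ and every $A\in\mathcal A$ with $\mathfrak c(0),\mathfrak c(\ell)\in\mathcal N_{\theta\ell}(A)$ we have $\mathfrak c([0,\ell])\cap\mathcal N_M(A)\neq\emptyset$. $(\alpha_2')$ For every $L\ge1$, $C\ge0$ and $\theta\in[0,\frac12)$ there exists $M>0$ such that for every $(L,C)$-quasi-geodesic $\mathfrak c$ defined on $[0,\ell]$ and every $A\in\mathcal A$ with $\mathfrak c(0),\mathfrak c(\ell)\in\mathcal N_{\theta\ell/L}(A)$ we have $\mathfrak c([0,\ell])\cap\mathcal N_M(A)\ne\emptyset$. $(\alpha_3)$ For every $k\ge2$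 there exist $\vartheta>0$, $\nu\ge8$, $\chi>0$ such that every $k$-gon $P$ with geodesic edges which is $(\vartheta,2,\nu)$-fat satisfies $P\subset\mathcal N_\chi(A)$ for some $A\in\mathcal A$. $(\alpha_3')$ For every $L\ge1$, $C\ge0$, $k\ge2$, $\sigma\ge1$ and $\nu\ge4\sigma$ there exists $\vartheta_0>0$ such that for every $\vartheta\ge\vartheta_0$ every $k$-gon $P$ with $(L,C)$-quasi-geodesic edges which is $(\vartheta,\sigma,\nu)$-fat is contained in $\mathcal N_\chi(A)$ for some $A\in\mathcal A$, where $\chi=\sigma L^2\vartheta+c$ with $c$ a constant independent of $\vartheta$. Fat polygons. A $k$-gon $P$ (with geodesic or quasi-geodesic edges) is a union of $k$ geodesics (quasi-geodesics) $\mathfrak q_1,\dots,\mathfrak q_k$ with $(\mathfrak q_i)_+=(\mathfrak q_{i+1})_-$, indices mod $k$ ($\mathfrak q_-$, $\mathfrak q_+$ are the start and end of $\mathfrak q$). For the vertex $x=(\mathfrak q_{i-1})_+=(\mathfrak q_i)_-$, $\mathcal O_x$ is the polygonal curve formed by the edges other than $\mathfrak q_{i-1},\mathfrak q_i$. For $\vartheta>0$, $\sigma\ge1$, $\nu\ge4\sigma$, $P$ is $(\vartheta,\sigma,\nu)$-fat if: $(F_1)$ for every edge $\mathfrak q$ with endpoints $x,y$, $\mathrm{dist}(\mathfrak q\setminus\mathcal N_{\sigma\vartheta}(\{x,y\}),P\setminus\mathfrak q)\ge\vartheta$, where $P\setminus\mathfrak q$ denotes the union of the other edges; $(F_2)$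 for every vertex $x$, $\mathrm{dist}(x,\mathcal O_x)\ge\nu\vartheta$. The distance to or from the empty set is $+\infty$. Asymptotic cones. For a non-principal ultrafilter $\omega$ over a countable set, points $e=(e_n)$ of $X$ and positive numbers $d=(d_n)$ with $\lim_\omega d_n=\infty$, $\mathrm{Con}^\omega(X;e,d)$ is the set of sequences $(x_n)$ in $X$ with $\lim_\omega\mathrm{dist}(x_n,e_n)/d_n<\infty$, with pseudo-distance $\lim_\omega\mathrm{dist}(x_n,y_n)/d_n$, modulo pseudo-distance $0$; the class of $(x_n)$ is $\lim^\omega(x_n)$. For subsets $B_n\subseteq X$, $\lim^\omega(B_n)=\{\lim^\omega(x_n)\mid x_n\in B_n\ \omega\text{-almost surely}\}$. Tree-graded. A complete geodesic metric space $\mathbb F$ is tree-graded with respect to a collection $\mathcal P$ of closed geodesic subsets (pieces; a subset is geodesic if any two of its points are joined by a geodesic contained in it) if $(T_1)$ every two different pieces have at most one common point, and $(T_2)$ every simple geodesic triangle (simple loop composed of three geodesics) is contained in one piece. A point is regarded as a geodesic triangle with sides of length $0$, so pieces cover $\mathbb F$. $X$ is asymptotically tree-graded with respect to $\mathcal A$ if every asymptotic cone $\mathrm{Con}^\omega(X;e,d)$ is tree-graded with respect to the collection of all sets $\lim^\omega(A_{i_n})$ with $(i_n)$ a sequence in $I$ such that $\mathrm{dist}(e_n,A_{i_n})/d_n$ is bounded; here $(T_1)$ means: if $i_n\ne j_n$ $\omega$-almost surely, then $\lim^\omega(A_{i_n})\cap\lim^\omega(A_{j_n})$ has at most one point. 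*)

theory Defs
  imports "HOL-Analysis.Analysis"
begin

section \<open>Distances and neighbourhoods\<close>

text \<open>The library's \<^const>\<open>infdist\<close> and \<^const>\<open>setdist\<close> are \<open>0\<close> on empty sets; here the
  distance to or from the empty set is \<open>\<infinity>\<close>.\<close>

definition edist :: "'a::metric_space set \<Rightarrow> 'a set \<Rightarrow> ereal" where
  "edist S T = (INF x\<in>S. INF y\<in>T. ereal (dist x y))"

definition nbhd :: "real \<Rightarrow> 'a::metric_space set \<Rightarrow> 'a set" where
  "nbhd \<delta> S = {x. edist {x} S < ereal \<delta>}"

lemma nbhd_iff: "x \<in> nbhd \<delta> S \<longleftrightarrow> (\<exists>a\<in>S. dist x a < \<delta>)"
  by (simp add: nbhd_def edist_def INF_less_iff)

lemma edist_ge_iff: "ereal r \<le> edist S T \<longleftrightarrow> (\<forall>x\<in>S. \<forall>y\<in>T. r \<le> dist x y)"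
  by (simp add: edist_def le_INF_iff)

section \<open>Geodesics, quasi-geodesics and quasi-isometries\<close>

text \<open>Asymptotic cones are carrier-based metric spaces (locale \<^locale>\<open>Metric_space\<close>), hence the
  explicit carrier and distance in the notions needed for both kinds of spaces.\<close>

definition geodesic :: "'a set \<Rightarrow> ('a \<Rightarrow> 'a \<Rightarrow> real) \<Rightarrow> (real \<Rightarrow> 'a) \<Rightarrow> real \<Rightarrow> bool" where
  "geodesic M d c l \<longleftrightarrow>
     0 \<le> l \<and> c ` {0..l} \<subseteq> M \<and> (\<forall>s\<in>{0..l}. \<forall>t\<in>{0..l}. d (c s) (c t) = \<bar>s - t\<bar>)"

definition geodesic_subset :: "('a \<Rightarrow> 'a \<Rightarrow> real) \<Rightarrow> 'a set \<Rightarrow> bool" where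
  "geodesic_subset d S \<longleftrightarrow>
     (\<forall>x\<in>S. \<forall>y\<in>S. \<exists>c l. geodesic S d c l \<and> c 0 = x \<and> c l = y)"

definition qi_embedding_on ::
    "real \<Rightarrow> real \<Rightarrow> 'a::metric_space set \<Rightarrow> ('a \<Rightarrow> 'b::metric_space) \<Rightarrow> bool" where
  "qi_embedding_on L C S f \<longleftrightarrow> 1 \<le> L \<and> 0 \<le> C \<and>
     (\<forall>x\<in>S. \<forall>y\<in>S. 1 / L * dist x y - C \<le> dist (f x) (f y) \<and> dist (f x) (f y) \<le> L * dist x y + C)"

text \<open>Only quasi-geodesics with two endpoints occur; their domain is translated to start at \<open>0\<close>.\<close>

definition quasi_geodesic ::
    "real \<Rightarrow> real \<Rightarrow> (real \<Rightarrow> 'a::metric_space) \<Rightarrow> real \<Rightarrow> bool" where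
  "quasi_geodesic L C c l \<longleftrightarrow> 0 \<le> l \<and> qi_embedding_on L C {0..l} c"

definition quasi_isometry :: "('a::metric_space \<Rightarrow> 'b::metric_space) \<Rightarrow> bool" where
  "quasi_isometry f \<longleftrightarrow>
     (\<exists>L C. qi_embedding_on L C UNIV f) \<and>
     (\<exists>g. (\<exists>L C. qi_embedding_on L C UNIV g) \<and>
          (\<exists>D. \<forall>x. dist (g (f x)) x \<le> D) \<and> (\<exists>D. \<forall>y. dist (f (g y)) y \<le> D))"

section \<open>Fat polygons\<close>

text \<open>The edges of a \<open>k\<close>-gon are \<open>q 0, \<dots>, q (k - 1)\<close>, with \<open>q i\<close> defined on \<open>{0..l i}\<close>; vertex
  \<open>i\<close> is the start \<open>q i 0\<close> of edge \<open>i\<close>.\<close>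

definition edge :: "(nat \<Rightarrow> real \<Rightarrow> 'a) \<Rightarrow> (nat \<Rightarrow> real) \<Rightarrow> nat \<Rightarrow> 'a set" where
  "edge q l i = q i ` {0..l i}"

definition closed_chain :: "nat \<Rightarrow> (nat \<Rightarrow> real \<Rightarrow> 'a) \<Rightarrow> (nat \<Rightarrow> real) \<Rightarrow> bool" where
  "closed_chain k q l \<longleftrightarrow> (\<forall>i<k. q i (l i) = q (Suc i mod k) 0)"

definition geodesic_polygon ::
    "nat \<Rightarrow> (nat \<Rightarrow> real \<Rightarrow> 'a::metric_space) \<Rightarrow> (nat \<Rightarrow> real) \<Rightarrow> bool" where
  "geodesic_polygon k q l \<longleftrightarrow> closed_chain k q l \<and> (\<forall>i<k. geodesic UNIV dist (q i) (l i))"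

definition quasi_geodesic_polygon ::
    "real \<Rightarrow> real \<Rightarrow> nat \<Rightarrow> (nat \<Rightarrow> real \<Rightarrow> 'a::metric_space) \<Rightarrow> (nat \<Rightarrow> real) \<Rightarrow> bool" where
  "quasi_geodesic_polygon L C k q l \<longleftrightarrow>
     closed_chain k q l \<and> (\<forall>i<k. quasi_geodesic L C (q i) (l i))"

definition polygon_set :: "nat \<Rightarrow> (nat \<Rightarrow> real \<Rightarrow> 'a) \<Rightarrow> (nat \<Rightarrow> real) \<Rightarrow> 'a set" where
  "polygon_set k q l = (\<Union>i<k. edge q l i)"

text \<open>\<open>(i + k - 1) mod k\<close> is the cyclic predecessor of \<open>i\<close>.\<close>

definition fat_polygon ::
    "real \<Rightarrow> real \<Rightarrow> real \<Rightarrow> nat \<Rightarrow> (nat \<Rightarrow> real \<Rightarrow> 'a::metric_space) \<Rightarrow> (nat \<Rightarrow> real) \<Rightarrow> bool" where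
  "fat_polygon \<theta> \<sigma> \<nu> k q l \<longleftrightarrow>
     (\<forall>i<k. edist (edge q l i - nbhd (\<sigma> * \<theta>) {q i 0, q i (l i)})
                  (\<Union>j\<in>{..<k} - {i}. edge q l j) \<ge> ereal \<theta>) \<and>
     (\<forall>i<k. edist {q i 0} (\<Union>j\<in>{..<k} - {i, (i + k - 1) mod k}. edge q l j) \<ge> ereal (\<nu> * \<theta>))"

section \<open>The properties \<open>(\<alpha>\<^sub>1)\<close>, \<open>(\<alpha>\<^sub>2)\<close>, \<open>(\<alpha>\<^sub>3)\<close> and their variants\<close>

text \<open>The bound has to be stated together with \<^const>\<open>bounded\<close>, because \<^const>\<open>diameter\<close> is
  meaningless on unbounded sets.\<close>

definition alpha1 :: "'i set \<Rightarrow> ('i \<Rightarrow> 'a::metric_space set) \<Rightarrow> bool" where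
  "alpha1 I A \<longleftrightarrow>
     (\<forall>\<delta>>0. \<exists>D. \<forall>i\<in>I. \<forall>j\<in>I. i \<noteq> j \<longrightarrow>
        bounded (nbhd \<delta> (A i) \<inter> nbhd \<delta> (A j)) \<and> diameter (nbhd \<delta> (A i) \<inter> nbhd \<delta> (A j)) \<le> D)"

definition alpha2 :: "real \<Rightarrow> 'i set \<Rightarrow> ('i \<Rightarrow> 'a::metric_space set) \<Rightarrow> bool" where
  "alpha2 \<epsilon> I A \<longleftrightarrow>
     (\<forall>\<theta>. 0 \<le> \<theta> \<and> \<theta> < \<epsilon> \<longrightarrow>
       (\<exists>M>0. \<forall>c l. \<forall>i\<in>I.
          geodesic UNIV dist c l \<and> c 0 \<in> nbhd (\<theta> * l) (A i) \<and> c l \<in> nbhd (\<theta> * l) (A i) \<longrightarrow>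
          c ` {0..l} \<inter> nbhd M (A i) \<noteq> {}))"

definition alpha2' :: "'i set \<Rightarrow> ('i \<Rightarrow> 'a::metric_space set) \<Rightarrow> bool" where
  "alpha2' I A \<longleftrightarrow>
     (\<forall>L C \<theta>. 1 \<le> L \<and> 0 \<le> C \<and> 0 \<le> \<theta> \<and> \<theta> < 1 / 2 \<longrightarrow>
       (\<exists>M>0. \<forall>c l. \<forall>i\<in>I.
          quasi_geodesic L C c l \<and>
          c 0 \<in> nbhd (\<theta> * l / L) (A i) \<and> c l \<in> nbhd (\<theta> * l / L) (A i) \<longrightarrow>
          c ` {0..l} \<inter> nbhd M (A i) \<noteq> {}))"

definition alpha3 :: "'i set \<Rightarrow> ('i \<Rightarrow> 'a::metric_space set) \<Rightarrow> bool" where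
  "alpha3 I A \<longleftrightarrow>
     (\<forall>k\<ge>2. \<exists>\<theta>>0. \<exists>\<nu>\<ge>8. \<exists>R>0. \<forall>q l.
        geodesic_polygon k q l \<and> fat_polygon \<theta> 2 \<nu> k q l \<longrightarrow>
        (\<exists>i\<in>I. polygon_set k q l \<subseteq> nbhd R (A i)))"

definition alpha3' :: "'i set \<Rightarrow> ('i \<Rightarrow> 'a::metric_space set) \<Rightarrow> bool" where
  "alpha3' I A \<longleftrightarrow>
     (\<forall>L C k \<sigma> \<nu>. 1 \<le> L \<and> 0 \<le> C \<and> 2 \<le> k \<and> 1 \<le> \<sigma> \<and> 4 * \<sigma> \<le> \<nu> \<longrightarrow>
       (\<exists>\<theta>0>0. \<exists>c. \<forall>\<theta>\<ge>\<theta>0. \<forall>q l.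
          quasi_geodesic_polygon L C k q l \<and> fat_polygon \<theta> \<sigma> \<nu> k q l \<longrightarrow>
          (\<exists>i\<in>I. polygon_set k q l \<subseteq> nbhd (\<sigma> * L\<^sup>2 * \<theta> + c) (A i))))"

section \<open>Asymptotic cones\<close>

definition nonprincipal_ultrafilter :: "'n filter \<Rightarrow> bool" where
  "nonprincipal_ultrafilter \<omega> \<longleftrightarrow>
     \<omega> \<noteq> bot \<and> (\<forall>P. eventually P \<omega> \<or> eventually (\<lambda>n. \<not> P n) \<omega>) \<and>
     (\<forall>m. eventually (\<lambda>n. n \<noteq> m) \<omega>)"

text \<open>A countable set carrying such an ultrafilter is infinite, so sequences are indexed by \<^typ>\<open>nat\<close>.
  Limits along \<open>\<omega>\<close> always exist in \<open>[0, \<infinity>]\<close>; finiteness is convergence to a real number.\<close>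

definition cone_seqs :: "nat filter \<Rightarrow> (nat \<Rightarrow> 'a::metric_space) \<Rightarrow> (nat \<Rightarrow> real) \<Rightarrow> (nat \<Rightarrow> 'a) set"
  where "cone_seqs \<omega> e d = {x. \<exists>r::real. ((\<lambda>n. dist (x n) (e n) / d n) \<longlongrightarrow> r) \<omega>}"

definition cone_rel ::
    "nat filter \<Rightarrow> (nat \<Rightarrow> 'a::metric_space) \<Rightarrow> (nat \<Rightarrow> real) \<Rightarrow> ((nat \<Rightarrow> 'a) \<times> (nat \<Rightarrow> 'a)) set" where
  "cone_rel \<omega> e d = {(x, y). x \<in> cone_seqs \<omega> e d \<and> y \<in> cone_seqs \<omega> e d \<and>
                             ((\<lambda>n. dist (x n) (y n) / d n) \<longlongrightarrow> 0) \<omega>}"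

definition asym_cone ::
    "nat filter \<Rightarrow> (nat \<Rightarrow> 'a::metric_space) \<Rightarrow> (nat \<Rightarrow> real) \<Rightarrow> (nat \<Rightarrow> 'a) set set" where
  "asym_cone \<omega> e d = cone_seqs \<omega> e d // cone_rel \<omega> e d"

text \<open>The value \<open>0\<close> outside the carrier is only there because \<^locale>\<open>Metric_space\<close> requires
  distances to be nonnegative everywhere.\<close>

definition cone_dist ::
    "nat filter \<Rightarrow> (nat \<Rightarrow> 'a::metric_space) \<Rightarrow> (nat \<Rightarrow> real) \<Rightarrow>
     (nat \<Rightarrow> 'a) set \<Rightarrow> (nat \<Rightarrow> 'a) set \<Rightarrow> real" where
  "cone_dist \<omega> e d p q =
     (if p \<in> asym_cone \<omega> e d \<and> q \<in> asym_cone \<omega> e d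
      then THE r. \<exists>x\<in>p. \<exists>y\<in>q. ((\<lambda>n. dist (x n) (y n) / d n) \<longlongrightarrow> r) \<omega> else 0)"

definition cone_point ::
    "nat filter \<Rightarrow> (nat \<Rightarrow> 'a::metric_space) \<Rightarrow> (nat \<Rightarrow> real) \<Rightarrow> (nat \<Rightarrow> 'a) \<Rightarrow> (nat \<Rightarrow> 'a) set" where
  "cone_point \<omega> e d x = cone_rel \<omega> e d `` {x}"

definition cone_lim ::
    "nat filter \<Rightarrow> (nat \<Rightarrow> 'a::metric_space) \<Rightarrow> (nat \<Rightarrow> real) \<Rightarrow> (nat \<Rightarrow> 'a set) \<Rightarrow> (nat \<Rightarrow> 'a) set set"
  where "cone_lim \<omega> e d B =
     {cone_point \<omega> e d x | x. x \<in> cone_seqs \<omega> e d \<and> (\<forall>\<^sub>F n in \<omega>. x n \<in> B n)}"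

text \<open>The following facts show that the cone is a metric space in which \<^const>\<open>cone_dist\<close> is
  computed on arbitrary representatives.\<close>

lemma ultrafilter_bounded_tendsto:
  fixes f :: "nat \<Rightarrow> real"
  assumes om: "nonprincipal_ultrafilter \<omega>" and ev: "\<forall>\<^sub>F n in \<omega>. \<bar>f n\<bar> \<le> B"
  shows "\<exists>r. (f \<longlongrightarrow> r) \<omega>"
proof -
  have "filtermap f \<omega> \<noteq> bot"
    using om by (simp add: nonprincipal_ultrafilter_def filtermap_bot_iff)
  moreover have "eventually (\<lambda>x. x \<in> {-B..B}) (filtermap f \<omega>)"
    unfolding eventually_filtermap by (rule eventually_mono[OF ev]) auto
  ultimately obtain r where r: "inf (nhds r) (filtermap f \<omega>) \<noteq> bot"
    using compact_filter[of "{-B..B}"] by auto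
  have "(f \<longlongrightarrow> r) \<omega>"
    unfolding tendsto_def
  proof (intro allI impI)
    fix S assume S: "open S" "r \<in> S"
    show "\<forall>\<^sub>F n in \<omega>. f n \<in> S"
    proof (rule ccontr)
      assume "\<not> (\<forall>\<^sub>F n in \<omega>. f n \<in> S)"
      then have "\<forall>\<^sub>F n in \<omega>. f n \<notin> S"
        using om unfolding nonprincipal_ultrafilter_def by blast
      then have "eventually (\<lambda>x. x \<notin> S) (filtermap f \<omega>)"
        by (simp add: eventually_filtermap)
      moreover have "eventually (\<lambda>x. x \<in> S) (nhds r)"
        using S by (auto simp: eventually_nhds)
      ultimately have "eventually (\<lambda>x. False) (inf (nhds r) (filtermap f \<omega>))"
        unfolding eventually_inf by blast
      with r show False by (simp add: trivial_limit_def)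
    qed
  qed
  then show ?thesis ..
qed

context
  fixes \<omega> :: "nat filter" and e :: "nat \<Rightarrow> 'a::metric_space" and d :: "nat \<Rightarrow> real"
  assumes om: "nonprincipal_ultrafilter \<omega>" and pos: "\<And>n. 0 < d n"
begin

lemma omega_nbot: "\<omega> \<noteq> bot"
  using om by (simp add: nonprincipal_ultrafilter_def)

lemma cone_seqs_tendsto:
  assumes "x \<in> cone_seqs \<omega> e d" "y \<in> cone_seqs \<omega> e d"
  shows "\<exists>r. ((\<lambda>n. dist (x n) (y n) / d n) \<longlongrightarrow> r) \<omega>"
proof -
  obtain a b where a: "((\<lambda>n. dist (x n) (e n) / d n) \<longlongrightarrow> a) \<omega>"
    and b: "((\<lambda>n. dist (y n) (e n) / d n) \<longlongrightarrow> b) \<omega>"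
    using assms by (auto simp: cone_seqs_def)
  have "\<forall>\<^sub>F n in \<omega>. dist (x n) (e n) / d n < a + 1" "\<forall>\<^sub>F n in \<omega>. dist (y n) (e n) / d n < b + 1"
    using order_tendstoD(2)[OF a, of "a + 1"] order_tendstoD(2)[OF b, of "b + 1"] by auto
  then have "\<forall>\<^sub>F n in \<omega>. \<bar>dist (x n) (y n) / d n\<bar> \<le> a + b + 2"
  proof eventually_elim
    case (elim n)
    have "dist (x n) (y n) / d n \<le> (dist (x n) (e n) + dist (y n) (e n)) / d n"
      using pos[of n] by (intro divide_right_mono dist_triangle2) auto
    with elim show ?case using pos[of n] by (simp add: add_divide_distrib)
  qed
  then show ?thesis by (rule ultrafilter_bounded_tendsto[OF om])
qed

lemma tendsto_scaled_triangle:
  assumes "((\<lambda>n. dist (x n) (y n) / d n) \<longlongrightarrow> r) \<omega>" "((\<lambda>n. dist (y n) (z n) / d n) \<longlongrightarrow> s) \<omega>"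
    "((\<lambda>n. dist (x n) (z n) / d n) \<longlongrightarrow> t) \<omega>"
  shows "t \<le> r + s"
proof (rule tendsto_le[OF omega_nbot tendsto_add[OF assms(1,2)] assms(3)])
  show "\<forall>\<^sub>F n in \<omega>. dist (x n) (z n) / d n \<le> dist (x n) (y n) / d n + dist (y n) (z n) / d n"
    using pos by (intro always_eventually allI)
      (metis add_divide_distrib dist_triangle divide_right_mono less_imp_le)
qed

lemma tendsto_scaled_commute:
  "((\<lambda>n. dist (x n) (y n) / d n) \<longlongrightarrow> r) \<omega> \<Longrightarrow> ((\<lambda>n. dist (y n) (x n) / d n) \<longlongrightarrow> r) \<omega>"
  by (simp add: dist_commute)

lemma tendsto_scaled_nonneg:
  "((\<lambda>n. dist (x n) (y n) / d n) \<longlongrightarrow> r) \<omega> \<Longrightarrow> 0 \<le> r"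
  using omega_nbot pos
  by (rule_tac tendsto_lowerbound[OF _ always_eventually]) (auto simp: less_imp_le)

lemma equiv_cone_rel: "equiv (cone_seqs \<omega> e d) (cone_rel \<omega> e d)"
proof (rule equivI)
  show "cone_rel \<omega> e d \<subseteq> cone_seqs \<omega> e d \<times> cone_seqs \<omega> e d"
    by (auto simp: cone_rel_def)
  show "refl_on (cone_seqs \<omega> e d) (cone_rel \<omega> e d)"
    by (auto simp: refl_on_def cone_rel_def)
  show "sym (cone_rel \<omega> e d)"
    by (auto simp: sym_def cone_rel_def intro: tendsto_scaled_commute)
  show "trans (cone_rel \<omega> e d)"
  proof (rule transI)
    fix x y z assume xy: "(x, y) \<in> cone_rel \<omega> e d" and yz: "(y, z) \<in> cone_rel \<omega> e d"
    then obtain t where t: "((\<lambda>n. dist (x n) (z n) / d n) \<longlongrightarrow> t) \<omega>"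
      using cone_seqs_tendsto[of x z] by (auto simp: cone_rel_def)
    have "t = 0"
      using tendsto_scaled_triangle[of x y 0 z 0 t] tendsto_scaled_nonneg[OF t] xy yz t
      by (auto simp: cone_rel_def)
    with t xy yz show "(x, z) \<in> cone_rel \<omega> e d" by (auto simp: cone_rel_def)
  qed
qed

lemma cone_dist_eqI:
  assumes p: "p \<in> asym_cone \<omega> e d" "x \<in> p" and q: "q \<in> asym_cone \<omega> e d" "y \<in> q"
    and r: "((\<lambda>n. dist (x n) (y n) / d n) \<longlongrightarrow> r) \<omega>"
  shows "cone_dist \<omega> e d p q = r"
proof -
  have "(THE r. \<exists>x\<in>p. \<exists>y\<in>q. ((\<lambda>n. dist (x n) (y n) / d n) \<longlongrightarrow> r) \<omega>) = r"
  proof (rule the_equality)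
    show "\<exists>x\<in>p. \<exists>y\<in>q. ((\<lambda>n. dist (x n) (y n) / d n) \<longlongrightarrow> r) \<omega>" using assms by blast
    fix s assume "\<exists>x\<in>p. \<exists>y\<in>q. ((\<lambda>n. dist (x n) (y n) / d n) \<longlongrightarrow> s) \<omega>"
    then obtain x' y' where x': "x' \<in> p" and y': "y' \<in> q"
      and s: "((\<lambda>n. dist (x' n) (y' n) / d n) \<longlongrightarrow> s) \<omega>" by blast
    have xx: "(x, x') \<in> cone_rel \<omega> e d" and yy: "(y, y') \<in> cone_rel \<omega> e d"
      using p q x' y' quotient_eq_iff[OF equiv_cone_rel] unfolding asym_cone_def by blast+
    then have "x \<in> cone_seqs \<omega> e d" "y' \<in> cone_seqs \<omega> e d" by (auto simp: cone_rel_def)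
    then obtain u where u: "((\<lambda>n. dist (x n) (y' n) / d n) \<longlongrightarrow> u) \<omega>"
      using cone_seqs_tendsto by blast
    have 1: "((\<lambda>n. dist (x n) (x' n) / d n) \<longlongrightarrow> 0) \<omega>" "((\<lambda>n. dist (y n) (y' n) / d n) \<longlongrightarrow> 0) \<omega>"
      using xx yy by (auto simp: cone_rel_def)
    have "u \<le> s" "s \<le> u" "u \<le> r" "r \<le> u"
      using tendsto_scaled_triangle[OF 1(1) s u]
        tendsto_scaled_triangle[OF tendsto_scaled_commute[OF 1(1)] u s]
        tendsto_scaled_triangle[OF r 1(2) u]
        tendsto_scaled_triangle[OF u tendsto_scaled_commute[OF 1(2)] r] by auto
    then show "s = r" by simp
  qed
  then show ?thesis using p(1) q(1) by (simp add: cone_dist_def)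
qed

lemma cone_repr:
  assumes "p \<in> asym_cone \<omega> e d"
  obtains x where "x \<in> p" "x \<in> cone_seqs \<omega> e d" "p = cone_point \<omega> e d x"
proof -
  obtain x where x: "x \<in> cone_seqs \<omega> e d" "p = cone_rel \<omega> e d `` {x}"
    using assms by (auto simp: asym_cone_def elim: quotientE)
  then have "x \<in> p" using equiv_class_self[OF equiv_cone_rel] by blast
  with x that show thesis by (simp add: cone_point_def)
qed

lemma Metric_space_cone: "Metric_space (asym_cone \<omega> e d) (cone_dist \<omega> e d)"
proof -
  have lim: "\<exists>x\<in>p. \<exists>y\<in>q. x \<in> cone_seqs \<omega> e d \<and> y \<in> cone_seqs \<omega> e d \<and>
      ((\<lambda>n. dist (x n) (y n) / d n) \<longlongrightarrow> cone_dist \<omega> e d p q) \<omega>"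
    if p: "p \<in> asym_cone \<omega> e d" and q: "q \<in> asym_cone \<omega> e d" for p q
  proof -
    obtain x where x: "x \<in> p" "x \<in> cone_seqs \<omega> e d" using cone_repr[OF p] .
    obtain y where y: "y \<in> q" "y \<in> cone_seqs \<omega> e d" using cone_repr[OF q] .
    obtain r where r: "((\<lambda>n. dist (x n) (y n) / d n) \<longlongrightarrow> r) \<omega>"
      using cone_seqs_tendsto[OF x(2) y(2)] ..
    with cone_dist_eqI[OF p x(1) q y(1) r] x y show ?thesis by blast
  qed
  have sym: "cone_dist \<omega> e d p q = cone_dist \<omega> e d q p" for p q
  proof -
    have "(\<lambda>r. \<exists>x\<in>p. \<exists>y\<in>q. ((\<lambda>n. dist (x n) (y n) / d n) \<longlongrightarrow> r) \<omega>) =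
          (\<lambda>r. \<exists>x\<in>q. \<exists>y\<in>p. ((\<lambda>n. dist (x n) (y n) / d n) \<longlongrightarrow> r) \<omega>)"
      by (intro ext iffI; elim bexE; intro bexI; (rule tendsto_scaled_commute)?; assumption)
    then show ?thesis unfolding cone_dist_def by auto
  qed
  have nonneg: "0 \<le> cone_dist \<omega> e d p q" if "p \<in> asym_cone \<omega> e d" "q \<in> asym_cone \<omega> e d" for p q
    using lim[OF that] tendsto_scaled_nonneg by blast
  have zero: "cone_dist \<omega> e d p q = 0 \<longleftrightarrow> p = q" 
    if p: "p \<in> asym_cone \<omega> e d" and q: "q \<in> asym_cone \<omega> e d" for p q
  proof
    assume "cone_dist \<omega> e d p q = 0"
    then obtain x y where "x \<in> p" "y \<in> q" "(x, y) \<in> cone_rel \<omega> e d"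
      using lim[OF p q] by (auto simp: cone_rel_def)
    then show "p = q" using quotient_eqI[OF equiv_cone_rel] p q unfolding asym_cone_def by blast
  next
    assume "p = q"
    then obtain x where "x \<in> p" "x \<in> q" using cone_repr[OF p] by blast
    then show "cone_dist \<omega> e d p q = 0" by (intro cone_dist_eqI[OF p _ q]) auto
  qed
  have tri: "cone_dist \<omega> e d p r \<le> cone_dist \<omega> e d p q + cone_dist \<omega> e d q r"
    if p: "p \<in> asym_cone \<omega> e d" and q: "q \<in> asym_cone \<omega> e d" and r: "r \<in> asym_cone \<omega> e d" for p q r
  proof -
    obtain x where x: "x \<in> p" "x \<in> cone_seqs \<omega> e d" using cone_repr[OF p] .
    obtain y where y: "y \<in> q" "y \<in> cone_seqs \<omega> e d" using cone_repr[OF q] .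
    obtain z where z: "z \<in> r" "z \<in> cone_seqs \<omega> e d" using cone_repr[OF r] .
    obtain a where a: "((\<lambda>n. dist (x n) (y n) / d n) \<longlongrightarrow> a) \<omega>"
      using cone_seqs_tendsto[OF x(2) y(2)] ..
    obtain b where b: "((\<lambda>n. dist (y n) (z n) / d n) \<longlongrightarrow> b) \<omega>"
      using cone_seqs_tendsto[OF y(2) z(2)] ..
    obtain c where c: "((\<lambda>n. dist (x n) (z n) / d n) \<longlongrightarrow> c) \<omega>"
      using cone_seqs_tendsto[OF x(2) z(2)] ..
    show ?thesis
      using tendsto_scaled_triangle[OF a b c] cone_dist_eqI[OF p x(1) q y(1) a]
        cone_dist_eqI[OF q y(1) r z(1) b] cone_dist_eqI[OF p x(1) r z(1) c] by simp
  qed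
  have "0 \<le> cone_dist \<omega> e d p q" for p q
    using nonneg[of p q] by (cases "p \<in> asym_cone \<omega> e d \<and> q \<in> asym_cone \<omega> e d") (auto simp: cone_dist_def)
  with sym zero tri show ?thesis by unfold_locales auto
qed

end

section \<open>Tree-graded and asymptotically tree-graded spaces\<close>

definition concat3 ::
    "(real \<Rightarrow> 'a) \<Rightarrow> real \<Rightarrow> (real \<Rightarrow> 'a) \<Rightarrow> real \<Rightarrow> (real \<Rightarrow> 'a) \<Rightarrow> real \<Rightarrow> 'a" where
  "concat3 g1 l1 g2 l2 g3 t =
     (if t \<le> l1 then g1 t else if t \<le> l1 + l2 then g2 (t - l1) else g3 (t - l1 - l2))"

text \<open>Injectivity on the half-open interval says that the loop is simple. Sides may have length
  \<open>0\<close>; if all three have, the triangle is a point.\<close>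

definition simple_geodesic_triangle ::
    "'a set \<Rightarrow> ('a \<Rightarrow> 'a \<Rightarrow> real) \<Rightarrow> 'a set \<Rightarrow> bool" where
  "simple_geodesic_triangle M d T \<longleftrightarrow>
     (\<exists>g1 l1 g2 l2 g3 l3.
        geodesic M d g1 l1 \<and> geodesic M d g2 l2 \<and> geodesic M d g3 l3 \<and>
        g1 l1 = g2 0 \<and> g2 l2 = g3 0 \<and> g3 l3 = g1 0 \<and>
        inj_on (concat3 g1 l1 g2 l2 g3) {0..<l1 + l2 + l3} \<and>
        T = concat3 g1 l1 g2 l2 g3 ` {0..l1 + l2 + l3})"

definition tree_graded :: "'a set \<Rightarrow> ('a \<Rightarrow> 'a \<Rightarrow> real) \<Rightarrow> 'a set set \<Rightarrow> bool" where
  "tree_graded M d \<P> \<longleftrightarrow>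
     Metric_space M d \<and> Metric_space.mcomplete M d \<and> geodesic_subset d M \<and>
     (\<forall>P\<in>\<P>. closedin (Metric_space.mtopology M d) P \<and> geodesic_subset d P) \<and>
     (\<forall>P\<in>\<P>. \<forall>Q\<in>\<P>. P \<noteq> Q \<longrightarrow> (\<forall>x\<in>P \<inter> Q. \<forall>y\<in>P \<inter> Q. x = y)) \<and>
     (\<forall>T. simple_geodesic_triangle M d T \<longrightarrow> (\<exists>P\<in>\<P>. T \<subseteq> P))"

text \<open>Boundedness of \<open>dist (e n) (A (i n)) / d n\<close> is meant \<open>\<omega>\<close>-almost surely, like every other
  condition on sequences in a cone.\<close>

definition cone_indices ::
    "nat filter \<Rightarrow> (nat \<Rightarrow> 'a::metric_space) \<Rightarrow> (nat \<Rightarrow> real) \<Rightarrow>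
     'i set \<Rightarrow> ('i \<Rightarrow> 'a set) \<Rightarrow> (nat \<Rightarrow> 'i) set" where
  "cone_indices \<omega> e d I A =
     {s. range s \<subseteq> I \<and> (\<exists>B. \<forall>\<^sub>F n in \<omega>. edist {e n} (A (s n)) / ereal (d n) \<le> ereal B)}"

text \<open>The last condition is the form of \<open>(T\<^sub>1)\<close> required of the limit sets. It refers to the
  indices and implies \<open>(T\<^sub>1)\<close> for the collection of limit sets, since two sequences of indices
  which agree \<open>\<omega>\<close>-almost surely have the same limit set.\<close>

definition asymptotically_tree_graded :: "'i set \<Rightarrow> ('i \<Rightarrow> 'a::metric_space set) \<Rightarrow> bool" where
  "asymptotically_tree_graded I A \<longleftrightarrow>
     (\<forall>\<omega> e d. nonprincipal_ultrafilter \<omega> \<and> (\<forall>n. 0 < d n) \<and> filterlim d at_top \<omega> \<longrightarrow>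
        tree_graded (asym_cone \<omega> e d) (cone_dist \<omega> e d)
          {cone_lim \<omega> e d (\<lambda>n. A (s n)) | s. s \<in> cone_indices \<omega> e d I A} \<and>
        (\<forall>s\<in>cone_indices \<omega> e d I A. \<forall>t\<in>cone_indices \<omega> e d I A.
           (\<forall>\<^sub>F n in \<omega>. s n \<noteq> t n) \<longrightarrow>
           (\<forall>x y. {x, y} \<subseteq> cone_lim \<omega> e d (\<lambda>n. A (s n)) \<inter> cone_lim \<omega> e d (\<lambda>n. A (t n)) \<longrightarrow> x = y)))"

end

theory Submission
  imports Defs
begin

text \<open>
  Let \<open>g\<close> be a quasi-inverse of \<open>q\<close>. Properties \<open>(\<alpha>\<^sub>1)\<close>, \<open>(\<alpha>\<^sub>2\<^sup>\<epsilon>)\<close> and \<open>(\<alpha>\<^sub>3)\<close> are obtained by pulling back: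
  \<open>g\<close> turns neighbourhoods of \<open>q(A)\<close> into slightly larger neighbourhoods of \<open>A\<close>, geodesics into
  quasi-geodesics, and fat geodesic polygons into fat quasi-geodesic polygons, with controlled
  constants, and \<open>q\<close> carries the conclusion back. This is why the primed properties, which speak of
  quasi-geodesics, are assumed of \<open>X\<close>, while only the geodesic versions are asserted of \<open>X'\<close>. The
  additive errors are harmless because short geodesics start near the set anyway, and because the
  fatness \<open>\<vartheta>\<close> may be chosen large.

  For asymptotically tree-graded spaces, \<open>q\<close> induces a bi-Lipschitz bijection from the cone of \<open>X\<close>
  with base points \<open>g(e\<^sub>n)\<close> onto the cone of \<open>X'\<close> with base points \<open>e\<^sub>n\<close>, since additive constants
  vanish after rescaling; it maps limit sets of \<open>A\<close> onto limit sets of \<open>q(A)\<close>. So it remains to see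
  that being tree-graded is invariant under bi-Lipschitz bijections between geodesic spaces
  (\<open>tree_graded_bilipschitz\<close>). This is not immediate, because both the geodesics inside the pieces
  and the simple geodesic triangles of the new space are merely paths in the old one. It follows
  from two purely topological properties of a tree-graded space: an arc whose ends lie in a piece is
  contained in the piece (\<open>arc_in_piece\<close>), and every simple loop is contained in a piece
  (\<open>loop_in_piece\<close>).

  Both rest on the gate of a point \<open>x\<close> in a piece \<open>P\<close>, the point where geodesics from \<open>x\<close> enter
  \<open>P\<close>. If there were two gates, the geodesics to them and a geodesic inside \<open>P\<close> would bound a simple
  triangle, which would have to lie in a piece sharing two points with \<open>P\<close>. The same kind of argument
  shows that the gate does not change along a geodesic, hence along a path, that misses \<open>P\<close>. So a
  path that leaves \<open>P\<close> returns to \<open>P\<close> at the point where it left, which an arc cannot do.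

  For a simple loop, choose two of its points, a geodesic between them and its midpoint \<open>z\<close>. One of
  the two arcs of the loop avoids \<open>z\<close>. A path can bypass a point \<open>z\<close> of a geodesic only through a piece
  \<open>P\<close> that contains \<open>z\<close> and in which the ends of the path have gates on either side of \<open>z\<close>
  (\<open>path_avoiding_piece\<close>). The arc passes through both gates, so the loop has two points in \<open>P\<close>, and
  then all of it lies in \<open>P\<close> by the statement about arcs.
\<close>

section \<open>Quasi-isometries and the properties of geodesics and polygons\<close>

lemma nbhd_mono: "x \<in> nbhd r S \<Longrightarrow> r \<le> r' \<Longrightarrow> x \<in> nbhd r' S"
  unfolding nbhd_iff using less_le_trans by blast

lemma qi_embedding_on_mono:
  assumes f: "qi_embedding_on L C S f" and L: "L \<le> L'" and C: "C \<le> C'"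
  shows "qi_embedding_on L' C' S f"
  unfolding qi_embedding_on_def
proof (intro conjI ballI)
  have 1: "1 \<le> L" "0 \<le> C" using f by (auto simp: qi_embedding_on_def)
  then show "1 \<le> L'" "0 \<le> C'" using L C by auto
  fix x y assume "x \<in> S" "y \<in> S"
  then have b: "1 / L * dist x y - C \<le> dist (f x) (f y)" "dist (f x) (f y) \<le> L * dist x y + C"
    using f by (auto simp: qi_embedding_on_def)
  have "1 / L' * dist x y \<le> 1 / L * dist x y" "L * dist x y \<le> L' * dist x y"
    using 1 L by (auto intro!: mult_right_mono divide_left_mono)
  with b C show "1 / L' * dist x y - C' \<le> dist (f x) (f y)" "dist (f x) (f y) \<le> L' * dist x y + C'"
    by linarith+
qed

lemma qi_embedding_onD:
  assumes "qi_embedding_on L C S f" "x \<in> S" "y \<in> S"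
  shows "dist (f x) (f y) \<le> L * dist x y + C" "dist x y \<le> L * (dist (f x) (f y) + C)"
proof -
  have L: "1 \<le> L" and b: "1 / L * dist x y - C \<le> dist (f x) (f y)" "dist (f x) (f y) \<le> L * dist x y + C"
    using assms by (auto simp: qi_embedding_on_def)
  show "dist (f x) (f y) \<le> L * dist x y + C" by (rule b)
  have "dist x y / L \<le> dist (f x) (f y) + C" using b(1) by simp
  then show "dist x y \<le> L * (dist (f x) (f y) + C)" using L by (simp add: pos_divide_le_eq mult.commute)
qed

text \<open>A single pair of constants serves the map, its quasi-inverse and both compositions.\<close>

locale quasi_inverses =
  fixes q :: "'a::metric_space \<Rightarrow> 'b::metric_space" and g :: "'b \<Rightarrow> 'a" and L C :: real
  assumes q: "qi_embedding_on L C UNIV q" and g: "qi_embedding_on L C UNIV g"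
    and gq: "dist (g (q x)) x \<le> C" and qg: "dist (q (g y)) y \<le> C"
begin

lemma constants: "1 \<le> L" "0 \<le> C"
  using q by (auto simp: qi_embedding_on_def)

lemmas q_upper = qi_embedding_onD(1)[OF q UNIV_I UNIV_I]
  and q_lower = qi_embedding_onD(2)[OF q UNIV_I UNIV_I]
  and g_upper = qi_embedding_onD(1)[OF g UNIV_I UNIV_I]
  and g_lower = qi_embedding_onD(2)[OF g UNIV_I UNIV_I]

lemma dist_image_le: "dist y (q a) \<le> L * dist (g y) a + 2 * C"
  using dist_triangle2[of y "q a" "q (g y)"] q_upper[of "g y" a] qg[of y]
  by (simp add: dist_commute)

lemma dist_preimage_le: "dist (g y) a \<le> L * dist y (q a) + 2 * C"
  using dist_triangle[of "g y" a "g (q a)"] g_upper[of y "q a"] gq[of a] by simp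

text \<open>Two additive constants occur: one from the upper bound for \<open>q\<close>, one from replacing \<open>y\<close> by
  \<open>q (g y)\<close>.\<close>

lemma nbhd_image:
  assumes "g y \<in> nbhd r S"
  shows "y \<in> nbhd (L * r + 2 * C) (q ` S)"
proof -
  obtain a where a: "a \<in> S" "dist (g y) a < r" using assms by (auto simp: nbhd_iff)
  then have "L * dist (g y) a < L * r" using constants by simp
  then have "dist y (q a) < L * r + 2 * C" using dist_image_le[of y a] by linarith
  with a(1) show ?thesis by (auto simp: nbhd_iff)
qed

lemma nbhd_preimage:
  assumes "y \<in> nbhd r (q ` S)"
  shows "g y \<in> nbhd (L * r + 2 * C) S"
proof -
  obtain a where a: "a \<in> S" "dist y (q a) < r" using assms by (auto simp: nbhd_iff)
  then have "L * dist y (q a) < L * r" using constants by simp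
  then have "dist (g y) a < L * r + 2 * C" using dist_preimage_le[of y a] by linarith
  with a(1) show ?thesis by (auto simp: nbhd_iff)
qed

lemma quasi_geodesic_preimage:
  assumes "geodesic UNIV dist c l"
  shows "quasi_geodesic L C (\<lambda>t. g (c t)) l"
proof -
  have c: "0 \<le> l" "\<And>s t. s \<in> {0..l} \<Longrightarrow> t \<in> {0..l} \<Longrightarrow> dist (c s) (c t) = dist s t"
    using assms by (auto simp: geodesic_def dist_real_def)
  have "1 / L * dist x y - C \<le> dist (g x) (g y) \<and> dist (g x) (g y) \<le> L * dist x y + C" for x y
    using g unfolding qi_embedding_on_def by simp
  then show ?thesis
    unfolding quasi_geodesic_def qi_embedding_on_def using c constants by metis
qed

lemma alpha1_image:
  assumes A: "alpha1 I A"
  shows "alpha1 I (\<lambda>i. q ` A i)"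
  unfolding alpha1_def
proof (intro allI impI)
  fix \<delta> :: real assume \<delta>: "0 < \<delta>"
  define \<delta>' where "\<delta>' = L * \<delta> + 2 * C"
  have "0 < \<delta>'" using \<delta> constants by (simp add: \<delta>'_def add_pos_nonneg)
  then obtain D where D: "\<And>i j. i \<in> I \<Longrightarrow> j \<in> I \<Longrightarrow> i \<noteq> j \<Longrightarrow>
      bounded (nbhd \<delta>' (A i) \<inter> nbhd \<delta>' (A j)) \<and> diameter (nbhd \<delta>' (A i) \<inter> nbhd \<delta>' (A j)) \<le> D"
    using A unfolding alpha1_def by meson
  define D' where "D' = L * (max D 0 + C)"
  have D'0: "0 \<le> D'" using constants by (simp add: D'_def)
  show "\<exists>D. \<forall>i\<in>I. \<forall>j\<in>I. i \<noteq> j \<longrightarrow>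
      bounded (nbhd \<delta> (q ` A i) \<inter> nbhd \<delta> (q ` A j)) \<and> diameter (nbhd \<delta> (q ` A i) \<inter> nbhd \<delta> (q ` A j)) \<le> D"
  proof (intro exI[of _ D'] ballI impI)
    fix i j assume ij: "i \<in> I" "j \<in> I" "i \<noteq> j"
    let ?N = "nbhd \<delta> (q ` A i) \<inter> nbhd \<delta> (q ` A j)"
    let ?N' = "nbhd \<delta>' (A i) \<inter> nbhd \<delta>' (A j)"
    have le: "dist x y \<le> D'" if "x \<in> ?N" "y \<in> ?N" for x y
    proof -
      have "g x \<in> ?N'" "g y \<in> ?N'" using nbhd_preimage that unfolding \<delta>'_def by blast+
      then have "dist (g x) (g y) \<le> max D 0"
        using diameter_bounded_bound[of ?N' "g x" "g y"] D[OF ij] by linarith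
      then have "L * (dist (g x) (g y) + C) \<le> D'" using constants by (simp add: D'_def)
      then show ?thesis using g_lower[of x y] by linarith
    qed
    then have "bounded ?N" unfolding bounded_two_points by blast
    moreover have "diameter ?N \<le> D'"
      unfolding diameter_def using D'0 le by (auto intro!: cSUP_least)
    ultimately show "bounded ?N \<and> diameter ?N \<le> D'" ..
  qed
qed

text \<open>The multiplicative error enters twice, once in the hypothesis on the endpoints of
  \<open>g \<circ> c\<close> and once in the factor \<open>1 / L\<close> of \<open>(\<alpha>\<^sub>2')\<close>; hence \<open>\<epsilon>\<close> is of the order of \<open>1 / L\<^sup>2\<close>.\<close>

lemma alpha2_image:
  assumes A: "alpha2' I A"
  shows "alpha2 (1 / (4 * L\<^sup>2)) I (\<lambda>i. q ` A i)"
  unfolding alpha2_def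
proof (intro allI impI)
  fix \<theta> :: real assume \<theta>: "0 \<le> \<theta> \<and> \<theta> < 1 / (4 * L\<^sup>2)"
  have L: "1 \<le> L" "0 \<le> C" by (rule constants)+
  obtain M where M: "0 < M" "\<And>c l i. i \<in> I \<Longrightarrow> quasi_geodesic L C c l \<Longrightarrow>
      c 0 \<in> nbhd (3 / 8 * l / L) (A i) \<Longrightarrow> c l \<in> nbhd (3 / 8 * l / L) (A i) \<Longrightarrow>
      c ` {0..l} \<inter> nbhd M (A i) \<noteq> {}"
  proof -
    have "\<exists>M>0. \<forall>c l. \<forall>i\<in>I. quasi_geodesic L C c l \<and>
        c 0 \<in> nbhd (3 / 8 * l / L) (A i) \<and> c l \<in> nbhd (3 / 8 * l / L) (A i) \<longrightarrow>
        c ` {0..l} \<inter> nbhd M (A i) \<noteq> {}"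
      by (rule A[unfolded alpha2'_def, rule_format]) (use L in auto)
    with that show thesis by blast
  qed
  define M' where "M' = L * M + 2 * C + 16 * C * L"
  have M'0: "0 < M'" using L M(1) by (simp add: M'_def add_pos_nonneg)
  have "c ` {0..l} \<inter> nbhd M' (q ` A i) \<noteq> {}"
    if i: "i \<in> I" and c: "geodesic UNIV dist c l"
      and ends: "c 0 \<in> nbhd (\<theta> * l) (q ` A i)" "c l \<in> nbhd (\<theta> * l) (q ` A i)" for c l i
  proof (cases "l \<le> 16 * C * L")
    \<comment> \<open>A short geodesic starts close to the set.\<close>
    case True
    have l: "0 \<le> l" using c by (simp add: geodesic_def)
    have "1 \<le> 4 * L\<^sup>2" using one_le_power[OF L(1), of 2] by linarith
    then have "1 / (4 * L\<^sup>2) \<le> 1" by (simp add: divide_le_eq)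
    then have "\<theta> * l \<le> l" using \<theta> l by (intro mult_left_le_one_le) auto
    also have "\<dots> \<le> M'" using True L M(1) by (simp add: M'_def add_increasing)
    finally have "c 0 \<in> nbhd M' (q ` A i)" by (rule nbhd_mono[OF ends(1)])
    moreover have "0 \<in> {0..l}" using l by simp
    ultimately show ?thesis by blast
  next
    \<comment> \<open>On a long geodesic the additive error is absorbed by enlarging \<open>1 / 4\<close> to \<open>3 / 8\<close>.\<close>
    case False
    then have l: "16 * C * L < l" "0 \<le> l" using c by (auto simp: geodesic_def)
    have "L * (\<theta> * l) \<le> L * (1 / (4 * L\<^sup>2) * l)"
      using L l \<theta> by (intro mult_left_mono mult_right_mono) auto
    also have "\<dots> = l / (4 * L)" using L by (simp add: power2_eq_square)
    finally have "L * (\<theta> * l) \<le> l / (4 * L)" .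
    moreover have "2 * C \<le> l / (8 * L)" using l L by (simp add: pos_le_divide_eq mult.commute mult.left_commute)
    moreover have "l / (4 * L) + l / (8 * L) = 3 / 8 * l / L" using L by (simp add: field_simps)
    ultimately have r: "L * (\<theta> * l) + 2 * C \<le> 3 / 8 * l / L" by linarith
    have "g (c t) \<in> nbhd (3 / 8 * l / L) (A i)" if "c t \<in> nbhd (\<theta> * l) (q ` A i)" for t
      using nbhd_mono[OF nbhd_preimage[OF that] r] .
    then have "(\<lambda>t. g (c t)) ` {0..l} \<inter> nbhd M (A i) \<noteq> {}"
      using M(2)[OF i quasi_geodesic_preimage[OF c]] ends by blast
    then obtain t where t: "t \<in> {0..l}" "g (c t) \<in> nbhd M (A i)" by blast
    have "0 \<le> 16 * C * L" using L by simp
    then have "c t \<in> nbhd M' (q ` A i)"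
      using nbhd_mono[OF nbhd_image[OF t(2)]] by (simp add: M'_def)
    with t(1) show ?thesis by blast
  qed
  with M'0 show "\<exists>M>0. \<forall>c l. \<forall>i\<in>I. geodesic UNIV dist c l \<and> c 0 \<in> nbhd (\<theta> * l) (q ` A i) \<and>
      c l \<in> nbhd (\<theta> * l) (q ` A i) \<longrightarrow> c ` {0..l} \<inter> nbhd M (q ` A i) \<noteq> {}"
    by blast
qed

text \<open>Distances at least \<open>L (\<theta> + C)\<close> stay at least \<open>\<theta>\<close> under \<open>g\<close>. Points within \<open>2 L (\<theta> + C)\<close> of a vertex
  are moved by \<open>g\<close> to within \<open>2 L\<^sup>2 \<theta>\<close> of it, up to a constant that the last summand of the new
  \<open>\<sigma> = 2 L\<^sup>2 + 1\<close> absorbs for large \<open>\<theta>\<close>.\<close>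

lemma fat_polygon_preimage:
  assumes fat: "fat_polygon (L * (\<theta> + C)) 2 \<nu> k p l"
    and \<theta>: "2 * L\<^sup>2 * C + C \<le> \<theta>" and \<nu>: "1 \<le> \<nu>"
  shows "fat_polygon \<theta> (2 * L\<^sup>2 + 1) \<nu> k (\<lambda>i t. g (p i t)) l"
proof -
  let ?\<theta> = "L * (\<theta> + C)" and ?p = "\<lambda>i t. g (p i t)"
  have L: "1 \<le> L" "0 \<le> C" by (rule constants)+
  have edge: "edge ?p l i = g ` edge p l i" for i by (auto simp: edge_def)
  have far: "r \<le> dist (g u) (g w)" if "L * (r + C) \<le> dist u w" for r u w
  proof -
    have "L * (r + C) \<le> L * (dist (g u) (g w) + C)" using that g_lower[of u w] by linarith
    then show ?thesis using L by simp
  qed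
  have F1: "\<theta> \<le> dist x y"
    if i: "i < k" and x: "x \<in> edge ?p l i - nbhd ((2 * L\<^sup>2 + 1) * \<theta>) {?p i 0, ?p i (l i)}"
      and y: "y \<in> (\<Union>j\<in>{..<k} - {i}. edge ?p l j)" for i x y
  proof -
    obtain u where u: "u \<in> edge p l i" "x = g u" using x edge by blast
    obtain w where w: "w \<in> (\<Union>j\<in>{..<k} - {i}. edge p l j)" "y = g w" using y edge by auto
    have "u \<notin> nbhd (2 * ?\<theta>) {p i 0, p i (l i)}"
    proof
      assume "u \<in> nbhd (2 * ?\<theta>) {p i 0, p i (l i)}"
      then obtain v where v: "v \<in> {p i 0, p i (l i)}" "dist u v < 2 * ?\<theta>" by (auto simp: nbhd_iff)
      have "L * dist u v < L * (2 * ?\<theta>)" using v(2) L by simp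
      then have "dist (g u) (g v) < L * (2 * ?\<theta>) + C" using g_upper[of u v] by linarith
      also have "\<dots> = 2 * L\<^sup>2 * \<theta> + (2 * L\<^sup>2 * C + C)" by (simp add: power2_eq_square algebra_simps)
      also have "\<dots> \<le> (2 * L\<^sup>2 + 1) * \<theta>" using \<theta> by (simp add: algebra_simps)
      finally have "x \<in> nbhd ((2 * L\<^sup>2 + 1) * \<theta>) {?p i 0, ?p i (l i)}"
        using v(1) u(2) by (auto simp: nbhd_iff)
      with x show False by blast
    qed
    then have "?\<theta> \<le> dist u w"
      using fat i u(1) w(1) unfolding fat_polygon_def edist_ge_iff by blast
    then show ?thesis using far u(2) w(2) by blast
  qed
  have F2: "\<nu> * \<theta> \<le> dist (?p i 0) y"
    if i: "i < k" and y: "y \<in> (\<Union>j\<in>{..<k} - {i, (i + k - 1) mod k}. edge ?p l j)" for i y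
  proof -
    obtain w where w: "w \<in> (\<Union>j\<in>{..<k} - {i, (i + k - 1) mod k}. edge p l j)" "y = g w"
      using y edge by auto
    have "\<nu> * ?\<theta> \<le> dist (p i 0) w"
      using fat i w(1) unfolding fat_polygon_def edist_ge_iff by blast
    moreover have "L * (\<nu> * \<theta> + C) \<le> \<nu> * ?\<theta>"
    proof -
      have "L * C \<le> \<nu> * (L * C)" using \<nu> L mult_right_mono[of 1 \<nu> "L * C"] by simp
      then show ?thesis by (simp add: algebra_simps)
    qed
    ultimately show ?thesis using far[of "\<nu> * \<theta>" "p i 0" w] w(2) by simp
  qed
  show ?thesis
    unfolding fat_polygon_def edist_ge_iff using F1 F2 by blast
qed

lemma alpha3_image:
  assumes A: "alpha3' I A"
  shows "alpha3 I (\<lambda>i. q ` A i)"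
  unfolding alpha3_def
proof (intro allI impI)
  fix k :: nat assume k: "2 \<le> k"
  define \<sigma> where "\<sigma> = 2 * L\<^sup>2 + 1"
  define \<nu> where "\<nu> = 4 * \<sigma>"
  have L: "1 \<le> L" "0 \<le> C" by (rule constants)+
  then have "1 \<le> L\<^sup>2" by simp
  then have \<sigma>: "1 \<le> \<sigma>" "8 \<le> \<nu>" by (auto simp: \<sigma>_def \<nu>_def)
  have "1 \<le> L \<and> 0 \<le> C \<and> 2 \<le> k \<and> 1 \<le> \<sigma> \<and> 4 * \<sigma> \<le> \<nu>" using L k \<sigma> by (simp add: \<nu>_def)
  then obtain \<theta>0 c where A': "0 < \<theta>0" "\<And>\<theta> p l. \<theta>0 \<le> \<theta> \<Longrightarrow> quasi_geodesic_polygon L C k p l \<Longrightarrow>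
      fat_polygon \<theta> \<sigma> \<nu> k p l \<Longrightarrow> \<exists>i\<in>I. polygon_set k p l \<subseteq> nbhd (\<sigma> * L\<^sup>2 * \<theta> + c) (A i)"
    using A unfolding alpha3'_def by meson
  define \<theta> where "\<theta> = max \<theta>0 (2 * L\<^sup>2 * C + C)"
  have \<theta>: "\<theta>0 \<le> \<theta>" "2 * L\<^sup>2 * C + C \<le> \<theta>" by (auto simp: \<theta>_def)
  define r where "r = \<sigma> * L\<^sup>2 * \<theta> + c"
  \<comment> \<open>The maximum only ensures positivity, as \<open>c\<close> may be negative.\<close>
  define R where "R = max 1 (L * r + 2 * C)"
  have main: "\<exists>i\<in>I. polygon_set k p l \<subseteq> nbhd R (q ` A i)"
    if p: "geodesic_polygon k p l" and fat: "fat_polygon (L * (\<theta> + C)) 2 \<nu> k p l" for p l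
  proof -
    let ?p = "\<lambda>i t. g (p i t)"
    have "quasi_geodesic_polygon L C k ?p l"
      using p quasi_geodesic_preimage
      unfolding quasi_geodesic_polygon_def geodesic_polygon_def closed_chain_def by auto
    moreover have "fat_polygon \<theta> \<sigma> \<nu> k ?p l"
      unfolding \<sigma>_def by (rule fat_polygon_preimage[OF fat \<theta>(2)]) (use \<sigma> in simp)
    ultimately obtain i where i: "i \<in> I" "polygon_set k ?p l \<subseteq> nbhd r (A i)"
      using A'(2)[OF \<theta>(1)] unfolding r_def by blast
    have "y \<in> nbhd R (q ` A i)" if "y \<in> polygon_set k p l" for y
    proof -
      have "g y \<in> polygon_set k ?p l" using that unfolding polygon_set_def edge_def by auto
      then have "g y \<in> nbhd r (A i)" using i(2) by blast
      then have "y \<in> nbhd (L * r + 2 * C) (q ` A i)" by (rule nbhd_image)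
      then show ?thesis by (rule nbhd_mono) (simp add: R_def)
    qed
    with i(1) show ?thesis by blast
  qed
  have "0 < L * (\<theta> + C)" using L A'(1) \<theta>(1) by (intro mult_pos_pos) auto
  moreover have "0 < R" by (simp add: R_def)
  ultimately show "\<exists>\<theta>>0. \<exists>\<nu>\<ge>8. \<exists>R>0. \<forall>p l. geodesic_polygon k p l \<and> fat_polygon \<theta> 2 \<nu> k p l \<longrightarrow>
      (\<exists>i\<in>I. polygon_set k p l \<subseteq> nbhd R (q ` A i))"
    using main \<sigma>(2) by blast
qed

end

lemma quasi_isometry_quasi_inverses:
  assumes "quasi_isometry q"
  obtains g L C where "quasi_inverses q g L C"
proof -
  obtain L1 C1 g L2 C2 D1 D2 where
    q: "qi_embedding_on L1 C1 UNIV q" and g: "qi_embedding_on L2 C2 UNIV g"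
    and D1: "\<And>x. dist (g (q x)) x \<le> D1" and D2: "\<And>y. dist (q (g y)) y \<le> D2"
    using assms unfolding quasi_isometry_def by metis
  define C where "C = max (max C1 C2) (max D1 D2)"
  have "quasi_inverses q g (max L1 L2) C"
  proof
    show "qi_embedding_on (max L1 L2) C UNIV q"
      by (rule qi_embedding_on_mono[OF q]) (auto simp: C_def)
    show "qi_embedding_on (max L1 L2) C UNIV g"
      by (rule qi_embedding_on_mono[OF g]) (auto simp: C_def)
    show "dist (g (q x)) x \<le> C" for x using D1[of x] by (auto simp: C_def)
    show "dist (q (g y)) y \<le> C" for y using D2[of y] by (auto simp: C_def)
  qed
  then show thesis by (rule that)
qed

section \<open>Paths and geodesic segments in carrier-based metric spaces\<close>

context Metric_space
begin

definition path_on :: "(real \<Rightarrow> 'a) \<Rightarrow> real \<Rightarrow> real \<Rightarrow> bool" where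
  "path_on c a b \<longleftrightarrow> continuous_map (top_of_set {a..b}) mtopology c"

lemma path_on_iff:
  "path_on c a b \<longleftrightarrow>
     (\<forall>t\<in>{a..b}. c t \<in> M \<and> (\<forall>\<epsilon>>0. \<exists>\<delta>>0. \<forall>s\<in>{a..b}. \<bar>s - t\<bar> < \<delta> \<longrightarrow> c s \<in> M \<and> d (c t) (c s) < \<epsilon>))"
  (is "?L \<longleftrightarrow> ?R")
proof
  assume ?L
  show ?R
  proof (intro ballI conjI allI impI)
    fix t :: real assume t: "t \<in> {a..b}"
    from \<open>?L\<close> t show "c t \<in> M"
      unfolding path_on_def continuous_map_def by auto
    fix \<epsilon> :: real assume "0 < \<epsilon>"
    with \<open>?L\<close> t obtain U where U: "openin (top_of_set {a..b}) U" "t \<in> U" "\<forall>y\<in>U. c y \<in> mball (c t) \<epsilon>"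
      unfolding path_on_def continuous_map_to_metric by (metis topspace_euclidean_subtopology)
    then obtain \<delta> where "0 < \<delta>" "\<forall>s\<in>{a..b}. dist s t < \<delta> \<longrightarrow> s \<in> U"
      unfolding openin_euclidean_subtopology_iff by blast
    with U show "\<exists>\<delta>>0. \<forall>s\<in>{a..b}. \<bar>s - t\<bar> < \<delta> \<longrightarrow> c s \<in> M \<and> d (c t) (c s) < \<epsilon>"
      by (metis dist_real_def in_mball)
  qed
next
  assume R: ?R
  show ?L
    unfolding path_on_def continuous_map_to_metric
  proof (intro ballI allI impI)
    fix t and \<epsilon> :: real assume "t \<in> topspace (top_of_set {a..b})" "0 < \<epsilon>"
    then have t: "t \<in> {a..b}" "c t \<in> M" using R by auto
    with R \<open>0 < \<epsilon>\<close>
    obtain \<delta> where \<delta>: "0 < \<delta>" "\<forall>s\<in>{a..b}. \<bar>s - t\<bar> < \<delta> \<longrightarrow> c s \<in> M \<and> d (c t) (c s) < \<epsilon>"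
      by blast
    have "openin (top_of_set {a..b}) ({a..b} \<inter> ball t \<delta>)"
      by (simp add: openin_open_Int)
    with \<delta> t show "\<exists>U. openin (top_of_set {a..b}) U \<and> t \<in> U \<and> (\<forall>y\<in>U. c y \<in> mball (c t) \<epsilon>)"
      by (intro exI[of _ "{a..b} \<inter> ball t \<delta>"]) (auto simp: dist_real_def abs_minus_commute)
  qed
qed

lemma path_onD: "path_on c a b \<Longrightarrow> t \<in> {a..b} \<Longrightarrow> c t \<in> M"
  by (simp add: path_on_iff)

lemma path_on_close:
  assumes "path_on c a b" "t \<in> {a..b}" "0 < \<epsilon>"
  shows "\<exists>\<delta>>0. \<forall>s\<in>{a..b}. \<bar>s - t\<bar> < \<delta> \<longrightarrow> d (c t) (c s) < \<epsilon>"
  using assms unfolding path_on_iff by blast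

lemma path_on_eventually_close:
  assumes "path_on c a b" "t \<in> {a..b}" "0 < \<epsilon>"
  shows "\<forall>\<^sub>F s in at t within {a..b}. s \<in> {a..b} \<and> d (c t) (c s) < \<epsilon>"
  using path_on_close[OF assms] unfolding eventually_at dist_real_def by blast

lemma lipschitz_path_on:
  assumes M: "\<And>t. t \<in> {a..b} \<Longrightarrow> c t \<in> M"
    and L: "\<And>s t. s \<in> {a..b} \<Longrightarrow> t \<in> {a..b} \<Longrightarrow> d (c s) (c t) \<le> L * \<bar>s - t\<bar>"
  shows "path_on c a b"
  unfolding path_on_iff
proof (intro ballI conjI allI impI)
  fix t and \<epsilon> :: real assume t: "t \<in> {a..b}" and \<epsilon>: "0 < \<epsilon>"
  define \<delta> where "\<delta> = \<epsilon> / (\<bar>L\<bar> + 1)"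
  have "0 < \<delta>" using \<epsilon> by (simp add: \<delta>_def)
  moreover have "d (c t) (c s) < \<epsilon>" if "s \<in> {a..b}" "\<bar>s - t\<bar> < \<delta>" for s
  proof -
    have "d (c t) (c s) \<le> (\<bar>L\<bar> + 1) * \<bar>s - t\<bar>"
    proof -
      have "d (c t) (c s) \<le> L * \<bar>s - t\<bar>" using L[OF t that(1)] by (simp add: abs_minus_commute)
      also have "\<dots> \<le> (\<bar>L\<bar> + 1) * \<bar>s - t\<bar>" by (rule mult_right_mono) auto
      finally show ?thesis .
    qed
    also have "\<dots> < (\<bar>L\<bar> + 1) * \<delta>"
      by (rule mult_strict_left_mono) (use that in auto)
    finally show ?thesis by (simp add: \<delta>_def)
  qed
  ultimately show "\<exists>\<delta>>0. \<forall>s\<in>{a..b}. \<bar>s - t\<bar> < \<delta> \<longrightarrow> c s \<in> M \<and> d (c t) (c s) < \<epsilon>"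
    using M by blast
qed (use M in auto)

lemma path_on_mono: "path_on c a b \<Longrightarrow> {s..t} \<subseteq> {a..b} \<Longrightarrow> path_on c s t"
  unfolding path_on_def by (rule continuous_map_from_subtopology_mono)

lemma path_on_reverse:
  assumes "path_on c a b"
  shows "path_on (\<lambda>t. c (a + b - t)) a b"
  unfolding path_on_iff
proof (intro ballI conjI allI impI)
  fix t and \<epsilon> :: real assume t: "t \<in> {a..b}" and \<epsilon>: "0 < \<epsilon>"
  then have t': "a + b - t \<in> {a..b}" by auto
  obtain \<delta> where \<delta>: "0 < \<delta>"
      "\<forall>s\<in>{a..b}. \<bar>s - (a + b - t)\<bar> < \<delta> \<longrightarrow> d (c (a + b - t)) (c s) < \<epsilon>"
    using path_on_close[OF assms t' \<epsilon>] by blast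
  have "c (a + b - s) \<in> M \<and> d (c (a + b - t)) (c (a + b - s)) < \<epsilon>" if "s \<in> {a..b}" "\<bar>s - t\<bar> < \<delta>" for s
    using that path_onD[OF assms, of "a + b - s"] \<delta>(2)[rule_format, of "a + b - s"] by auto
  with \<delta>(1) show "\<exists>\<delta>>0. \<forall>s\<in>{a..b}. \<bar>s - t\<bar> < \<delta> \<longrightarrow>
      c (a + b - s) \<in> M \<and> d (c (a + b - t)) (c (a + b - s)) < \<epsilon>" by blast
qed (use path_onD[OF assms] in auto)

lemma path_on_first_hit:
  assumes c: "path_on c a b" and K: "closedin mtopology K" and t0: "t0 \<in> {a..b}" "c t0 \<in> K"
  obtains t where "t \<in> {a..t0}" "c t \<in> K" "\<And>s. s \<in> {a..<t} \<Longrightarrow> c s \<notin> K"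
proof -
  define T where "T = {s \<in> {a..b}. c s \<in> K}"
  have "closedin (top_of_set {a..b}) T"
    using closedin_continuous_map_preimage[OF c[unfolded path_on_def] K] by (simp add: T_def)
  then have "compact T"
    using closedin_compact[OF compact_Icc] by blast
  moreover have "t0 \<in> T" using t0 by (simp add: T_def)
  ultimately obtain t where t: "t \<in> T" "\<And>s. s \<in> T \<Longrightarrow> t \<le> s"
    using compact_attains_inf[of T] by blast
  show thesis
  proof (rule that)
    show "t \<in> {a..t0}" "c t \<in> K"
      using t \<open>t0 \<in> T\<close> by (auto simp: T_def)
    show "c s \<notin> K" if "s \<in> {a..<t}" for s
      using t(2)[of s] t(1) that by (force simp: T_def)
  qed
qed

lemma path_on_last_hit:
  assumes c: "path_on c a b" and K: "closedin mtopology K" and t0: "t0 \<in> {a..b}" "c t0 \<in> K"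
  obtains t where "t \<in> {t0..b}" "c t \<in> K" "\<And>s. s \<in> {t<..b} \<Longrightarrow> c s \<notin> K"
proof -
  obtain t where t: "t \<in> {a..a + b - t0}" "c (a + b - t) \<in> K" "\<And>s. s \<in> {a..<t} \<Longrightarrow> c (a + b - s) \<notin> K"
    using path_on_first_hit[OF path_on_reverse[OF c] K, of "a + b - t0"] t0 by auto
  show thesis
  proof (rule that)
    show "a + b - t \<in> {t0..b}" "c (a + b - t) \<in> K"
      using t by auto
    show "c s \<notin> K" if "s \<in> {a + b - t<..b}" for s
      using t(3)[of "a + b - s"] that by auto
  qed
qed

lemma closedin_positive_distance:
  assumes "closedin mtopology K" "x \<in> M" "x \<notin> K"
  obtains r where "0 < r" "\<And>y. y \<in> K \<Longrightarrow> r \<le> d x y"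
proof -
  obtain r where r: "0 < r" "disjnt K (mball x r)"
    using assms unfolding closedin_metric by blast
  have "K \<subseteq> M" using assms(1) closedin_metric by blast
  then have "r \<le> d x y" if "y \<in> K" for y
    using r assms that by (force simp: disjnt_iff)
  with r that show thesis by blast
qed

text \<open>Segments are handled as point sets, because cutting and gluing parametrisations obscures
  arguments that only ask which points are shared.\<close>

definition seg :: "'a \<Rightarrow> 'a \<Rightarrow> 'a set \<Rightarrow> bool" where
  "seg x y S \<longleftrightarrow> (\<exists>c l. geodesic M d c l \<and> c 0 = x \<and> c l = y \<and> S = c ` {0..l})"

text \<open>A segment is a set on which the distance from one endpoint is an isometry onto an interval.
  In this form reversal, subsegments and concatenation become statements about real numbers.\<close>

lemma seg_iff:
  "seg x y S \<longleftrightarrow> S \<subseteq> M \<and> x \<in> S \<and> y \<in> S \<and> (\<forall>w\<in>S. d x w \<le> d x y) \<and>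
     (\<forall>w\<in>S. \<forall>w'\<in>S. d w w' = \<bar>d x w - d x w'\<bar>) \<and> (\<forall>t. 0 \<le> t \<and> t \<le> d x y \<longrightarrow> (\<exists>w\<in>S. d x w = t))"
  (is "_ \<longleftrightarrow> ?R")
proof
  assume "seg x y S"
  then obtain c l where c: "geodesic M d c l" "c 0 = x" "c l = y" "S = c ` {0..l}"
    unfolding seg_def by blast
  have l: "0 \<le> l" and dc: "\<And>s t. s \<in> {0..l} \<Longrightarrow> t \<in> {0..l} \<Longrightarrow> d (c s) (c t) = \<bar>s - t\<bar>"
    using c(1) by (auto simp: geodesic_def)
  have dx: "d x (c t) = t" if "t \<in> {0..l}" for t
    using dc[of 0 t] that c(2) by auto
  have dxy: "d x y = l" using dx[of l] l c by auto
  have "S \<subseteq> M" "x \<in> S" "y \<in> S"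
    using c l by (auto simp: geodesic_def)
  moreover have "\<exists>w\<in>S. d x w = t" if "0 \<le> t" "t \<le> l" for t
    using dx[of t] that c(4) by auto
  moreover have "d w w' = \<bar>d x w - d x w'\<bar>" if "w \<in> S" "w' \<in> S" for w w'
    using that c(4) dx dc by force
  moreover have "d x w \<le> l" if "w \<in> S" for w
    using that c(4) dx by force
  ultimately show ?R unfolding dxy by blast
next
  assume R: ?R
  then have mem: "S \<subseteq> M" "x \<in> S" "y \<in> S" and le: "\<And>w. w \<in> S \<Longrightarrow> d x w \<le> d x y"
    and iso: "\<And>w w'. w \<in> S \<Longrightarrow> w' \<in> S \<Longrightarrow> d w w' = \<bar>d x w - d x w'\<bar>"
    and surj: "\<And>t. 0 \<le> t \<Longrightarrow> t \<le> d x y \<Longrightarrow> \<exists>w. w \<in> S \<and> d x w = t" by blast+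
  define c where "c t = (SOME w. w \<in> S \<and> d x w = t)" for t
  have c: "c t \<in> S" "d x (c t) = t" if "t \<in> {0..d x y}" for t
    using someI_ex[OF surj[of t]] that unfolding c_def by auto
  have inj: "w = w'" if "w \<in> S" "w' \<in> S" "d x w = d x w'" for w w'
  proof -
    have "d w w' = 0" using iso[of w w'] that by linarith
    then show ?thesis using that mem zero[of w w'] by blast
  qed
  have "d (c s) (c t) = \<bar>s - t\<bar>" if "s \<in> {0..d x y}" "t \<in> {0..d x y}" for s t
    using iso[OF c(1) c(1), OF that] c(2) that by simp
  then have "geodesic M d c (d x y)"
    unfolding geodesic_def using c(1) mem by auto
  moreover have "c 0 = x" "c (d x y) = y"
    using inj[of "c 0" x] inj[of "c (d x y)" y] c[of 0] c[of "d x y"] mem by auto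
  moreover have "S = c ` {0..d x y}"
  proof
    show "S \<subseteq> c ` {0..d x y}"
    proof
      fix w assume w: "w \<in> S"
      then have "w = c (d x w)" "d x w \<in> {0..d x y}"
        using inj[of w "c (d x w)"] c[of "d x w"] le by auto
      then show "w \<in> c ` {0..d x y}" by blast
    qed
  qed (use c in auto)
  ultimately show "seg x y S" unfolding seg_def by blast
qed

lemma segD:
  assumes "seg x y S"
  shows "S \<subseteq> M" "x \<in> S" "y \<in> S" "x \<in> M" "y \<in> M"
  using assms unfolding seg_iff by blast+

lemma seg_le: "seg x y S \<Longrightarrow> w \<in> S \<Longrightarrow> d x w \<le> d x y"
  unfolding seg_iff by blast

lemma seg_dist: "seg x y S \<Longrightarrow> w \<in> S \<Longrightarrow> w' \<in> S \<Longrightarrow> d w w' = \<bar>d x w - d x w'\<bar>"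
  unfolding seg_iff by blast

lemma seg_between: "seg x y S \<Longrightarrow> w \<in> S \<Longrightarrow> d x w + d w y = d x y"
  using seg_dist[of x y S w y] seg_le[of x y S w] segD(3)[of x y S] by linarith

lemma seg_trivial: "x \<in> M \<Longrightarrow> seg x x {x}"
  by (auto simp: seg_iff)

lemma seg_sym:
  assumes "seg x y S"
  shows "seg y x S"
proof -
  have b: "d y w = d x y - d x w" if "w \<in> S" for w
    using seg_between[OF assms that] by (simp add: commute)
  show ?thesis
    unfolding seg_iff
  proof (intro conjI allI impI ballI)
    fix t assume "0 \<le> t \<and> t \<le> d y x"
    then have "0 \<le> d x y - t" "d x y - t \<le> d x y" by (auto simp: commute)
    then obtain w where "w \<in> S" "d x w = d x y - t"
      using assms unfolding seg_iff by blast
    then show "\<exists>w\<in>S. d y w = t" using b[of w] by (intro bexI[of _ w]) auto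
  next
    fix w assume "w \<in> S"
    then show "d y w \<le> d y x" using b by (simp add: commute)
  next
    fix w w' assume "w \<in> S" "w' \<in> S"
    then show "d w w' = \<bar>d y w - d y w'\<bar>" using seg_dist[OF assms, of w w'] b[of w] b[of w'] by linarith
  qed (use segD[OF assms] in auto)
qed

definition subseg :: "'a set \<Rightarrow> 'a \<Rightarrow> 'a \<Rightarrow> 'a set" where
  "subseg S u v = {w \<in> S. d u w + d w v = d u v}"

lemma subseg_subset: "subseg S u v \<subseteq> S"
  by (auto simp: subseg_def)

lemma subseg_sym: "subseg S u v = subseg S v u"
  by (auto simp: subseg_def commute add.commute)

lemma seg_subseg:
  assumes S: "seg x y S" and u: "u \<in> S" and v: "v \<in> S"
  shows "seg u v (subseg S u v)"
proof -
  have D: "d w w' = \<bar>d x w - d x w'\<bar>" if "w \<in> S" "w' \<in> S" for w w'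
    using seg_dist[OF S] that .
  show ?thesis
    unfolding seg_iff
  proof (intro conjI allI impI ballI)
    show "subseg S u v \<subseteq> M" using subseg_subset segD[OF S] by blast
    show "u \<in> subseg S u v" "v \<in> subseg S u v" using u v segD[OF S] by (auto simp: subseg_def)
  next
    fix w assume w: "w \<in> subseg S u v"
    then show "d u w \<le> d u v" using nonneg[of w v] by (simp add: subseg_def del: nonneg)
  next
    fix w w' assume w: "w \<in> subseg S u v" "w' \<in> subseg S u v"
    then have "w \<in> S" "w' \<in> S" "d u w + d w v = d u v" "d u w' + d w' v = d u v"
      by (auto simp: subseg_def)
    with D[of w w'] D[of u w] D[of u w'] D[of w v] D[of w' v] D[of u v] u v
    show "d w w' = \<bar>d u w - d u w'\<bar>" by linarith
  next
    fix t assume t: "0 \<le> t \<and> t \<le> d u v"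
    define r where "r = (if d x u \<le> d x v then d x u + t else d x u - t)"
    have le: "d x u \<le> d x y" "d x v \<le> d x y" using seg_le[OF S] u v by auto
    have "0 \<le> r" "r \<le> d x y"
      using t le D[OF u v] nonneg[of x u] nonneg[of x v]
      by (cases "d x u \<le> d x v"; simp only: r_def if_True if_False; linarith)+
    then obtain w where w: "w \<in> S" "d x w = r" using S unfolding seg_iff by blast
    then have "d u w = t" "d u w + d w v = d u v"
      using D[of u w] D[of w v] D[of u v] u v t by (auto simp: r_def split: if_splits)
    with w show "\<exists>w\<in>subseg S u v. d u w = t" by (auto simp: subseg_def)
  qed
qed

lemma seg_concat:
  assumes S: "seg x y S" and T: "seg y z T" and xz: "d x z = d x y + d y z"
  shows "seg x z (S \<union> T)"
proof -
  have sM: "S \<subseteq> M" "T \<subseteq> M" "x \<in> M" "y \<in> M" "z \<in> M" using segD[OF S] segD[OF T] by auto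
  have dS: "d x w + d w y = d x y" if "w \<in> S" for w using seg_between[OF S that] .
  have dT: "d x w = d x y + d y w" if w: "w \<in> T" for w
  proof -
    have "w \<in> M" using w sM by auto
    then have "d x z \<le> d x w + d w z" "d x w \<le> d x y + d y w" using triangle sM by blast+
    with seg_between[OF T w] xz show ?thesis by linarith
  qed
  have mix: "d w w' = \<bar>d x w - d x w'\<bar>" if w: "w \<in> S" "w' \<in> T" for w w'
  proof -
    have "w \<in> M" "w' \<in> M" using w sM by auto
    then have "d w w' \<le> d w y + d y w'" "d x w' \<le> d x w + d w w'" using triangle sM by blast+
    with dS[OF w(1)] dT[OF w(2)] nonneg[of w y] nonneg[of y w'] show ?thesis by linarith
  qed
  show ?thesis
    unfolding seg_iff
  proof (intro conjI allI impI ballI)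
    fix w assume "w \<in> S \<union> T"
    then show "d x w \<le> d x z"
    proof
      assume w: "w \<in> S"
      show ?thesis using dS[OF w] xz nonneg[of w y] nonneg[of y z] by linarith
    next
      assume w: "w \<in> T"
      show ?thesis using dT[OF w] seg_between[OF T w] xz nonneg[of w z] by linarith
    qed
  next
    fix w w' assume "w \<in> S \<union> T" "w' \<in> S \<union> T"
    then consider "w \<in> S" "w' \<in> S" | "w \<in> T" "w' \<in> T" | "w \<in> S" "w' \<in> T" | "w' \<in> S" "w \<in> T" by blast
    then show "d w w' = \<bar>d x w - d x w'\<bar>"
    proof cases
      case 1 then show ?thesis using seg_dist[OF S] by blast
    next
      case 2 then show ?thesis using seg_dist[OF T, of w w'] dT[of w] dT[of w'] by linarith
    next
      case 3 then show ?thesis using mix by blast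
    next
      case 4 then show ?thesis using mix[of w' w] by (simp add: commute abs_minus_commute)
    qed
  next
    fix t assume t: "0 \<le> t \<and> t \<le> d x z"
    show "\<exists>w\<in>S \<union> T. d x w = t"
    proof (cases "t \<le> d x y")
      case True
      then show ?thesis using t S unfolding seg_iff by blast
    next
      case False
      then have "0 \<le> t - d x y" "t - d x y \<le> d y z" using t xz by auto
      then obtain w where "w \<in> T" "d y w = t - d x y" using T unfolding seg_iff by blast
      with dT[of w] show ?thesis by auto
    qed
  qed (use segD[OF S] segD[OF T] in auto)
qed

lemma geodesic_path_on: "geodesic M d c l \<Longrightarrow> path_on c 0 l"
  by (rule lipschitz_path_on[where L = 1]) (auto simp: geodesic_def)

lemma closedin_seg:
  assumes "seg x y S"
  shows "closedin mtopology S"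
proof -
  obtain c l where c: "geodesic M d c l" "S = c ` {0..l}"
    using assms unfolding seg_def by blast
  have "compactin (top_of_set {0..l}) {0..l}"
    by (simp add: compactin_subtopology)
  then have "compactin mtopology S"
    using image_compactin geodesic_path_on[OF c(1)] c(2) unfolding path_on_def by blast
  then show ?thesis by (simp add: compactin_imp_closedin Hausdorff_space_mtopology)
qed

lemma seg_first_hit:
  assumes S: "seg x y S" and K: "closedin mtopology K" and w: "w \<in> S \<inter> K"
  obtains u where "u \<in> S \<inter> K" "subseg S x u \<inter> K = {u}"
proof -
  obtain c l where c: "geodesic M d c l" "c 0 = x" "c l = y" "S = c ` {0..l}"
    using S unfolding seg_def by blast
  obtain t0 where t0: "t0 \<in> {0..l}" "c t0 \<in> K" using w c by auto
  obtain t where t: "t \<in> {0..t0}" "c t \<in> K" "\<And>s. s \<in> {0..<t} \<Longrightarrow> c s \<notin> K"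
    using path_on_first_hit[OF geodesic_path_on[OF c(1)] K t0] by auto
  have dc: "\<And>s t. s \<in> {0..l} \<Longrightarrow> t \<in> {0..l} \<Longrightarrow> d (c s) (c t) = \<bar>s - t\<bar>"
    using c(1) by (auto simp: geodesic_def)
  show thesis
  proof (rule that)
    show "c t \<in> S \<inter> K" using c t t0 by auto
    have "v = c t" if "v \<in> subseg S x (c t) \<inter> K" for v
    proof -
      have "v \<in> S" using that by (simp add: subseg_def)
      then obtain s where s: "s \<in> {0..l}" "v = c s" using c(4) by blast
      then have "\<bar>s\<bar> + \<bar>s - t\<bar> = \<bar>t\<bar>"
        using that dc[of 0 s] dc[of s t] dc[of 0 t] t t0 c(2) by (auto simp: subseg_def)
      then have "s \<le> t" using t(1) by auto
      with t(3)[of s] s that have "s = t" by force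
      with s show ?thesis by simp
    qed
    moreover have "c t \<in> subseg S x (c t)"
      using segD[OF seg_subseg[OF S segD(2)[OF S], of "c t"]] \<open>c t \<in> S \<inter> K\<close> by auto
    ultimately show "subseg S x (c t) \<inter> K = {c t}" using t by auto
  qed
qed

lemma seg_subseg_left: "seg x y S \<Longrightarrow> u \<in> S \<Longrightarrow> seg x u (subseg S x u)"
  using seg_subseg segD(2) by blast

lemma seg_subseg_right: "seg x y S \<Longrightarrow> u \<in> S \<Longrightarrow> seg u y (subseg S u y)"
  using seg_subseg segD(3) by blast

end

section \<open>Gates of pieces\<close>

locale graded_space = Metric_space M d
  for M :: "'a set" and d +
  fixes pieces :: "'a set set"
  assumes geodesic_carrier: "geodesic_subset d M"
    and closed_piece: "P \<in> pieces \<Longrightarrow> closedin mtopology P"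
    and geodesic_piece: "P \<in> pieces \<Longrightarrow> geodesic_subset d P"
    and pieces_meet: "P \<in> pieces \<Longrightarrow> Q \<in> pieces \<Longrightarrow> x \<in> P \<inter> Q \<Longrightarrow> y \<in> P \<inter> Q \<Longrightarrow> x \<noteq> y \<Longrightarrow> P = Q"
    and simple_triangle: "simple_geodesic_triangle M d T \<Longrightarrow> \<exists>P\<in>pieces. T \<subseteq> P"
begin

lemma piece_subset: "P \<in> pieces \<Longrightarrow> P \<subseteq> M"
  using closed_piece closedin_metric by blast

lemma seg_exists:
  assumes "x \<in> M" "y \<in> M"
  obtains S where "seg x y S"
proof -
  obtain c l where "geodesic M d c l" "c 0 = x" "c l = y"
    using geodesic_carrier assms unfolding geodesic_subset_def by meson
  then show thesis using that unfolding seg_def by blast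
qed

lemma seg_in_piece_exists:
  assumes P: "P \<in> pieces" and "x \<in> P" "y \<in> P"
  obtains S where "seg x y S" "S \<subseteq> P"
proof -
  obtain c l where c: "geodesic P d c l" "c 0 = x" "c l = y"
    using geodesic_piece[OF P] assms(2,3) unfolding geodesic_subset_def by meson
  then have "geodesic M d c l" "c ` {0..l} \<subseteq> P"
    using piece_subset[OF P] by (auto simp: geodesic_def)
  with c that show thesis unfolding seg_def by blast
qed

text \<open>The form in which the axiom on simple triangles is used. Because each two sides may share only
  the named vertex, a degenerate side forces all three vertices to coincide.\<close>

lemma triangle_in_piece:
  assumes S: "seg x y S" and T: "seg y z T" and U: "seg z x U"
    and ST: "S \<inter> T \<subseteq> {y}" and TU: "T \<inter> U \<subseteq> {z}" and US: "U \<inter> S \<subseteq> {x}"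
  obtains P where "P \<in> pieces" "S \<subseteq> P" "T \<subseteq> P" "U \<subseteq> P"
proof -
  obtain c1 l1 where c1: "geodesic M d c1 l1" "c1 0 = x" "c1 l1 = y" "S = c1 ` {0..l1}"
    using S unfolding seg_def by blast
  obtain c2 l2 where c2: "geodesic M d c2 l2" "c2 0 = y" "c2 l2 = z" "T = c2 ` {0..l2}"
    using T unfolding seg_def by blast
  obtain c3 l3 where c3: "geodesic M d c3 l3" "c3 0 = z" "c3 l3 = x" "U = c3 ` {0..l3}"
    using U unfolding seg_def by blast
  let ?c = "concat3 c1 l1 c2 l2 c3"
  have l: "0 \<le> l1" "0 \<le> l2" "0 \<le> l3" using c1 c2 c3 by (auto simp: geodesic_def)
  have inj: "s = t" if "geodesic M d c l" "s \<in> {0..l}" "t \<in> {0..l}" "c s = c t" for c l s t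
  proof -
    have "c t \<in> M" "d (c s) (c t) = \<bar>s - t\<bar>" using that(1-3) by (auto simp: geodesic_def)
    then show ?thesis using mdist_zero[of "c t"] that(4) by simp
  qed
  have sep: "?c s \<noteq> ?c t" if st: "0 \<le> s" "s < t" "t < l1 + l2 + l3" for s t
  proof
    assume eq: "?c s = ?c t"
    consider "t \<le> l1" | "s \<le> l1" "l1 < t" "t \<le> l1 + l2" | "s \<le> l1" "l1 + l2 < t"
      | "l1 < s" "t \<le> l1 + l2" | "l1 < s" "s \<le> l1 + l2" "l1 + l2 < t" | "l1 + l2 < s"
      by linarith
    then show False
    proof cases
      case 1
      then show False using eq st inj[OF c1(1), of s t] by (simp add: concat3_def)
    next
      case 2
      then have e: "c1 s = c2 (t - l1)" using eq by (simp add: concat3_def)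
      moreover have "c1 s \<in> S" "c2 (t - l1) \<in> T" using c1(4) c2(4) st 2 by auto
      ultimately have "c2 (t - l1) = c2 0" using ST c2(2) by auto
      then show False using inj[OF c2(1), of "t - l1" 0] 2 l by auto
    next
      case 3
      then have e: "c1 s = c3 (t - l1 - l2)" using eq l by (simp add: concat3_def)
      moreover have "c1 s \<in> S" "c3 (t - l1 - l2) \<in> U" using c1(4) c3(4) st 3 by auto
      ultimately have "c3 (t - l1 - l2) = c3 l3" using US c3(3) by auto
      then show False using inj[OF c3(1), of "t - l1 - l2" l3] 3 l st by auto
    next
      case 4
      then show False using eq st inj[OF c2(1), of "s - l1" "t - l1"] by (simp add: concat3_def)
    next
      case 5
      then have e: "c2 (s - l1) = c3 (t - l1 - l2)" using eq l by (simp add: concat3_def)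
      moreover have "c2 (s - l1) \<in> T" "c3 (t - l1 - l2) \<in> U" using c2(4) c3(4) st 5 by auto
      ultimately have "c3 (t - l1 - l2) = c3 0" using TU c3(2) by auto
      then show False using inj[OF c3(1), of "t - l1 - l2" 0] 5 l st by auto
    next
      case 6
      then show False using eq st l inj[OF c3(1), of "s - l1 - l2" "t - l1 - l2"] by (simp add: concat3_def)
    qed
  qed
  have "inj_on ?c {0..<l1 + l2 + l3}"
  proof (rule inj_onI)
    fix s t assume "s \<in> {0..<l1 + l2 + l3}" "t \<in> {0..<l1 + l2 + l3}" "?c s = ?c t"
    then show "s = t" using sep[of s t] sep[of t s] by (cases s t rule: linorder_cases) auto
  qed
  then have "simple_geodesic_triangle M d (?c ` {0..l1 + l2 + l3})"
    unfolding simple_geodesic_triangle_def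
    by (intro exI[of _ c1] exI[of _ c2] exI[of _ c3] exI[of _ l1] exI[of _ l2] exI[of _ l3])
      (simp add: c1 c2 c3)
  then obtain P where P: "P \<in> pieces" "?c ` {0..l1 + l2 + l3} \<subseteq> P"
    using simple_triangle by blast
  have at1: "c1 t \<in> P" if "t \<in> {0..l1}" for t
  proof -
    have "?c t \<in> P" using P(2) that l by auto
    then show ?thesis using that by (simp add: concat3_def)
  qed
  have at2: "c2 t \<in> P" if "t \<in> {0..l2}" for t
  proof (cases "t = 0")
    case True
    then show ?thesis using at1[of l1] l c1 c2 by auto
  next
    case False
    have "?c (l1 + t) \<in> P" using P(2) that l by auto
    then show ?thesis using that False by (simp add: concat3_def)
  qed
  have at3: "c3 t \<in> P" if "t \<in> {0..l3}" for t
  proof (cases "t = 0")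
    case True
    then show ?thesis using at2[of l2] l c2 c3 by auto
  next
    case False
    have "?c (l1 + l2 + t) \<in> P" using P(2) that l by auto
    then show ?thesis using that False l by (simp add: concat3_def)
  qed
  show thesis by (rule that[OF P(1)]) (use at1 at2 at3 c1 c2 c3 in auto)
qed

text \<open>A bigon becomes a triangle when the midpoint of one side is made a vertex.\<close>

lemma bigon_in_piece:
  assumes S: "seg x y S" and T: "seg x y T" and ST: "S \<inter> T \<subseteq> {x, y}" and "x \<noteq> y"
  obtains P where "P \<in> pieces" "S \<subseteq> P" "T \<subseteq> P"
proof -
  have xy: "x \<in> M" "y \<in> M" using segD[OF S] by auto
  then have pos: "0 < d x y" using \<open>x \<noteq> y\<close> by simp
  obtain m where m: "m \<in> S" "d x m = d x y / 2"
    using S pos unfolding seg_iff by (metis field_sum_of_halves half_gt_zero less_add_same_cancel1 less_eq_real_def)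
  have my: "d m y = d x y / 2" using seg_between[OF S m(1)] m(2) by simp
  have S1: "seg x m (subseg S x m)" and S2: "seg m y (subseg S m y)"
    using seg_subseg[OF S] m(1) segD[OF S] by auto
  have mM: "m \<in> M" using m(1) segD[OF S] by auto
  have cover: "S = subseg S x m \<union> subseg S m y"
  proof
    show "S \<subseteq> subseg S x m \<union> subseg S m y"
    proof
      fix w assume w: "w \<in> S"
      have "d x w + d w y = d x y" "d w m = \<bar>d x w - d x m\<bar>" "d m w = \<bar>d x m - d x w\<bar>"
        using seg_between[OF S w] seg_dist[OF S w m(1)] seg_dist[OF S m(1) w] by auto
      then show "w \<in> subseg S x m \<union> subseg S m y" using w m(2) my by (auto simp: subseg_def)
    qed
  qed (use subseg_subset in blast)
  have meet: "w = m" if "w \<in> subseg S x m" "w \<in> subseg S m y" for w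
  proof -
    have w: "w \<in> S" "d x w + d w m = d x m" "d m w + d w y = d m y" using that by (auto simp: subseg_def)
    have "d m w = 0" using w(2,3) seg_between[OF S w(1)] m(2) my commute[of w m] by linarith
    then show ?thesis using zero[of m w] mM w(1) segD(1)[OF S] by auto
  qed
  have "x \<notin> subseg S m y"
  proof
    assume "x \<in> subseg S m y"
    then have "d m x + d x y = d m y" by (simp add: subseg_def)
    with my m(2) pos commute[of m x] show False by linarith
  qed
  moreover have "y \<notin> subseg S x m"
  proof
    assume "y \<in> subseg S x m"
    then have "d x y + d y m = d x m" by (simp add: subseg_def)
    with my m(2) pos commute[of m y] show False by linarith
  qed
  ultimately have "subseg S m y \<inter> T \<subseteq> {y}" "T \<inter> subseg S x m \<subseteq> {x}"
    using ST subseg_subset[of S] by blast+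
  then obtain P where "P \<in> pieces" "subseg S x m \<subseteq> P" "subseg S m y \<subseteq> P" "T \<subseteq> P"
    using triangle_in_piece[OF S1 S2 seg_sym[OF T]] meet by blast
  with cover that show thesis by blast
qed

text \<open>The gate is the nearest-point projection onto a piece; it is introduced through entering
  segments because these are what simple triangles control.\<close>

definition enters :: "'a set \<Rightarrow> 'a \<Rightarrow> 'a \<Rightarrow> bool" where
  "enters P x p \<longleftrightarrow> p \<in> P \<and> (\<exists>S. seg x p S \<and> S \<inter> P \<subseteq> {p})"

definition gate :: "'a set \<Rightarrow> 'a \<Rightarrow> 'a" where
  "gate P x = (THE p. enters P x p)"

text \<open>Cut two entering segments at the first point, counted from the piece, where they meet. The
  remaining parts and a segment inside the piece form a simple triangle.\<close>

lemma enters_unique: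
  assumes P: "P \<in> pieces" and "enters P x y" "enters P x z"
  shows "y = z"
proof (rule ccontr)
  assume "y \<noteq> z"
  obtain S where S: "seg x y S" "S \<inter> P \<subseteq> {y}" "y \<in> P" using assms(2) by (auto simp: enters_def)
  obtain T where T: "seg x z T" "T \<inter> P \<subseteq> {z}" "z \<in> P" using assms(3) by (auto simp: enters_def)
  obtain u where u: "u \<in> S \<inter> T" "subseg S y u \<inter> T = {u}"
    using seg_first_hit[OF seg_sym[OF S(1)] closedin_seg[OF T(1)], of x] segD(2)[OF S(1)] segD(2)[OF T(1)] by blast
  obtain V where V: "seg y z V" "V \<subseteq> P" using seg_in_piece_exists[OF P S(3) T(3)] .
  have S': "seg u y (subseg S y u)" using seg_sym[OF seg_subseg_left[OF seg_sym[OF S(1)]]] u(1) by blast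
  have T': "seg z u (subseg T z u)" using seg_subseg_left[OF seg_sym[OF T(1)]] u(1) by blast
  obtain Q where Q: "Q \<in> pieces" "subseg S y u \<subseteq> Q" "V \<subseteq> Q" "subseg T z u \<subseteq> Q"
  proof (rule triangle_in_piece[OF S' V(1) T'])
    show "subseg S y u \<inter> V \<subseteq> {y}" "V \<inter> subseg T z u \<subseteq> {z}" "subseg T z u \<inter> subseg S y u \<subseteq> {u}"
      using V(2) S(2) T(2) u(2) subseg_subset[of S y u] subseg_subset[of T z u] by blast+
  qed
  have "y \<in> Q" "z \<in> Q" "u \<in> Q" using Q segD[OF V(1)] segD[OF S'] by auto
  then have "Q = P" using pieces_meet[OF Q(1) P] S(3) T(3) \<open>y \<noteq> z\<close> by blast
  then have "u = y" "u = z" using \<open>u \<in> Q\<close> u(1) S(2) T(2) by blast+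
  with \<open>y \<noteq> z\<close> show False by simp
qed

lemma gate_eqI: "P \<in> pieces \<Longrightarrow> enters P x p \<Longrightarrow> gate P x = p"
  unfolding gate_def using enters_unique by blast

lemma enters_on_seg:
  assumes P: "P \<in> pieces" and S: "seg x y S" and w: "w \<in> S \<inter> P"
  obtains p where "p \<in> S" "enters P x p"
proof -
  obtain p where p: "p \<in> S \<inter> P" "subseg S x p \<inter> P = {p}"
    using seg_first_hit[OF S closed_piece[OF P] w] .
  then show thesis
    using that[of p] seg_subseg[OF S segD(2)[OF S]] by (auto simp: enters_def)
qed

lemma gate_on_seg:
  assumes "P \<in> pieces" "seg x y S" "w \<in> S \<inter> P"
  shows "gate P x \<in> S"
proof -
  obtain p where "p \<in> S" "enters P x p" by (rule enters_on_seg[OF assms])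
  then show ?thesis using gate_eqI[OF assms(1)] by blast
qed

lemma gate_enters:
  assumes P: "P \<in> pieces" "P \<noteq> {}" and x: "x \<in> M"
  shows "enters P x (gate P x)"
proof -
  obtain w where w: "w \<in> P" using P by blast
  then have "w \<in> M" using piece_subset[OF P(1)] by blast
  then obtain S where S: "seg x w S" using seg_exists[OF x] by blast
  then have "w \<in> S \<inter> P" using w segD[OF S] by blast
  then obtain p where "enters P x p" using enters_on_seg[OF P(1) S] by blast
  then show ?thesis using gate_eqI[OF P(1)] by metis
qed

lemma gate_in_piece: "P \<in> pieces \<Longrightarrow> P \<noteq> {} \<Longrightarrow> x \<in> M \<Longrightarrow> gate P x \<in> P"
  using gate_enters by (auto simp: enters_def)

lemma gate_self: "P \<in> pieces \<Longrightarrow> x \<in> P \<Longrightarrow> gate P x = x"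
  using piece_subset by (intro gate_eqI) (auto simp: enters_def intro!: exI[of _ "{x}"] seg_trivial)

lemma gate_between:
  assumes P: "P \<in> pieces" and x: "x \<in> M" and y: "y \<in> P"
  shows "d x (gate P x) + d (gate P x) y = d x y"
proof -
  obtain S where S: "seg x y S" using seg_exists[OF x] y piece_subset[OF P] by blast
  then have "gate P x \<in> S" using gate_on_seg[OF P S, of y] y segD[OF S] by blast
  then show ?thesis by (rule seg_between[OF S])
qed

text \<open>If the gates \<open>p\<close> of \<open>x\<close> and \<open>q\<close> of \<open>y\<close> differ, then the segments from \<open>x\<close> to \<open>p\<close>, from \<open>x\<close> to
  \<open>y\<close>, from \<open>y\<close> to \<open>q\<close> and from \<open>q\<close> to \<open>p\<close> form a quadrilateral, made simple by cutting off what its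
  sides share at \<open>x\<close> (cut at \<open>a\<close>) and at \<open>y\<close> (cut at \<open>b\<close>). It is a geodesic triangle: as \<open>q\<close> is a gate, the
  two sides meeting at \<open>q\<close> together form a segment. If the cuts leave no fourth side, then \<open>b\<close> has
  two gates.\<close>

lemma gate_const_on_seg:
  assumes P: "P \<in> pieces" "P \<noteq> {}" and V: "seg x y V" "V \<inter> P = {}"
  shows "gate P x = gate P y"
proof (rule ccontr)
  define p q where "p = gate P x" and "q = gate P y"
  assume "gate P x \<noteq> gate P y"
  then have pq: "p \<noteq> q" by (simp add: p_def q_def)
  have xy: "x \<in> M" "y \<in> M" using segD[OF V(1)] by auto
  obtain S where S: "seg x p S" "S \<inter> P \<subseteq> {p}" "p \<in> P"
    using gate_enters[OF P xy(1)] by (auto simp: enters_def p_def)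
  obtain W where W: "seg y q W" "W \<inter> P \<subseteq> {q}" "q \<in> P"
    using gate_enters[OF P xy(2)] by (auto simp: enters_def q_def)
  obtain a where a: "a \<in> S \<inter> V" "subseg S p a \<inter> V = {a}"
    using seg_first_hit[OF seg_sym[OF S(1)] closedin_seg[OF V(1)], of x] segD(2)[OF S(1)] segD(2)[OF V(1)] by blast
  define S' where "S' = subseg S p a"
  define V' where "V' = subseg V a y"
  have S': "seg p a S'" "S' \<subseteq> S" unfolding S'_def using seg_subseg_left[OF seg_sym[OF S(1)]] a(1) subseg_subset by auto
  have V': "seg a y V'" "V' \<subseteq> V" unfolding V'_def using seg_subseg_right[OF V(1)] a(1) subseg_subset by auto
  have cl: "closedin mtopology (V' \<union> S')"
    by (intro closedin_Un closedin_seg[OF V'(1)] closedin_seg[OF S'(1)])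
  have y: "y \<in> W \<inter> (V' \<union> S')" using segD(2)[OF W(1)] segD(3)[OF V'(1)] by simp
  obtain b where b: "b \<in> W \<inter> (V' \<union> S')" "subseg W q b \<inter> (V' \<union> S') = {b}"
    using seg_first_hit[OF seg_sym[OF W(1)] cl y] .
  define W' where "W' = subseg W q b"
  have W': "seg b q W'" "W' \<subseteq> W" "W' \<inter> (V' \<union> S') = {b}"
    unfolding W'_def using seg_sym[OF seg_subseg_left[OF seg_sym[OF W(1)]]] b subseg_subset by auto
  have enq: "enters P b q" using W(2,3) W'(1,2) by (auto simp: enters_def)
  show False
  proof (cases "b \<in> S'")
    case True
    then have "seg b p (subseg S' b p)" using seg_sym[OF seg_subseg_left[OF S'(1) True]] by (simp add: subseg_sym)
    then have "enters P b p" using S(2,3) S'(2) subseg_subset[of S' b p] unfolding enters_def by blast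
    with enq pq enters_unique[OF P(1)] show False by blast
  next
    case False
    then have bV: "b \<in> V'" using b by blast
    obtain N where N: "seg q p N" "N \<subseteq> P" using seg_in_piece_exists[OF P(1) W(3) S(3)] .
    have bM: "b \<in> M" using bV segD[OF V'(1)] by blast
    have "gate P b = q" using gate_eqI[OF P(1) enq] .
    then have bp: "seg b p (W' \<union> N)"
      using seg_concat[OF W'(1) N(1)] gate_between[OF P(1) bM S(3)] by simp
    have ab: "seg a b (subseg V' a b)" using seg_subseg_left[OF V'(1) bV] .
    obtain Q where Q: "Q \<in> pieces" "subseg V' a b \<subseteq> Q" "W' \<union> N \<subseteq> Q" "S' \<subseteq> Q"
    proof (rule triangle_in_piece[OF ab bp S'(1)])
      have sV: "subseg V' a b \<subseteq> V'" by (rule subseg_subset)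
      have WV: "W' \<inter> V' \<subseteq> {b}" and WS: "W' \<inter> S' \<subseteq> {b}" using W'(3) by auto
      have VN: "V' \<inter> N = {}" using V'(2) V(2) N(2) by auto
      show "subseg V' a b \<inter> (W' \<union> N) \<subseteq> {b}" using sV WV VN by auto
      have "N \<inter> S' \<subseteq> {p}" using N(2) S(2) S'(2) by auto
      with WS False show "(W' \<union> N) \<inter> S' \<subseteq> {p}" by auto
      have "S' \<inter> V \<subseteq> {a}" using a(2) by (simp add: S'_def)
      then show "S' \<inter> subseg V' a b \<subseteq> {a}" using V'(2) sV by auto
    qed
    then have "p \<in> Q" "q \<in> Q" "a \<in> Q" using segD(2,3)[OF N(1)] segD(3)[OF S'(1)] by auto
    then have "Q = P" using pieces_meet[OF Q(1) P(1)] S(3) W(3) pq by blast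
    then show False using \<open>a \<in> Q\<close> a(1) V(2) by blast
  qed
qed

end

context graded_space
begin

section \<open>Paths and pieces\<close>

lemma gate_const_on_path:
  assumes P: "P \<in> pieces" "P \<noteq> {}" and c: "path_on c a b" "a \<le> b"
    and off: "\<And>t. t \<in> {a..b} \<Longrightarrow> c t \<notin> P"
  shows "gate P (c a) = gate P (c b)"
proof (rule connected_local_const[where f = "\<lambda>t. gate P (c t)" and A = "{a..b}"])
  show "connected {a..b}" "a \<in> {a..b}" "b \<in> {a..b}" using c(2) by auto
  show "\<forall>t\<in>{a..b}. \<forall>\<^sub>F s in at t within {a..b}. gate P (c t) = gate P (c s)"
  proof
    fix t assume t: "t \<in> {a..b}"
    obtain r where r: "0 < r" "\<And>y. y \<in> P \<Longrightarrow> r \<le> d (c t) y"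
      using closedin_positive_distance[OF closed_piece[OF P(1)] path_onD[OF c(1) t] off[OF t]] by metis
    show "\<forall>\<^sub>F s in at t within {a..b}. gate P (c t) = gate P (c s)"
      using path_on_eventually_close[OF c(1) t r(1)]
    proof eventually_elim
      case (elim s)
      obtain V where V: "seg (c t) (c s) V"
        using seg_exists[OF path_onD[OF c(1) t] path_onD[OF c(1)]] elim by blast
      have "V \<inter> P = {}"
      proof (rule ccontr)
        assume "V \<inter> P \<noteq> {}"
        then obtain w where "w \<in> V" "w \<in> P" by blast
        with r(2)[of w] seg_le[OF V, of w] elim show False by linarith
      qed
      then show ?case by (rule gate_const_on_seg[OF P V])
    qed
  qed
qed

text \<open>The gate is constant up to the time of entrance, and it lies between the current point and
  every point of the piece; so it is as close as desired to the point of entrance.\<close>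

lemma path_enters_at_gate:
  assumes P: "P \<in> pieces" and c: "path_on c a b" "a \<le> b" and b: "c b \<in> P"
    and off: "\<And>t. t \<in> {a..<b} \<Longrightarrow> c t \<notin> P"
  shows "c b = gate P (c a)"
proof (rule ccontr)
  assume ne: "c b \<noteq> gate P (c a)"
  have "P \<noteq> {}" using b by blast
  have M: "c a \<in> M" "c b \<in> M" using path_onD[OF c(1)] c(2) by auto
  have gM: "gate P (c a) \<in> M"
    using gate_in_piece[OF P \<open>P \<noteq> {}\<close> M(1)] piece_subset[OF P] by blast
  have "a \<noteq> b" using ne gate_self[OF P b] by auto
  with c have ab: "a < b" by simp
  define \<epsilon> where "\<epsilon> = d (c b) (gate P (c a))"
  have "0 < \<epsilon>" using ne M gM by (simp add: \<epsilon>_def)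
  then obtain \<delta> where \<delta>: "0 < \<delta>" "\<forall>s\<in>{a..b}. \<bar>s - b\<bar> < \<delta> \<longrightarrow> d (c b) (c s) < \<epsilon>"
    using path_on_close[OF c(1), of b \<epsilon>] ab by auto
  define t where "t = max a (b - \<delta> / 2)"
  have t: "a \<le> t" "t < b" "\<bar>t - b\<bar> < \<delta>" using \<delta>(1) ab by (auto simp: t_def)
  have ct: "path_on c a t" by (rule path_on_mono[OF c(1)]) (use t in auto)
  have "gate P (c a) = gate P (c t)"
    by (rule gate_const_on_path[OF P \<open>P \<noteq> {}\<close> ct]) (use t off in auto)
  moreover have "d (c t) (gate P (c t)) + d (gate P (c t)) (c b) = d (c t) (c b)"
    by (rule gate_between[OF P _ b]) (use path_onD[OF ct, of t] t in auto)
  moreover have "d (c b) (c t) < \<epsilon>" using \<delta>(2) t by auto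
  ultimately show False
    using nonneg[of "c t" "gate P (c t)"] by (simp add: \<epsilon>_def commute del: nonneg)
qed

lemma path_leaves_at_gate:
  assumes P: "P \<in> pieces" and c: "path_on c a b" "a \<le> b" and a: "c a \<in> P"
    and off: "\<And>t. t \<in> {a<..b} \<Longrightarrow> c t \<notin> P"
  shows "c a = gate P (c b)"
  using path_enters_at_gate[OF P path_on_reverse[OF c(1)] c(2)] a off by simp

text \<open>On an excursion outside the piece the gate is constant, so the excursion ends where it began.\<close>

lemma arc_in_piece:
  assumes P: "P \<in> pieces" and c: "path_on c a b" and inj: "inj_on c {a..b}"
    and ends: "c a \<in> P" "c b \<in> P"
  shows "c ` {a..b} \<subseteq> P"
proof (rule ccontr)
  assume "\<not> ?thesis"
  then obtain t where t: "t \<in> {a..b}" "c t \<notin> P" by blast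
  have c1: "path_on c a t" and c2: "path_on c t b"
    using path_on_mono[OF c, of a t] path_on_mono[OF c, of t b] t by auto
  obtain s where s: "s \<in> {a..t}" "c s \<in> P" "\<And>r. r \<in> {s<..t} \<Longrightarrow> c r \<notin> P"
    using path_on_last_hit[OF c1 closed_piece[OF P], of a] ends t by auto
  obtain u where u: "u \<in> {t..b}" "c u \<in> P" "\<And>r. r \<in> {t..<u} \<Longrightarrow> c r \<notin> P"
    using path_on_first_hit[OF c2 closed_piece[OF P], of b] ends t by auto
  have st: "path_on c s t" and tu: "path_on c t u"
    using path_on_mono[OF c, of s t] path_on_mono[OF c, of t u] s(1) u(1) t by auto
  have "c s = gate P (c t)"
    by (rule path_leaves_at_gate[OF P st _ s(2)]) (use s in auto)
  moreover have "c u = gate P (c t)"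
    by (rule path_enters_at_gate[OF P tu _ u(2)]) (use u in auto)
  ultimately have "c s = c u" by simp
  then have "s = u" using inj_onD[OF inj, of s u] s(1) u(1) t by auto
  then have "s = t" using s(1) u(1) by auto
  with s(2) t(2) show False by simp
qed

lemma seg_in_piece:
  assumes P: "P \<in> pieces" and S: "seg x y S" and xy: "x \<in> P" "y \<in> P"
  shows "S \<subseteq> P"
proof -
  obtain c l where c: "geodesic M d c l" "c 0 = x" "c l = y" "S = c ` {0..l}"
    using S unfolding seg_def by blast
  have "inj_on c {0..l}"
  proof (rule inj_onI)
    fix s t assume st: "s \<in> {0..l}" "t \<in> {0..l}" "c s = c t"
    then have "d (c s) (c t) = \<bar>s - t\<bar>" "c t \<in> M" using c(1) unfolding geodesic_def by blast+
    with st(3) show "s = t" using mdist_zero[of "c t"] by simp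
  qed
  then show ?thesis
    using arc_in_piece[OF P geodesic_path_on[OF c(1)]] c xy by simp
qed

section \<open>Points separating a geodesic\<close>

lemma bigon_side_in_piece:
  assumes G: "seg u v G" and S: "seg a b S" and u: "u \<in> S" and v: "v \<in> S" and "u \<noteq> v"
    and GS: "G \<inter> S \<subseteq> {u, v}"
  obtains P where "P \<in> pieces" "G \<subseteq> P"
proof -
  have "G \<inter> subseg S u v \<subseteq> {u, v}" using GS subseg_subset[of S u v] by blast
  then show thesis using bigon_in_piece[OF G seg_subseg[OF S u v]] \<open>u \<noteq> v\<close> that by metis
qed

lemma triangle_side_in_piece:
  assumes G: "seg u v G" and S: "seg a b S" and T: "seg b c T"
    and u: "u \<in> S" "u \<notin> T" and v: "v \<in> T" "v \<notin> S" and meet: "G \<inter> (S \<union> T) \<subseteq> {u, v}"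
  obtains P where "P \<in> pieces" "G \<subseteq> P"
proof -
  have S1: "seg u b (subseg S u b)" by (rule seg_subseg_right[OF S u(1)])
  have b: "b \<in> subseg S u b \<inter> T" using segD(3)[OF S1] segD(2)[OF T] by blast
  obtain w where w: "w \<in> subseg S u b \<inter> T" "subseg (subseg S u b) u w \<inter> T = {w}"
    using seg_first_hit[OF S1 closedin_seg[OF T] b] .
  define S' where "S' = subseg (subseg S u b) u w"
  define T' where "T' = subseg T w v"
  have wST: "w \<in> subseg S u b" "w \<in> T" using w(1) by auto
  have S': "seg u w S'" "S' \<subseteq> S" "S' \<inter> T = {w}"
    unfolding S'_def
    by (fact seg_subseg_left[OF S1 wST(1)], fact subset_trans[OF subseg_subset subseg_subset], fact w(2))
  have T': "seg w v T'" "T' \<subseteq> T"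
    unfolding T'_def by (fact seg_subseg[OF T wST(2) v(1)], fact subseg_subset)
  have 1: "S' \<inter> T' \<subseteq> {w}" using S'(3) T'(2) by auto
  have 2: "T' \<inter> G \<subseteq> {v}" using T'(2) meet u(2) by auto
  have 3: "G \<inter> S' \<subseteq> {u}" using S'(2) meet v(2) by auto
  from triangle_in_piece[OF S'(1) T'(1) seg_sym[OF G] 1 2 3] that show thesis by metis
qed

text \<open>If a broken line \<open>S \<union> T\<close> from \<open>a\<close> to \<open>c\<close> avoids a point \<open>z\<close> of a segment from \<open>a\<close> to \<open>c\<close>, then the
  part of the segment around \<open>z\<close> that is off the broken line is a side of a simple bigon or
  triangle, so it lies in a piece.\<close>

lemma detour_piece:
  assumes G: "seg a c G" and z: "z \<in> G" and S: "seg a b S" "z \<notin> S" and T: "seg b c T" "z \<notin> T"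
  shows "\<exists>P\<in>pieces. z \<in> P \<and> gate P a \<noteq> z \<and> gate P c \<noteq> z"
proof -
  let ?K = "S \<union> T"
  have K: "closedin mtopology ?K" by (intro closedin_Un closedin_seg[OF S(1)] closedin_seg[OF T(1)])
  have M: "a \<in> M" "c \<in> M" "z \<in> M" using segD[OF G] z by auto
  define G1 where "G1 = subseg G a z"
  define G2 where "G2 = subseg G z c"
  have G1: "seg z a G1" unfolding G1_def by (rule seg_sym[OF seg_subseg_left[OF G z]])
  have G2: "seg z c G2" unfolding G2_def by (rule seg_subseg_right[OF G z])
  have aK: "a \<in> G1 \<inter> ?K" using segD(3)[OF G1] segD(2)[OF S(1)] by blast
  have cK: "c \<in> G2 \<inter> ?K" using segD(3)[OF G2] segD(3)[OF T(1)] by blast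
  obtain u where u: "u \<in> G1 \<inter> ?K" "subseg G1 z u \<inter> ?K = {u}"
    using seg_first_hit[OF G1 K aK] .
  obtain v where v: "v \<in> G2 \<inter> ?K" "subseg G2 z v \<inter> ?K = {v}"
    using seg_first_hit[OF G2 K cK] .
  have uG: "u \<in> G" "d a u + d u z = d a z" and vG: "v \<in> G" "d z v + d v c = d z c"
    using u(1) v(1) by (auto simp: G1_def G2_def subseg_def)
  then have uv: "u \<in> M" "v \<in> M" using segD(1)[OF G] by auto
  have zuv: "z \<noteq> u" "z \<noteq> v" using u(1) v(1) S(2) T(2) by blast+
  then have pos: "0 < d z u" "0 < d z v" using M(3) uv by auto
  have duv: "d u v = d u z + d z v"
  proof -
    have "d a v + d v c = d a c" "d a z + d z c = d a c" "d u v = \<bar>d a u - d a v\<bar>"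
      using seg_between[OF G vG(1)] seg_between[OF G z] seg_dist[OF G uG(1) vG(1)] by auto
    with uG(2) vG(2) nonneg[of u z] nonneg[of z v] show ?thesis by linarith
  qed
  define G' where "G' = subseg G1 z u \<union> subseg G2 z v"
  have u1: "seg u z (subseg G1 z u)" using seg_sym[OF seg_subseg_left[OF G1]] u(1) by blast
  have v1: "seg z v (subseg G2 z v)" using seg_subseg_left[OF G2] v(1) by blast
  have G': "seg u v G'" unfolding G'_def by (rule seg_concat[OF u1 v1 duv])
  have zG': "z \<in> G'" using segD(3)[OF u1] by (simp add: G'_def)
  have meet: "G' \<inter> ?K \<subseteq> {u, v}" using u(2) v(2) by (auto simp: G'_def)
  have "u \<noteq> v" using duv pos uv commute[of u z] by auto
  consider "u \<in> S" "v \<in> S" | "u \<in> T" "v \<in> T" | "u \<in> S" "u \<notin> T" "v \<in> T" "v \<notin> S"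
    | "u \<in> T" "u \<notin> S" "v \<in> S" "v \<notin> T"
    using u(1) v(1) by blast
  then obtain P where P: "P \<in> pieces" "G' \<subseteq> P"
  proof cases
    case 1
    have "G' \<inter> S \<subseteq> {u, v}" using meet by blast
    with bigon_side_in_piece[OF G' S(1) 1 \<open>u \<noteq> v\<close>] that show thesis by metis
  next
    case 2
    have "G' \<inter> T \<subseteq> {u, v}" using meet by blast
    with bigon_side_in_piece[OF G' T(1) 2 \<open>u \<noteq> v\<close>] that show thesis by metis
  next
    case 3
    from triangle_side_in_piece[OF G' S(1) T(1) 3 meet] that show thesis by metis
  next
    case 4
    have "G' \<inter> (S \<union> T) \<subseteq> {v, u}" using meet by blast
    from triangle_side_in_piece[OF seg_sym[OF G'] S(1) T(1) 4(3,4,1,2) this] that show thesis by metis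
  qed
  have in_P: "z \<in> P" "u \<in> P" "v \<in> P" using P(2) zG' segD(2,3)[OF G'] by auto
  have "gate P a \<noteq> z"
    using gate_between[OF P(1) M(1) in_P(2)] uG(2) pos(1) commute[of u z] by auto
  moreover have "gate P c \<noteq> z"
    using gate_between[OF P(1) M(2) in_P(3)] vG(2) pos(2) commute[of c z] commute[of c v] by auto
  ultimately show ?thesis using P(1) in_P(1) by blast
qed

text \<open>Any two points joined by a path that avoids \<open>z\<close> are linked around \<open>z\<close> (see \<open>path_avoiding_linked\<close>).
  The relation is weaker than the existence of such a path, but it exhibits the piece that a path
  around \<open>z\<close> has to use.\<close>

definition linked :: "'a \<Rightarrow> 'a \<Rightarrow> 'a \<Rightarrow> bool" where
  "linked z a b \<longleftrightarrow>
     (\<exists>S. seg a b S \<and> z \<notin> S) \<or> (\<exists>P\<in>pieces. z \<in> P \<and> gate P a \<noteq> z \<and> gate P b \<noteq> z)"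

lemma linked_sym: "linked z a b \<Longrightarrow> linked z b a"
  unfolding linked_def by (metis seg_sym)

lemma gate_ne_along_seg:
  assumes P: "P \<in> pieces" "z \<in> P" and S: "seg a b S" "z \<notin> S" and b: "gate P b \<noteq> z"
  shows "gate P a \<noteq> z"
proof (cases "S \<inter> P = {}")
  case True
  have "P \<noteq> {}" using P(2) by blast
  then show ?thesis using gate_const_on_seg[OF P(1) _ S(1) True] b by simp
next
  case False
  then obtain w where "w \<in> S \<inter> P" by blast
  then have "gate P a \<in> S" by (rule gate_on_seg[OF P(1) S(1)])
  with S(2) show ?thesis by blast
qed

text \<open>A geodesic from \<open>b\<close> to \<open>z\<close> ends with a segment in each piece that contains \<open>z\<close> and is entered before \<open>z\<close>.\<close>

lemma pieces_eq_if_gates_ne: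
  assumes PQ: "P \<in> pieces" "Q \<in> pieces" "z \<in> P" "z \<in> Q" and b: "b \<in> M"
    and ne: "gate P b \<noteq> z" "gate Q b \<noteq> z"
  shows "P = Q"
proof -
  have aux: "P = Q"
    if PQ: "P \<in> pieces" "Q \<in> pieces" "z \<in> P" "z \<in> Q" and ne: "gate Q b \<noteq> z"
      and le: "d b (gate P b) \<le> d b (gate Q b)" for P Q
  proof -
    have zM: "z \<in> M" using piece_subset PQ by blast
    obtain S where S: "seg b z S" using seg_exists[OF b zM] .
    have z: "z \<in> S \<inter> P" "z \<in> S \<inter> Q" using segD(3)[OF S] PQ by auto
    have p: "gate P b \<in> S" "gate Q b \<in> S"
      using gate_on_seg[OF PQ(1) S z(1)] gate_on_seg[OF PQ(2) S z(2)] by auto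
    have in_pq: "gate P b \<in> P" "gate Q b \<in> Q" using gate_in_piece PQ b by blast+
    have "d (gate P b) (gate Q b) + d (gate Q b) z = d (gate P b) z"
      using seg_dist[OF S p] seg_between[OF S p(1)] seg_between[OF S p(2)] le by linarith
    then have "gate Q b \<in> subseg S (gate P b) z" using p by (simp add: subseg_def)
    then have "gate Q b \<in> P"
      using seg_in_piece[OF PQ(1) seg_subseg_right[OF S p(1)] in_pq(1) PQ(3)] by blast
    then show "P = Q" using pieces_meet[OF PQ(1,2)] PQ(3,4) in_pq(2) ne by blast
  qed
  show ?thesis
    using aux[OF PQ(1,2,3,4) ne(2)] aux[OF PQ(2,1,4,3) ne(1)] linear by fastforce
qed

text \<open>If both links are segments, they form a broken line around \<open>z\<close>. If both are pieces, the pieces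
  agree. A segment and a piece combine because the gates of the ends of a segment are equal or lie
  on the segment.\<close>

lemma linked_trans:
  assumes ab: "linked z a b" and bc: "linked z b c" and M: "a \<in> M" "b \<in> M" "c \<in> M"
  shows "linked z a c"
proof -
  consider S T where "seg a b S" "z \<notin> S" "seg b c T" "z \<notin> T"
    | S P where "seg a b S" "z \<notin> S" "P \<in> pieces" "z \<in> P" "gate P b \<noteq> z" "gate P c \<noteq> z"
    | T P where "seg b c T" "z \<notin> T" "P \<in> pieces" "z \<in> P" "gate P a \<noteq> z" "gate P b \<noteq> z"
    | P Q where "P \<in> pieces" "z \<in> P" "gate P a \<noteq> z" "gate P b \<noteq> z"
        "Q \<in> pieces" "z \<in> Q" "gate Q b \<noteq> z" "gate Q c \<noteq> z"
    using ab bc unfolding linked_def by blast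
  then show ?thesis
  proof cases
    case 1
    obtain G where "seg a c G" using seg_exists[OF M(1,3)] .
    then show ?thesis using detour_piece[OF _ _ 1] unfolding linked_def by blast
  next
    case 2
    then have "gate P a \<noteq> z" using gate_ne_along_seg by blast
    with 2 show ?thesis unfolding linked_def by blast
  next
    case 3
    then have "gate P c \<noteq> z" using gate_ne_along_seg[OF 3(3,4) seg_sym[OF 3(1)]] by blast
    with 3 show ?thesis unfolding linked_def by blast
  next
    case 4
    then have "P = Q" using pieces_eq_if_gates_ne M(2) by blast
    with 4 show ?thesis unfolding linked_def by blast
  qed
qed

text \<open>Being linked around \<open>z\<close> is an equivalence relation whose classes are open off \<open>z\<close>, and a path is connected.\<close>

lemma path_avoiding_linked:
  assumes c: "path_on c a b" "a \<le> b" and z: "z \<in> M" "z \<notin> c ` {a..b}"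
  shows "linked z (c a) (c b)"
proof -
  have "linked z (c a) (c a) = linked z (c a) (c b)"
  proof (rule connected_local_const[where f = "\<lambda>t. linked z (c a) (c t)" and A = "{a..b}"])
    show "connected {a..b}" "a \<in> {a..b}" "b \<in> {a..b}" using c(2) by auto
    show "\<forall>t\<in>{a..b}. \<forall>\<^sub>F s in at t within {a..b}. linked z (c a) (c t) = linked z (c a) (c s)"
    proof
      fix t assume t: "t \<in> {a..b}"
      have M: "c a \<in> M" "c t \<in> M" using path_onD[OF c(1)] c(2) t by auto
      have "0 < d (c t) z" using M z t by auto
      from path_on_eventually_close[OF c(1) t this]
      show "\<forall>\<^sub>F s in at t within {a..b}. linked z (c a) (c t) = linked z (c a) (c s)"
      proof eventually_elim
        case (elim s)
        have sM: "c s \<in> M" using path_onD[OF c(1)] elim by blast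
        obtain V where V: "seg (c t) (c s) V" using seg_exists[OF M(2) sM] .
        have "z \<notin> V" using seg_le[OF V, of z] elim by auto
        with V have "linked z (c t) (c s)" unfolding linked_def by blast
        then show ?case
          using linked_trans[OF _ _ M(1,2) sM] linked_trans[OF _ linked_sym M(1) sM M(2)] by blast
      qed
    qed
  qed
  moreover have "linked z (c a) (c a)"
    unfolding linked_def using seg_trivial[OF path_onD[OF c(1)], of a] z c(2) by force
  ultimately show ?thesis by simp
qed

text \<open>Even if the ends are linked through a second geodesic that avoids \<open>z\<close>, that geodesic and the given
  one differ near \<open>z\<close>, and a piece arises from the bigon between them.\<close>

lemma path_avoiding_piece:
  assumes c: "path_on c a b" "a \<le> b" and z: "z \<notin> c ` {a..b}"
    and G: "seg (c a) (c b) G" "z \<in> G"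
  shows "\<exists>P\<in>pieces. z \<in> P \<and> gate P (c a) \<noteq> z \<and> gate P (c b) \<noteq> z"
proof -
  have zM: "z \<in> M" using segD(1)[OF G(1)] G(2) by blast
  have "c b \<in> M" using path_onD[OF c(1)] c(2) by auto
  note T = seg_trivial[OF this]
  have zb: "z \<notin> {c b}" using z c(2) by auto
  from path_avoiding_linked[OF c zM z]
  consider S where "seg (c a) (c b) S" "z \<notin> S"
    | "\<exists>P\<in>pieces. z \<in> P \<and> gate P (c a) \<noteq> z \<and> gate P (c b) \<noteq> z"
    unfolding linked_def by metis
  then show ?thesis
  proof cases
    case 1
    show ?thesis by (rule detour_piece[OF G 1 T zb])
  qed
qed

section \<open>Simple loops\<close>

lemma path_through_gates:
  assumes P: "P \<in> pieces" "P \<noteq> {}" and c: "path_on c a b" "a \<le> b"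
    and ne: "gate P (c a) \<noteq> gate P (c b)"
  obtains s t where "s \<in> {a..b}" "t \<in> {a..b}" "c s = gate P (c a)" "c t = gate P (c b)"
proof -
  obtain r where r: "r \<in> {a..b}" "c r \<in> P" using gate_const_on_path[OF P c] ne by blast
  obtain s where s: "s \<in> {a..r}" "c s \<in> P" "\<And>r. r \<in> {a..<s} \<Longrightarrow> c r \<notin> P"
    by (rule path_on_first_hit[OF c(1) closed_piece[OF P(1)] r]) blast
  obtain t where t: "t \<in> {r..b}" "c t \<in> P" "\<And>r. r \<in> {t<..b} \<Longrightarrow> c r \<notin> P"
    by (rule path_on_last_hit[OF c(1) closed_piece[OF P(1)] r]) blast
  have as: "path_on c a s" and tb: "path_on c t b"
    using path_on_mono[OF c(1), of a s] path_on_mono[OF c(1), of t b] r s(1) t(1) by auto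
  have "c s = gate P (c a)"
    by (rule path_enters_at_gate[OF P(1) as _ s(2)]) (use s in auto)
  moreover have "c t = gate P (c b)"
    by (rule path_leaves_at_gate[OF P(1) tb _ t(2)]) (use t in auto)
  ultimately show thesis using that[of s t] s(1) t(1) r by auto
qed

text \<open>A piece containing two points of the loop contains both arcs between them, so it is enough
  to find two such points. They are the gates of the ends of an arc that bypasses a point of a
  geodesic.\<close>

lemma loop_in_piece:
  assumes c: "path_on c a b" and ab: "a < b" and loop: "c a = c b" and inj: "inj_on c {a..<b}"
  obtains P where "P \<in> pieces" "c ` {a..b} \<subseteq> P"
proof -
  have only_ends: "s = a \<and> t = b" if "s \<in> {a..b}" "t \<in> {a..b}" "s < t" "c s = c t" for s t
  proof (cases "t = b")
    case True
    then have "c s = c a" using that loop by simp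
    then show ?thesis using inj_onD[OF inj, of s a] that ab True by auto
  next
    case False
    then show ?thesis using inj_onD[OF inj, of s t] that ab by auto
  qed
  define m where "m = (a + b) / 2"
  have m: "a < m" "m < b" using ab by (auto simp: m_def)
  have cM: "c t \<in> M" if "t \<in> {a..b}" for t using path_onD[OF c that] .
  have xy: "c a \<in> M" "c m \<in> M" using cM m by auto
  have ne: "c a \<noteq> c m" using only_ends[of a m] m by auto
  then have pos: "0 < d (c a) (c m)" using xy by simp
  obtain G where G: "seg (c a) (c m) G" using seg_exists[OF xy] .
  obtain z where z: "z \<in> G" "d (c a) z = d (c a) (c m) / 2"
  proof -
    have "0 \<le> d (c a) (c m) / 2 \<and> d (c a) (c m) / 2 \<le> d (c a) (c m)" using pos by simp
    then have "\<exists>w\<in>G. d (c a) w = d (c a) (c m) / 2" using G unfolding seg_iff by blast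
    then show thesis using that by blast
  qed
  have zM: "z \<in> M" using z(1) segD(1)[OF G] by blast
  have zy: "d z (c m) = d (c a) (c m) / 2" using seg_between[OF G z(1)] z(2) by simp
  have z_ends: "z \<noteq> c a" "z \<noteq> c m" using z(2) zy pos mdist_zero[OF xy(1)] mdist_zero[OF xy(2)] by auto
  have c1: "path_on c a m" and c2: "path_on c m b"
    using path_on_mono[OF c, of a m] path_on_mono[OF c, of m b] m by auto
  \<comment> \<open>The two halves of the loop only meet at their ends, so one of them avoids the midpoint \<open>z\<close>.\<close>
  have "z \<notin> c ` {a..m} \<or> z \<notin> c ` {m..b}"
  proof (rule ccontr)
    assume "\<not> ?thesis"
    then obtain s t where st: "s \<in> {a..m}" "t \<in> {m..b}" "z = c s" "z = c t" by blast
    then have "s \<noteq> t" using z_ends by auto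
    then have "s = a" using only_ends[of s t] st m by auto
    with st z_ends show False by simp
  qed
  then have "\<exists>P\<in>pieces. z \<in> P \<and> gate P (c a) \<noteq> z \<and> gate P (c m) \<noteq> z"
  proof
    assume "z \<notin> c ` {a..m}"
    then show ?thesis using path_avoiding_piece[OF c1 _ _ G z(1)] m by auto
  next
    assume "z \<notin> c ` {m..b}"
    moreover have "seg (c m) (c b) G" using seg_sym[OF G] loop by simp
    ultimately have "\<exists>P\<in>pieces. z \<in> P \<and> gate P (c m) \<noteq> z \<and> gate P (c b) \<noteq> z"
      using path_avoiding_piece[OF c2 _ _ _ z(1)] m by auto
    then show ?thesis using loop by auto
  qed
  then obtain P where P: "P \<in> pieces" "z \<in> P" "gate P (c a) \<noteq> z" "gate P (c m) \<noteq> z" by blast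
  have "P \<noteq> {}" using P(2) by blast
  have gates: "gate P (c a) \<noteq> gate P (c m)"
  proof
    assume eq: "gate P (c a) = gate P (c m)"
    have pM: "gate P (c a) \<in> M"
      using gate_in_piece[OF P(1) \<open>P \<noteq> {}\<close> xy(1)] piece_subset[OF P(1)] by blast
    have "0 < d (gate P (c a)) z" using P(3) pM zM by simp
    moreover have "d (c a) (c m) \<le> d (c a) (gate P (c a)) + d (gate P (c a)) (c m)"
      by (rule triangle[OF xy(1) pM xy(2)])
    ultimately show False
      using gate_between[OF P(1) xy(1) P(2)] gate_between[OF P(1) xy(2) P(2)] z(2) zy eq
        commute[of "c m" z] commute[of "c m" "gate P (c m)"] by auto
  qed
  obtain s t where st: "s \<in> {a..m}" "t \<in> {a..m}" "c s = gate P (c a)" "c t = gate P (c m)"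
    using path_through_gates[OF P(1) \<open>P \<noteq> {}\<close> c1 _ gates] m by auto
  have in_P: "c s \<in> P" "c t \<in> P" using st(3,4) gate_in_piece[OF P(1) \<open>P \<noteq> {}\<close>] xy by auto
  have hits: "\<exists>s t. s \<in> {a..b} \<and> t \<in> {a..b} \<and> s < t \<and> c s \<noteq> c t \<and> c s \<in> P \<and> c t \<in> P"
  proof (cases "s < t")
    case True
    then show ?thesis using st in_P gates m by (intro exI[of _ s] exI[of _ t]) auto
  next
    case False
    then have "t < s" using st(3,4) gates by (cases s t rule: linorder_cases) auto
    then show ?thesis using st in_P gates m by (intro exI[of _ t] exI[of _ s]) auto
  qed
  obtain s t where st: "s \<in> {a..b}" "t \<in> {a..b}" "s < t" "c s \<noteq> c t" "c s \<in> P" "c t \<in> P"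
    using hits by blast
  \<comment> \<open>Otherwise the loop would enter \<open>P\<close> for the first time and leave it for the last time at the
    same point, the gate of its base point.\<close>
  have base: "c a \<in> P"
  proof (rule ccontr)
    assume off: "c a \<notin> P"
    obtain f where f: "f \<in> {a..s}" "c f \<in> P" "\<And>r. r \<in> {a..<f} \<Longrightarrow> c r \<notin> P"
      by (rule path_on_first_hit[OF c closed_piece[OF P(1)] st(1,5)]) blast
    obtain h where h: "h \<in> {t..b}" "c h \<in> P" "\<And>r. r \<in> {h<..b} \<Longrightarrow> c r \<notin> P"
      by (rule path_on_last_hit[OF c closed_piece[OF P(1)] st(2,6)]) blast
    have af: "path_on c a f" and hb: "path_on c h b"
      using path_on_mono[OF c, of a f] path_on_mono[OF c, of h b] st f(1) h(1) by auto
    have "c f = gate P (c a)"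
      by (rule path_enters_at_gate[OF P(1) af _ f(2)]) (use f in auto)
    moreover have "c h = gate P (c b)"
      by (rule path_leaves_at_gate[OF P(1) hb _ h(2)]) (use h in auto)
    ultimately have "c f = c h" using loop by simp
    then have "f = a" using only_ends[of f h] f(1) h(1) st by auto
    with f(2) off show False by simp
  qed
  have arc: "c ` {u..v} \<subseteq> P"
    if "a \<le> u" "v \<le> b" "c u \<in> P" "c v \<in> P" "u \<noteq> a \<or> v \<noteq> b" for u v
  proof (rule arc_in_piece[OF P(1) _ _ that(3,4)])
    show "path_on c u v" by (rule path_on_mono[OF c]) (use that in auto)
    show "inj_on c {u..v}"
    proof (rule inj_onI)
      fix x y assume "x \<in> {u..v}" "y \<in> {u..v}" "c x = c y"
      then show "x = y"
        using only_ends[of x y] only_ends[of y x] that by (cases x y rule: linorder_cases) auto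
    qed
  qed
  have "c ` {a..s} \<subseteq> P" "c ` {s..t} \<subseteq> P" "c ` {t..b} \<subseteq> P"
    using arc[of a s] arc[of s t] arc[of t b] st base loop by auto
  moreover have "{a..b} \<subseteq> {a..s} \<union> {s..t} \<union> {t..b}" by auto
  ultimately have "c ` {a..b} \<subseteq> P" by blast
  with P(1) that show thesis by blast
qed

end

section \<open>Tree-graded spaces under bi-Lipschitz bijections\<close>

lemma graded_space_if_tree_graded:
  assumes "tree_graded M d Ps"
  shows "graded_space M d Ps"
proof -
  interpret Metric_space M d using assms by (simp add: tree_graded_def)
  show ?thesis
  proof
    fix P Q x y assume "P \<in> Ps" "Q \<in> Ps" "x \<in> P \<inter> Q" "y \<in> P \<inter> Q" "x \<noteq> y"
    then show "P = Q" using assms unfolding tree_graded_def by metis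
  qed (use assms in \<open>auto simp: tree_graded_def\<close>)
qed

lemma (in Metric_space) concat3_1_lipschitz:
  assumes g: "geodesic M d g1 l1" "geodesic M d g2 l2" "geodesic M d g3 l3"
    and v: "g1 l1 = g2 0" "g2 l2 = g3 0"
    and s: "0 \<le> s" "s \<le> t" "t \<le> l1 + l2 + l3"
  shows "concat3 g1 l1 g2 l2 g3 s \<in> M" "concat3 g1 l1 g2 l2 g3 t \<in> M"
    "d (concat3 g1 l1 g2 l2 g3 s) (concat3 g1 l1 g2 l2 g3 t) \<le> t - s"
proof -
  let ?c = "concat3 g1 l1 g2 l2 g3"
  have l: "0 \<le> l1" "0 \<le> l2" "0 \<le> l3" using g by (auto simp: geodesic_def)
  have m1: "g1 u \<in> M" if "0 \<le> u" "u \<le> l1" for u using g(1) that by (auto simp: geodesic_def)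
  have m2: "g2 u \<in> M" if "0 \<le> u" "u \<le> l2" for u using g(2) that by (auto simp: geodesic_def)
  have m3: "g3 u \<in> M" if "0 \<le> u" "u \<le> l3" for u using g(3) that by (auto simp: geodesic_def)
  have d1: "d (g1 u) (g1 w) = w - u" if "0 \<le> u" "u \<le> w" "w \<le> l1" for u w
    using g(1) that by (auto simp: geodesic_def)
  have d2: "d (g2 u) (g2 w) = w - u" if "0 \<le> u" "u \<le> w" "w \<le> l2" for u w
    using g(2) that by (auto simp: geodesic_def)
  have d3: "d (g3 u) (g3 w) = w - u" if "0 \<le> u" "u \<le> w" "w \<le> l3" for u w
    using g(3) that by (auto simp: geodesic_def)
  have mem: "?c u \<in> M" if "0 \<le> u" "u \<le> l1 + l2 + l3" for u
    using m1[of u] m2[of "u - l1"] m3[of "u - l1 - l2"] that by (auto simp: concat3_def)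
  then show "?c s \<in> M" "?c t \<in> M" using s by auto
  have c1: "?c u = g1 u" if "u \<le> l1" for u using that by (simp add: concat3_def)
  have c2: "?c u = g2 (u - l1)" if "l1 < u" "u \<le> l1 + l2" for u using that by (simp add: concat3_def)
  have c3: "?c u = g3 (u - l1 - l2)" if "l1 + l2 < u" for u using that l by (simp add: concat3_def)
  consider "t \<le> l1" | "s \<le> l1" "l1 < t" "t \<le> l1 + l2" | "s \<le> l1" "l1 + l2 < t"
    | "l1 < s" "t \<le> l1 + l2" | "l1 < s" "s \<le> l1 + l2" "l1 + l2 < t" | "l1 + l2 < s"
    by linarith
  then show "d (?c s) (?c t) \<le> t - s"
  proof cases
    case 1
    then show ?thesis using s d1[of s t] c1[of s] c1[of t] by auto
  next
    case 2
    have "d (g1 s) (g2 (t - l1)) \<le> d (g1 s) (g1 l1) + d (g2 0) (g2 (t - l1))"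
      unfolding v(1) by (rule triangle) (use m1[of s] m2[of 0] m2[of "t - l1"] s l 2 in auto)
    then show ?thesis using d1[of s l1] d2[of 0 "t - l1"] c1[of s] c2[of t] 2 s by auto
  next
    case 3
    have M: "g1 s \<in> M" "g2 0 \<in> M" "g3 0 \<in> M" "g3 (t - l1 - l2) \<in> M"
      using m1[of s] m2[of 0] m3[of 0] m3[of "t - l1 - l2"] s l 3 by auto
    have "d (g1 s) (g3 (t - l1 - l2)) \<le> d (g1 s) (g2 0) + d (g2 0) (g3 (t - l1 - l2))"
      "d (g2 0) (g3 (t - l1 - l2)) \<le> d (g2 0) (g3 0) + d (g3 0) (g3 (t - l1 - l2))"
      using triangle M by blast+
    then show ?thesis
      using d1[of s l1] d2[of 0 l2] d3[of 0 "t - l1 - l2"] c1[of s] c3[of t] 3 s l v by auto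
  next
    case 4
    then show ?thesis using s d2[of "s - l1" "t - l1"] c2[of s] c2[of t] by auto
  next
    case 5
    have "d (g2 (s - l1)) (g3 (t - l1 - l2)) \<le> d (g2 (s - l1)) (g2 l2) + d (g3 0) (g3 (t - l1 - l2))"
      unfolding v(2)
      by (rule triangle) (use m2[of "s - l1"] m3[of 0] m3[of "t - l1 - l2"] s l 5 in auto)
    then show ?thesis using d2[of "s - l1" l2] d3[of 0 "t - l1 - l2"] c2[of s] c3[of t] 5 s by auto
  next
    case 6
    then show ?thesis using s l d3[of "s - l1 - l2" "t - l1 - l2"] c3[of s] c3[of t] by auto
  qed
qed

text \<open>Completeness and closedness are transported directly. A geodesic between two points of an
  image piece is pulled back to an arc with ends in the piece, and a simple geodesic triangle to a
  simple loop or a point.\<close>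

lemma tree_graded_bilipschitz:
  assumes tg: "tree_graded M d Ps" and M': "Metric_space M' d'" and geo: "geodesic_subset d' M'"
    and h: "bij_betw h M M'" and K: "0 < K"
    and lower: "\<And>x y. x \<in> M \<Longrightarrow> y \<in> M \<Longrightarrow> d x y \<le> K * d' (h x) (h y)"
    and upper: "\<And>x y. x \<in> M \<Longrightarrow> y \<in> M \<Longrightarrow> d' (h x) (h y) \<le> K * d x y"
  shows "tree_graded M' d' ((`) h ` Ps)"
proof -
  interpret X: graded_space M d Ps by (rule graded_space_if_tree_graded[OF tg])
  interpret Y: Metric_space M' d' by (rule M')
  define f where "f = inv_into M h"
  have f: "f y \<in> M" "h (f y) = y" if "y \<in> M'" for y
    using that h unfolding f_def by (auto simp: bij_betw_def inv_into_into f_inv_into_f)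
  have hM: "h x \<in> M'" "f (h x) = x" if "x \<in> M" for x
    using that h unfolding f_def by (auto simp: bij_betw_def)
  have f_lip: "d (f y) (f y') \<le> K * d' y y'" if "y \<in> M'" "y' \<in> M'" for y y'
    using lower[of "f y" "f y'"] f that by auto
  have f_inj: "y = y'" if "y \<in> M'" "y' \<in> M'" "f y = f y'" for y y'
    by (metis f(2) that)
  have mem_image: "y \<in> h ` P \<longleftrightarrow> f y \<in> P" if "P \<in> Ps" "y \<in> M'" for P y
  proof
    assume "y \<in> h ` P"
    then obtain x where "x \<in> P" "y = h x" by blast
    then show "f y \<in> P" using hM(2)[of x] X.piece_subset[OF that(1)] by auto
  next
    assume "f y \<in> P"
    then show "y \<in> h ` P" using f(2)[OF that(2)] by (metis imageI)
  qed
  have image_subset_M: "h ` P \<subseteq> M'" if "P \<in> Ps" for P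
    using X.piece_subset[OF that] hM(1) by blast
  have complete: "Y.mcomplete"
    unfolding Y.mcomplete_def
  proof (intro allI impI)
    fix \<sigma> assume \<sigma>: "Y.MCauchy \<sigma>"
    then have \<sigma>M: "\<sigma> n \<in> M'" for n unfolding Y.MCauchy_def by blast
    have "X.MCauchy (f \<circ> \<sigma>)"
      unfolding X.MCauchy_def
    proof (intro conjI allI impI)
      show "range (f \<circ> \<sigma>) \<subseteq> M" using f(1)[OF \<sigma>M] by auto
      fix \<epsilon> :: real assume "0 < \<epsilon>"
      then have "0 < \<epsilon> / K" using K by simp
      then obtain N where N: "\<And>n n'. N \<le> n \<Longrightarrow> N \<le> n' \<Longrightarrow> d' (\<sigma> n) (\<sigma> n') < \<epsilon> / K"
        using \<sigma> unfolding Y.MCauchy_def by meson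
      have "d (f (\<sigma> n)) (f (\<sigma> n')) < \<epsilon>" if "N \<le> n" "N \<le> n'" for n n'
      proof -
        have "K * d' (\<sigma> n) (\<sigma> n') < \<epsilon>" using N[OF that] K by (simp add: field_simps)
        then show ?thesis using f_lip[OF \<sigma>M[of n] \<sigma>M[of n']] by linarith
      qed
      then show "\<exists>N. \<forall>n n'. N \<le> n \<longrightarrow> N \<le> n' \<longrightarrow> d ((f \<circ> \<sigma>) n) ((f \<circ> \<sigma>) n') < \<epsilon>" by auto
    qed
    moreover have "X.mcomplete" using tg by (simp add: tree_graded_def)
    ultimately obtain x where x: "limitin X.mtopology (f \<circ> \<sigma>) x sequentially"
      unfolding X.mcomplete_def by blast
    then have xM: "x \<in> M" by (simp add: X.limit_metric_sequentially)
    have "limitin Y.mtopology \<sigma> (h x) sequentially"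
      unfolding Y.limit_metric_sequentially
    proof (intro conjI allI impI)
      show "h x \<in> M'" by (rule hM(1)[OF xM])
      fix \<epsilon> :: real assume "0 < \<epsilon>"
      then have "0 < \<epsilon> / K" using K by simp
      then obtain N where N: "\<And>n. N \<le> n \<Longrightarrow> d (f (\<sigma> n)) x < \<epsilon> / K"
        using x unfolding X.limit_metric_sequentially o_def by meson
      have "d' (\<sigma> n) (h x) < \<epsilon>" if "N \<le> n" for n
      proof -
        have "K * d (f (\<sigma> n)) x < \<epsilon>" using N[OF that] K by (simp add: field_simps)
        then show ?thesis using upper[OF f(1)[OF \<sigma>M] xM, of n] f(2)[OF \<sigma>M[of n]] by simp
      qed
      then show "\<exists>N. \<forall>n\<ge>N. \<sigma> n \<in> M' \<and> d' (\<sigma> n) (h x) < \<epsilon>" using \<sigma>M by blast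
    qed
    then show "\<exists>x. limitin Y.mtopology \<sigma> x sequentially" ..
  qed
  have closed: "closedin Y.mtopology (h ` P)" if P: "P \<in> Ps" for P
    unfolding Y.closedin_metric
  proof (intro conjI allI impI)
    show "h ` P \<subseteq> M'" by (rule image_subset_M[OF P])
    fix y assume "y \<in> M' - h ` P"
    then have y: "y \<in> M'" "f y \<notin> P" using mem_image[OF P] by auto
    obtain r where r: "0 < r" "\<And>x. x \<in> P \<Longrightarrow> r \<le> d (f y) x"
      by (rule X.closedin_positive_distance[OF X.closed_piece[OF P] f(1)[OF y(1)] y(2)]) blast
    have far: "r / K \<le> d' y w" if "w \<in> h ` P" for w
    proof -
      have w: "w \<in> M'" using that image_subset_M[OF P] by blast
      then have "f w \<in> P" using mem_image[OF P w] that by blast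
      then have "r \<le> K * d' y w" using r(2) f_lip[OF y(1) w] by force
      then show ?thesis using K by (simp add: field_simps)
    qed
    have "disjnt (h ` P) (Y.mball y (r / K))"
      unfolding disjnt_iff
    proof (intro allI notI)
      fix w assume "w \<in> h ` P \<and> w \<in> Y.mball y (r / K)"
      then show False using far[of w] by auto
    qed
    moreover have "0 < r / K" using r(1) K by simp
    ultimately show "\<exists>r>0. disjnt (h ` P) (Y.mball y r)" by blast
  qed
  have geodesic_pieces: "geodesic_subset d' (h ` P)" if P: "P \<in> Ps" for P
    unfolding geodesic_subset_def
  proof (intro ballI)
    fix x y assume xy: "x \<in> h ` P" "y \<in> h ` P"
    then have xyM: "x \<in> M'" "y \<in> M'" using image_subset_M[OF P] by auto
    then obtain c l where c: "geodesic M' d' c l" "c 0 = x" "c l = y"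
      using geo unfolding geodesic_subset_def by meson
    have cM: "c t \<in> M'" if "t \<in> {0..l}" for t using c(1) that by (auto simp: geodesic_def)
    have dc: "d' (c s) (c t) = \<bar>s - t\<bar>" if "s \<in> {0..l}" "t \<in> {0..l}" for s t
      using c(1) that unfolding geodesic_def by blast
    have "X.path_on (f \<circ> c) 0 l"
    proof (rule X.lipschitz_path_on[where L = K])
      fix s t assume "s \<in> {0..l}" "t \<in> {0..l}"
      then show "d ((f \<circ> c) s) ((f \<circ> c) t) \<le> K * \<bar>s - t\<bar>"
        using f_lip[OF cM cM, of s t] dc[of s t] by simp
    qed (use f(1)[OF cM] in auto)
    moreover have "inj_on (f \<circ> c) {0..l}"
    proof (rule inj_onI)
      fix s t assume st: "s \<in> {0..l}" "t \<in> {0..l}" "(f \<circ> c) s = (f \<circ> c) t"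
      then have "c s = c t" using f_inj[OF cM[OF st(1)] cM[OF st(2)]] by simp
      then show "s = t" using dc[OF st(1,2)] Y.mdist_zero[OF cM[OF st(2)]] by simp
    qed
    moreover have "(f \<circ> c) 0 \<in> P" "(f \<circ> c) l \<in> P"
      using mem_image[OF P] xy xyM c by auto
    ultimately have "(f \<circ> c) ` {0..l} \<subseteq> P" by (rule X.arc_in_piece[OF P])
    then have "c ` {0..l} \<subseteq> h ` P" using mem_image[OF P cM] by auto
    then have "geodesic (h ` P) d' c l" using c(1) by (simp add: geodesic_def)
    then show "\<exists>c l. geodesic (h ` P) d' c l \<and> c 0 = x \<and> c l = y" using c by blast
  qed
  have meet: "x = y"
    if PQ: "P \<in> Ps" "Q \<in> Ps" "h ` P \<noteq> h ` Q" and xy: "x \<in> h ` P \<inter> h ` Q" "y \<in> h ` P \<inter> h ` Q"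
    for P Q x y
  proof -
    have xyM: "x \<in> M'" "y \<in> M'" using xy image_subset_M[OF PQ(1)] by auto
    have "f x \<in> P \<inter> Q" "f y \<in> P \<inter> Q" using xy mem_image PQ xyM by auto
    then have "f x = f y" using X.pieces_meet[OF PQ(1,2)] PQ(3) by blast
    then show "x = y" by (rule f_inj[OF xyM])
  qed
  have triangles: "\<exists>P\<in>Ps. T \<subseteq> h ` P" if T: "simple_geodesic_triangle M' d' T" for T
  proof -
    obtain g1 l1 g2 l2 g3 l3 where g: "geodesic M' d' g1 l1" "geodesic M' d' g2 l2" "geodesic M' d' g3 l3"
      and v: "g1 l1 = g2 0" "g2 l2 = g3 0" "g3 l3 = g1 0"
      and inj: "inj_on (concat3 g1 l1 g2 l2 g3) {0..<l1 + l2 + l3}"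
      and Teq: "T = concat3 g1 l1 g2 l2 g3 ` {0..l1 + l2 + l3}"
      using T unfolding simple_geodesic_triangle_def by metis
    define c where "c = concat3 g1 l1 g2 l2 g3"
    define l where "l = l1 + l2 + l3"
    have ls: "0 \<le> l1" "0 \<le> l2" "0 \<le> l3" using g by (auto simp: geodesic_def)
    have cM: "c t \<in> M'" if "t \<in> {0..l}" for t
      using Y.concat3_1_lipschitz(1)[OF g v(1,2), of t t] that by (auto simp: c_def l_def)
    have lip1: "d' (c s) (c t) \<le> \<bar>s - t\<bar>" if "s \<in> {0..l}" "t \<in> {0..l}" for s t
    proof (cases "s \<le> t")
      case True
      then show ?thesis
        using Y.concat3_1_lipschitz(3)[OF g v(1,2), of s t] that by (auto simp: c_def l_def)
    next
      case False
      then show ?thesis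
        using Y.concat3_1_lipschitz(3)[OF g v(1,2), of t s] that Y.commute[of "c s" "c t"]
        by (auto simp: c_def l_def)
    qed
    have path: "X.path_on (f \<circ> c) 0 l"
    proof (rule X.lipschitz_path_on[where L = K])
      fix s t assume st: "s \<in> {0..l}" "t \<in> {0..l}"
      have "d (f (c s)) (f (c t)) \<le> K * d' (c s) (c t)" using f_lip cM st by blast
      also have "\<dots> \<le> K * \<bar>s - t\<bar>" using lip1[OF st] K by simp
      finally show "d ((f \<circ> c) s) ((f \<circ> c) t) \<le> K * \<bar>s - t\<bar>" by simp
    qed (use f(1)[OF cM] in auto)
    have "\<exists>P\<in>Ps. (f \<circ> c) ` {0..l} \<subseteq> P"
    proof (cases "l = 0")
      case True
      have x: "f (c 0) \<in> M" using f(1)[OF cM] True by simp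
      note triv = X.seg_trivial[OF x]
      obtain P where "P \<in> Ps" "{f (c 0)} \<subseteq> P"
        by (rule X.triangle_in_piece[OF triv triv triv]) auto
      then show ?thesis using True by auto
    next
      case False
      then have l: "0 < l" using ls by (simp add: l_def)
      have loop: "c 0 = c l"
        using ls v by (auto simp: c_def l_def concat3_def)
      have "inj_on (f \<circ> c) {0..<l}"
      proof (rule inj_onI)
        fix s t assume st: "s \<in> {0..<l}" "t \<in> {0..<l}" "(f \<circ> c) s = (f \<circ> c) t"
        then have "c s = c t" using f_inj[OF cM cM, of s t] by simp
        then show "s = t" using inj_onD[OF inj] st(1,2) by (simp add: c_def l_def)
      qed
      moreover have "(f \<circ> c) 0 = (f \<circ> c) l" using loop by simp
      ultimately obtain P where "P \<in> Ps" "(f \<circ> c) ` {0..l} \<subseteq> P"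
        using X.loop_in_piece[OF path l] by blast
      then show ?thesis by blast
    qed
    then obtain P where P: "P \<in> Ps" "(f \<circ> c) ` {0..l} \<subseteq> P" by blast
    have "c ` {0..l} \<subseteq> h ` P" using mem_image[OF P(1) cM] P(2) by auto
    then show ?thesis using P(1) Teq by (auto simp: c_def l_def)
  qed
  show ?thesis
    unfolding tree_graded_def
  proof (intro conjI)
    show "\<forall>P\<in>(`) h ` Ps. closedin Y.mtopology P \<and> geodesic_subset d' P"
      using closed geodesic_pieces by auto
    show "\<forall>P\<in>(`) h ` Ps. \<forall>Q\<in>(`) h ` Ps. P \<noteq> Q \<longrightarrow> (\<forall>x\<in>P \<inter> Q. \<forall>y\<in>P \<inter> Q. x = y)"
    proof (intro ballI impI)
      fix P' Q' x y
      assume "P' \<in> (`) h ` Ps" "Q' \<in> (`) h ` Ps" and ne: "P' \<noteq> Q'" and xy: "x \<in> P' \<inter> Q'" "y \<in> P' \<inter> Q'"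
      then obtain P Q where "P \<in> Ps" "Q \<in> Ps" "P' = h ` P" "Q' = h ` Q" by (elim imageE)
      with ne xy show "x = y" using meet[of P Q x y] by simp
    qed
    show "\<forall>T. simple_geodesic_triangle M' d' T \<longrightarrow> (\<exists>P\<in>(`) h ` Ps. T \<subseteq> P)"
      using triangles by simp
  qed (fact M' complete geo)+
qed

section \<open>Asymptotic cones\<close>

lemma cone_seqs_iff_bounded:
  assumes om: "nonprincipal_ultrafilter \<omega>" and pos: "\<And>n. 0 < d n"
  shows "x \<in> cone_seqs \<omega> e d \<longleftrightarrow> (\<exists>B. \<forall>\<^sub>F n in \<omega>. dist (x n) (e n) \<le> B * d n)"
proof
  assume "x \<in> cone_seqs \<omega> e d"
  then obtain r where "((\<lambda>n. dist (x n) (e n) / d n) \<longlongrightarrow> r) \<omega>" by (auto simp: cone_seqs_def)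
  then have "\<forall>\<^sub>F n in \<omega>. dist (x n) (e n) / d n < r + 1" by (rule order_tendstoD(2)) simp
  then have "\<forall>\<^sub>F n in \<omega>. dist (x n) (e n) \<le> (r + 1) * d n"
  proof eventually_elim
    case (elim n)
    then show ?case using pos[of n] by (simp add: pos_divide_less_eq)
  qed
  then show "\<exists>B. \<forall>\<^sub>F n in \<omega>. dist (x n) (e n) \<le> B * d n" by blast
next
  assume "\<exists>B. \<forall>\<^sub>F n in \<omega>. dist (x n) (e n) \<le> B * d n"
  then obtain B where B: "\<forall>\<^sub>F n in \<omega>. dist (x n) (e n) \<le> B * d n" by blast
  have "\<forall>\<^sub>F n in \<omega>. \<bar>dist (x n) (e n) / d n\<bar> \<le> B"
    using B
  proof eventually_elim
    case (elim n)
    then show ?case using pos[of n] by (simp add: pos_divide_le_eq)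
  qed
  then show "x \<in> cone_seqs \<omega> e d"
    using ultrafilter_bounded_tendsto[OF om] by (simp add: cone_seqs_def)
qed

text \<open>The distance from \<open>e n\<close> to a set need not be attained. An approximating point costs an
  additional \<open>d n\<close>, which only changes the bound.\<close>

lemma cone_indices_iff:
  assumes pos: "\<And>n. 0 < d n"
  shows "s \<in> cone_indices \<omega> e d I A \<longleftrightarrow>
     range s \<subseteq> I \<and> (\<exists>B. \<forall>\<^sub>F n in \<omega>. \<exists>a\<in>A (s n). dist (e n) a \<le> B * d n)"
proof -
  have "(\<exists>B. \<forall>\<^sub>F n in \<omega>. edist {e n} (A (s n)) / ereal (d n) \<le> ereal B) \<longleftrightarrow>
        (\<exists>B. \<forall>\<^sub>F n in \<omega>. \<exists>a\<in>A (s n). dist (e n) a \<le> B * d n)" (is "?L \<longleftrightarrow> ?R")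
  proof
    assume ?L
    then obtain B where "\<forall>\<^sub>F n in \<omega>. edist {e n} (A (s n)) / ereal (d n) \<le> ereal B" by blast
    then have "\<forall>\<^sub>F n in \<omega>. \<exists>a\<in>A (s n). dist (e n) a \<le> (B + 1) * d n"
    proof eventually_elim
      case (elim n)
      have d: "0 < d n" by (rule pos)
      have "edist {e n} (A (s n)) \<le> ereal (d n * B)"
        using elim d by (simp add: ereal_divide_le_pos)
      also have "\<dots> < ereal ((B + 1) * d n)" using d by (simp add: algebra_simps)
      finally have "e n \<in> nbhd ((B + 1) * d n) (A (s n))" by (simp add: nbhd_def)
      then show ?case by (auto simp: nbhd_iff intro: less_imp_le)
    qed
    then show ?R by blast
  next
    assume ?R
    then obtain B where "\<forall>\<^sub>F n in \<omega>. \<exists>a\<in>A (s n). dist (e n) a \<le> B * d n" by blast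
    then have "\<forall>\<^sub>F n in \<omega>. edist {e n} (A (s n)) / ereal (d n) \<le> ereal B"
    proof eventually_elim
      case (elim n)
      have d: "0 < d n" by (rule pos)
      obtain a where a: "a \<in> A (s n)" "dist (e n) a \<le> B * d n" using elim by blast
      have "edist {e n} (A (s n)) \<le> ereal (dist (e n) a)"
        unfolding edist_def using a(1) by (auto intro: INF_lower)
      also have "\<dots> \<le> ereal (d n * B)" using a(2) by (simp add: mult.commute)
      finally show ?case using d by (simp add: ereal_divide_le_pos)
    qed
    then show ?L by blast
  qed
  then show ?thesis by (auto simp: cone_indices_def)
qed

context
  fixes \<omega> :: "nat filter" and e :: "nat \<Rightarrow> 'a::metric_space" and d :: "nat \<Rightarrow> real"
  assumes om: "nonprincipal_ultrafilter \<omega>" and pos: "\<And>n. 0 < d n"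
begin

lemma cone_point_in_cone: "x \<in> cone_seqs \<omega> e d \<Longrightarrow> cone_point \<omega> e d x \<in> asym_cone \<omega> e d"
  unfolding cone_point_def asym_cone_def by (rule quotientI)

lemma in_cone_point: "x \<in> cone_seqs \<omega> e d \<Longrightarrow> x \<in> cone_point \<omega> e d x"
  unfolding cone_point_def by (rule equiv_class_self[OF equiv_cone_rel[OF om pos]])

lemma cone_point_eqI: "(x, y) \<in> cone_rel \<omega> e d \<Longrightarrow> cone_point \<omega> e d x = cone_point \<omega> e d y"
  unfolding cone_point_def by (rule equiv_class_eq[OF equiv_cone_rel[OF om pos]])

lemma cone_dist_cone_point:
  assumes "x \<in> cone_seqs \<omega> e d" "y \<in> cone_seqs \<omega> e d"
    and "((\<lambda>n. dist (x n) (y n) / d n) \<longlongrightarrow> r) \<omega>"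
  shows "cone_dist \<omega> e d (cone_point \<omega> e d x) (cone_point \<omega> e d y) = r"
  by (rule cone_dist_eqI[OF om pos cone_point_in_cone in_cone_point cone_point_in_cone in_cone_point])
    (use assms in auto)

lemma tendsto_cone_dist:
  assumes x: "x \<in> cone_seqs \<omega> e d" and y: "y \<in> cone_seqs \<omega> e d"
  shows "((\<lambda>n. dist (x n) (y n) / d n) \<longlongrightarrow>
    cone_dist \<omega> e d (cone_point \<omega> e d x) (cone_point \<omega> e d y)) \<omega>"
proof -
  obtain r where r: "((\<lambda>n. dist (x n) (y n) / d n) \<longlongrightarrow> r) \<omega>"
    using cone_seqs_tendsto[OF om pos x y] by blast
  then show ?thesis using cone_dist_cone_point[OF x y r] by simp
qed

lemma cone_lim_subset: "cone_lim \<omega> e d B \<subseteq> asym_cone \<omega> e d"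
  unfolding cone_lim_def using cone_point_in_cone by blast

text \<open>Geodesics \<open>c n\<close> from \<open>x n\<close> to \<open>y n\<close>, run through at speed \<open>d n\<close> and stopped at their
  endpoint, converge to a geodesic of the cone.\<close>

lemma geodesic_cone:
  assumes geo: "geodesic_subset dist (UNIV :: 'a set)"
  shows "geodesic_subset (cone_dist \<omega> e d) (asym_cone \<omega> e d)"
  unfolding geodesic_subset_def
proof (intro ballI)
  fix p p' assume p: "p \<in> asym_cone \<omega> e d" and p': "p' \<in> asym_cone \<omega> e d"
  obtain x where x: "x \<in> cone_seqs \<omega> e d" "p = cone_point \<omega> e d x"
    by (rule cone_repr[OF om pos p])
  obtain y where y: "y \<in> cone_seqs \<omega> e d" "p' = cone_point \<omega> e d y"
    by (rule cone_repr[OF om pos p'])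
  obtain r where r: "((\<lambda>n. dist (x n) (y n) / d n) \<longlongrightarrow> r) \<omega>"
    using cone_seqs_tendsto[OF om pos x(1) y(1)] by blast
  have r0: "0 \<le> r" by (rule tendsto_scaled_nonneg[OF om pos r])
  have "\<forall>n. \<exists>c l. geodesic UNIV dist c l \<and> c 0 = x n \<and> c l = y n"
    using geo unfolding geodesic_subset_def by blast
  then obtain c l where c: "\<And>n. geodesic UNIV dist (c n) (l n)" "\<And>n. c n 0 = x n" "\<And>n. c n (l n) = y n"
    by metis
  have l0: "0 \<le> l n" for n using c(1) by (auto simp: geodesic_def)
  have dc: "dist (c n s) (c n t) = \<bar>s - t\<bar>" if "0 \<le> s" "s \<le> l n" "0 \<le> t" "t \<le> l n" for n s t
    using c(1)[of n] that by (auto simp: geodesic_def)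
  have l: "l n = dist (x n) (y n)" for n
    using dc[of 0 n "l n"] l0[of n] c(2,3)[of n] by simp
  define z where "z t n = c n (min (t * d n) (l n))" for t n
  have abs_scaled: "\<bar>a - b\<bar> / d n = \<bar>a / d n - b / d n\<bar>" for a b n
    using pos[of n] by (simp flip: diff_divide_distrib)
  have min_scaled: "min (t * d n) (l n) / d n = min t (dist (x n) (y n) / d n)" for t n
    using pos[of n] by (simp add: l min_divide_distrib_right)
  have dz: "dist (z s n) (z t n) / d n = \<bar>min s (dist (x n) (y n) / d n) - min t (dist (x n) (y n) / d n)\<bar>"
    if "0 \<le> s" "0 \<le> t" for s t n
  proof -
    have "dist (z s n) (z t n) = \<bar>min (s * d n) (l n) - min (t * d n) (l n)\<bar>"
      unfolding z_def by (rule dc) (use that pos[of n] l0[of n] in auto)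
    then show ?thesis by (simp only: abs_scaled min_scaled)
  qed
  have z0: "z 0 = x" using l0 c(2) pos by (auto simp: z_def fun_eq_iff)
  have zseq: "z t \<in> cone_seqs \<omega> e d" if t: "0 \<le> t" for t
  proof -
    obtain B where B: "\<forall>\<^sub>F n in \<omega>. dist (x n) (e n) \<le> B * d n"
      using x(1) cone_seqs_iff_bounded[of \<omega> d, OF om pos] by blast
    have "\<forall>\<^sub>F n in \<omega>. dist (z t n) (e n) \<le> (t + B) * d n"
      using B
    proof eventually_elim
      case (elim n)
      have "dist (z t n) (z 0 n) = \<bar>min (t * d n) (l n) - 0\<bar>"
        unfolding z_def using t pos[of n] l0[of n] by (subst dc) auto
      then have "dist (z t n) (x n) \<le> t * d n" using z0 t pos[of n] l0[of n] by auto
      moreover have "dist (z t n) (e n) \<le> dist (z t n) (x n) + dist (x n) (e n)" by (rule dist_triangle)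
      ultimately show ?case using elim by (simp add: distrib_right)
    qed
    then show ?thesis using cone_seqs_iff_bounded[of \<omega> d, OF om pos] by blast
  qed
  have dlim: "((\<lambda>n. dist (z s n) (z t n) / d n) \<longlongrightarrow> \<bar>s - t\<bar>) \<omega>" if "s \<in> {0..r}" "t \<in> {0..r}" for s t
  proof -
    have "((\<lambda>n. dist (z s n) (z t n) / d n) \<longlongrightarrow> \<bar>min s r - min t r\<bar>) \<omega>"
      unfolding dz[OF atLeastAtMost_iff[THEN iffD1, OF that(1), THEN conjunct1]
          atLeastAtMost_iff[THEN iffD1, OF that(2), THEN conjunct1]]
      by (intro tendsto_intros r)
    then show ?thesis using that by simp
  qed
  have "((\<lambda>n. dist (z r n) (y n) / d n) \<longlongrightarrow> \<bar>min r r - r\<bar>) \<omega>"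
  proof -
    have "dist (z r n) (y n) / d n = \<bar>min r (dist (x n) (y n) / d n) - dist (x n) (y n) / d n\<bar>" for n
    proof -
      have "dist (z r n) (y n) = \<bar>min (r * d n) (l n) - l n\<bar>"
        unfolding z_def c(3)[of n, symmetric] by (rule dc) (use r0 pos[of n] l0[of n] in auto)
      then have "dist (z r n) (y n) / d n = \<bar>min r (dist (x n) (y n) / d n) - l n / d n\<bar>"
        by (simp only: abs_scaled min_scaled)
      then show ?thesis by (simp only: l)
    qed
    then show ?thesis by (simp only:) (intro tendsto_intros r)
  qed
  then have zr: "cone_point \<omega> e d (z r) = p'"
    using zseq[OF r0] y by (auto intro!: cone_point_eqI simp: cone_rel_def)
  have "geodesic (asym_cone \<omega> e d) (cone_dist \<omega> e d) (\<lambda>t. cone_point \<omega> e d (z t)) r"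
    unfolding geodesic_def
    using r0 cone_point_in_cone[OF zseq] cone_dist_cone_point[OF zseq zseq dlim] by auto
  then show "\<exists>c l. geodesic (asym_cone \<omega> e d) (cone_dist \<omega> e d) c l \<and> c 0 = p \<and> c l = p'"
    using z0 zr x(2) by (intro exI[of _ "\<lambda>t. cone_point \<omega> e d (z t)"] exI[of _ r]) auto
qed

end

section \<open>The map induced by a quasi-isometry on asymptotic cones\<close>

locale quasi_inverses_cone = quasi_inverses q g L C
  for q :: "'a::metric_space \<Rightarrow> 'b::metric_space" and g :: "'b \<Rightarrow> 'a" and L C :: real +
  fixes \<omega> :: "nat filter" and e :: "nat \<Rightarrow> 'b" and d :: "nat \<Rightarrow> real"
  assumes om: "nonprincipal_ultrafilter \<omega>" and pos: "\<And>n. 0 < d n"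
    and scale: "filterlim d at_top \<omega>"
begin

abbreviation seqs where "seqs \<equiv> cone_seqs \<omega> (\<lambda>n. g (e n)) d"
abbreviation seqs' where "seqs' \<equiv> cone_seqs \<omega> e d"
abbreviation pt where "pt \<equiv> cone_point \<omega> (\<lambda>n. g (e n)) d"
abbreviation pt' where "pt' \<equiv> cone_point \<omega> e d"
abbreviation cone where "cone \<equiv> asym_cone \<omega> (\<lambda>n. g (e n)) d"
abbreviation cone' where "cone' \<equiv> asym_cone \<omega> e d"
abbreviation cdist where "cdist \<equiv> cone_dist \<omega> (\<lambda>n. g (e n)) d"
abbreviation cdist' where "cdist' \<equiv> cone_dist \<omega> e d"

lemma eventually_const_le: "\<forall>\<^sub>F n in \<omega>. c \<le> \<bar>c\<bar> * d n"
proof -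
  have "\<forall>\<^sub>F n in \<omega>. 1 \<le> d n" using scale by (simp add: filterlim_at_top)
  then show ?thesis
  proof eventually_elim
    case (elim n)
    then have "\<bar>c\<bar> * 1 \<le> \<bar>c\<bar> * d n" by (rule mult_left_mono) simp
    then show ?case by simp
  qed
qed

lemma tendsto_const_over_scale: "((\<lambda>n. c / d n) \<longlongrightarrow> 0) \<omega>"
  by (rule tendsto_divide_0[OF tendsto_const filterlim_at_top_imp_at_infinity[OF scale]])

lemma image_seqs:
  assumes "x \<in> seqs"
  shows "(\<lambda>n. q (x n)) \<in> seqs'"
proof -
  obtain B where B: "\<forall>\<^sub>F n in \<omega>. dist (x n) (g (e n)) \<le> B * d n"
    using assms cone_seqs_iff_bounded[of \<omega> d x "\<lambda>n. g (e n)", OF om pos] by blast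
  have "\<forall>\<^sub>F n in \<omega>. dist (q (x n)) (e n) \<le> (L * B + \<bar>2 * C\<bar>) * d n"
    using B eventually_const_le[of "2 * C"]
  proof eventually_elim
    case (elim n)
    have "dist (q (x n)) (e n) \<le> L * dist (x n) (g (e n)) + 2 * C"
      using dist_image_le[of "e n" "x n"] by (simp add: dist_commute)
    moreover have "L * dist (x n) (g (e n)) \<le> L * (B * d n)" using elim(1) constants by simp
    ultimately show ?case using elim(2) by (simp add: algebra_simps)
  qed
  then show ?thesis using cone_seqs_iff_bounded[of \<omega> d "\<lambda>n. q (x n)" e, OF om pos] by blast
qed

text \<open>Two kinds of preimages occur: \<open>g \<circ> y\<close>, which shows surjectivity, and sequences with \<open>q (x n) = y n\<close>,
  chosen in prescribed subsets, which are needed for limit sets.\<close>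

lemma preimage_seqs:
  assumes y: "y \<in> seqs'" and x: "\<forall>\<^sub>F n in \<omega>. dist (q (x n)) (y n) \<le> C"
  shows "x \<in> seqs"
proof -
  obtain B where B: "\<forall>\<^sub>F n in \<omega>. dist (y n) (e n) \<le> B * d n"
    using y cone_seqs_iff_bounded[of \<omega> d y e, OF om pos] by blast
  have "\<forall>\<^sub>F n in \<omega>. dist (x n) (g (e n)) \<le> (L * B + \<bar>L * C + 2 * C\<bar>) * d n"
    using B x eventually_const_le[of "L * C + 2 * C"]
  proof eventually_elim
    case (elim n)
    have "dist (e n) (q (x n)) \<le> B * d n + C"
      using elim(1,2) dist_triangle2[of "e n" "q (x n)" "y n"] by (simp add: dist_commute)
    then have "L * dist (e n) (q (x n)) \<le> L * (B * d n + C)" using constants by simp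
    then have "dist (x n) (g (e n)) \<le> L * (B * d n + C) + 2 * C"
      using dist_preimage_le[of "e n" "x n"] by (simp add: dist_commute)
    with elim(3) show ?case by (simp add: algebra_simps)
  qed
  then show ?thesis using cone_seqs_iff_bounded[of \<omega> d x "\<lambda>n. g (e n)", OF om pos] by blast
qed

text \<open>The additive constant of \<open>q\<close> disappears in the limit of the rescaled distances.\<close>

lemma limits_compare:
  assumes r: "((\<lambda>n. dist (x n) (y n) / d n) \<longlongrightarrow> r) \<omega>"
    and r': "((\<lambda>n. dist (q (x n)) (q (y n)) / d n) \<longlongrightarrow> r') \<omega>"
  shows "r' \<le> L * r" "r \<le> L * r'"
proof -
  have bot: "\<omega> \<noteq> bot" by (rule omega_nbot[OF om pos])
  have "((\<lambda>n. L * (dist (x n) (y n) / d n) + C / d n) \<longlongrightarrow> L * r + 0) \<omega>"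
    by (intro tendsto_intros r tendsto_const_over_scale)
  moreover have "dist (q (x n)) (q (y n)) / d n \<le> L * (dist (x n) (y n) / d n) + C / d n" for n
    using divide_right_mono[OF q_upper[of "x n" "y n"], of "d n"] pos[of n] by (simp add: add_divide_distrib)
  ultimately have "r' \<le> L * r + 0" by (intro tendsto_le[OF bot _ r']) auto
  then show "r' \<le> L * r" by simp
  have "((\<lambda>n. L * (dist (q (x n)) (q (y n)) / d n + C / d n)) \<longlongrightarrow> L * (r' + 0)) \<omega>"
    by (intro tendsto_intros r' tendsto_const_over_scale)
  moreover have "dist (x n) (y n) / d n \<le> L * (dist (q (x n)) (q (y n)) / d n + C / d n)" for n
    using divide_right_mono[OF q_lower[of "x n" "y n"], of "d n"] pos[of n]
    by (simp add: add_divide_distrib distrib_left)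
  ultimately have "r \<le> L * (r' + 0)" by (intro tendsto_le[OF bot _ r]) auto
  then show "r \<le> L * r'" by simp
qed

text \<open>Any representative would do (see \<open>induced_pt\<close>); one is chosen to get a function on classes.\<close>

definition induced :: "(nat \<Rightarrow> 'a) set \<Rightarrow> (nat \<Rightarrow> 'b) set" where
  "induced p = pt' (\<lambda>n. q ((SOME x. x \<in> p \<and> x \<in> seqs) n))"

lemma induced_pt:
  assumes x: "x \<in> seqs"
  shows "induced (pt x) = pt' (\<lambda>n. q (x n))"
proof -
  define y where "y = (SOME y. y \<in> pt x \<and> y \<in> seqs)"
  have "\<exists>y. y \<in> pt x \<and> y \<in> seqs" using in_cone_point[OF om pos x] x by blast
  then have y: "y \<in> pt x" "y \<in> seqs" unfolding y_def by (metis (mono_tags, lifting) someI_ex)+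
  then have yx: "((\<lambda>n. dist (y n) (x n) / d n) \<longlongrightarrow> 0) \<omega>"
    by (auto simp: cone_point_def cone_rel_def dist_commute)
  note S = image_seqs[OF y(2)] image_seqs[OF x]
  obtain r where r: "((\<lambda>n. dist (q (y n)) (q (x n)) / d n) \<longlongrightarrow> r) \<omega>"
    using cone_seqs_tendsto[OF om pos S] by blast
  have "r \<le> 0" using limits_compare(1)[OF yx r] by simp
  moreover have "0 \<le> r" using tendsto_scaled_nonneg[OF om pos r] .
  ultimately have "((\<lambda>n. q (y n)), (\<lambda>n. q (x n))) \<in> cone_rel \<omega> e d"
    using r S by (simp add: cone_rel_def)
  then show ?thesis unfolding induced_def y_def[symmetric] by (rule cone_point_eqI[OF om pos])
qed

lemma induced_dist:
  assumes "p \<in> cone" "p' \<in> cone"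
  shows "cdist' (induced p) (induced p') \<le> L * cdist p p'" "cdist p p' \<le> L * cdist' (induced p) (induced p')"
proof -
  obtain x where x: "x \<in> seqs" "p = pt x" by (rule cone_repr[OF om pos assms(1)])
  obtain y where y: "y \<in> seqs" "p' = pt y" by (rule cone_repr[OF om pos assms(2)])
  note lims = tendsto_cone_dist[OF om pos x(1) y(1)]
    tendsto_cone_dist[OF om pos image_seqs[OF x(1)] image_seqs[OF y(1)]]
  show "cdist' (induced p) (induced p') \<le> L * cdist p p'" "cdist p p' \<le> L * cdist' (induced p) (induced p')"
    using limits_compare[OF lims] x y by (simp_all add: induced_pt)
qed

lemma induced_preimage:
  assumes y: "y \<in> seqs'" and x: "\<forall>\<^sub>F n in \<omega>. dist (q (x n)) (y n) \<le> C"
  shows "x \<in> seqs" "induced (pt x) = pt' y"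
proof -
  show xs: "x \<in> seqs" by (rule preimage_seqs[OF y x])
  obtain r where r: "((\<lambda>n. dist (q (x n)) (y n) / d n) \<longlongrightarrow> r) \<omega>"
    using cone_seqs_tendsto[OF om pos image_seqs[OF xs] y] by blast
  have "\<forall>\<^sub>F n in \<omega>. dist (q (x n)) (y n) / d n \<le> C / d n"
    using x by eventually_elim (use pos in \<open>simp add: divide_right_mono less_imp_le\<close>)
  then have "r \<le> 0" by (rule tendsto_le[OF omega_nbot[OF om pos] tendsto_const_over_scale r])
  moreover have "0 \<le> r" using tendsto_scaled_nonneg[OF om pos r] .
  ultimately have "((\<lambda>n. q (x n)), y) \<in> cone_rel \<omega> e d"
    using r image_seqs[OF xs] y by (simp add: cone_rel_def)
  then show "induced (pt x) = pt' y"
    unfolding induced_pt[OF xs] by (rule cone_point_eqI[OF om pos])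
qed

lemma bij_induced: "bij_betw induced cone cone'"
  unfolding bij_betw_def
proof
  interpret X: Metric_space cone cdist by (rule Metric_space_cone[OF om pos])
  interpret Y: Metric_space cone' cdist' by (rule Metric_space_cone[OF om pos])
  have mem: "induced p \<in> cone'" if p: "p \<in> cone" for p
  proof -
    obtain x where x: "x \<in> seqs" "p = pt x" by (rule cone_repr[OF om pos p])
    show ?thesis
      unfolding x(2) induced_pt[OF x(1)] by (rule cone_point_in_cone[OF om pos image_seqs[OF x(1)]])
  qed
  show "inj_on induced cone"
  proof (rule inj_onI)
    fix p p' assume p: "p \<in> cone" "p' \<in> cone" "induced p = induced p'"
    have "cdist p p' \<le> 0"
      using induced_dist(2)[OF p(1,2)] p(3) Y.mdist_zero[OF mem[OF p(2)]] by simp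
    then have "cdist p p' = 0" using X.nonneg[of p p'] by linarith
    then show "p = p'" using p by simp
  qed
  show "induced ` cone = cone'"
  proof
    show "induced ` cone \<subseteq> cone'" using mem by blast
    show "cone' \<subseteq> induced ` cone"
    proof
      fix p assume p: "p \<in> cone'"
      obtain y where y: "y \<in> seqs'" "p = pt' y" by (rule cone_repr[OF om pos p])
      have "\<forall>\<^sub>F n in \<omega>. dist (q (g (y n))) (y n) \<le> C" using qg by simp
      note pre = induced_preimage[OF y(1) this]
      show "p \<in> induced ` cone"
        using pre(2) y(2) cone_point_in_cone[OF om pos pre(1)] by (metis imageI)
    qed
  qed
qed

lemma induced_cone_lim:
  "induced ` cone_lim \<omega> (\<lambda>n. g (e n)) d B = cone_lim \<omega> e d (\<lambda>n. q ` B n)"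
proof
  show "induced ` cone_lim \<omega> (\<lambda>n. g (e n)) d B \<subseteq> cone_lim \<omega> e d (\<lambda>n. q ` B n)"
  proof
    fix p assume "p \<in> induced ` cone_lim \<omega> (\<lambda>n. g (e n)) d B"
    then obtain x where x: "x \<in> seqs" "\<forall>\<^sub>F n in \<omega>. x n \<in> B n" "p = induced (pt x)"
      unfolding cone_lim_def by blast
    have "\<forall>\<^sub>F n in \<omega>. q (x n) \<in> q ` B n" using x(2) by eventually_elim blast
    then show "p \<in> cone_lim \<omega> e d (\<lambda>n. q ` B n)"
      using image_seqs[OF x(1)] induced_pt[OF x(1)] x(3) unfolding cone_lim_def by blast
  qed
  show "cone_lim \<omega> e d (\<lambda>n. q ` B n) \<subseteq> induced ` cone_lim \<omega> (\<lambda>n. g (e n)) d B"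
  proof
    fix p assume "p \<in> cone_lim \<omega> e d (\<lambda>n. q ` B n)"
    then obtain y where y: "y \<in> seqs'" "\<forall>\<^sub>F n in \<omega>. y n \<in> q ` B n" "p = pt' y"
      unfolding cone_lim_def by blast
    \<comment> \<open>Only the almost surely many \<open>n\<close> for which \<open>y n\<close> lies in the image matter.\<close>
    define x where "x n = (SOME a. a \<in> B n \<and> q a = y n)" for n
    have x: "\<forall>\<^sub>F n in \<omega>. x n \<in> B n \<and> q (x n) = y n"
      using y(2)
    proof eventually_elim
      case (elim n)
      then have "\<exists>a. a \<in> B n \<and> q a = y n" by auto
      then show ?case unfolding x_def by (rule someI_ex)
    qed
    then have "\<forall>\<^sub>F n in \<omega>. dist (q (x n)) (y n) \<le> C"
      by eventually_elim (use constants in simp)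
    note pre = induced_preimage[OF y(1) this]
    have "\<forall>\<^sub>F n in \<omega>. x n \<in> B n" using x by eventually_elim blast
    then have "pt x \<in> cone_lim \<omega> (\<lambda>n. g (e n)) d B" using pre(1) unfolding cone_lim_def by blast
    then show "p \<in> induced ` cone_lim \<omega> (\<lambda>n. g (e n)) d B" using pre(2) y(3) by (metis imageI)
  qed
qed

lemma cone_indices_image:
  "cone_indices \<omega> e d I (\<lambda>i. q ` A i) = cone_indices \<omega> (\<lambda>n. g (e n)) d I A"
proof -
  have "(\<exists>B. \<forall>\<^sub>F n in \<omega>. \<exists>a\<in>q ` A (s n). dist (e n) a \<le> B * d n) \<longleftrightarrow>
        (\<exists>B. \<forall>\<^sub>F n in \<omega>. \<exists>a\<in>A (s n). dist (g (e n)) a \<le> B * d n)" (is "?L \<longleftrightarrow> ?R") for s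
  proof
    assume ?L
    then obtain B where B: "\<forall>\<^sub>F n in \<omega>. \<exists>a\<in>q ` A (s n). dist (e n) a \<le> B * d n" by blast
    have "\<forall>\<^sub>F n in \<omega>. \<exists>a\<in>A (s n). dist (g (e n)) a \<le> (L * B + \<bar>2 * C\<bar>) * d n"
      using B eventually_const_le[of "2 * C"]
    proof eventually_elim
      case (elim n)
      then obtain a where a: "a \<in> A (s n)" "dist (e n) (q a) \<le> B * d n" by blast
      then have "L * dist (e n) (q a) \<le> L * (B * d n)" using constants by simp
      then have "dist (g (e n)) a \<le> (L * B + \<bar>2 * C\<bar>) * d n"
        using dist_preimage_le[of "e n" a] elim(2) by (simp add: algebra_simps)
      with a(1) show ?case by blast
    qed
    then show ?R by blast
  next
    assume ?R
    then obtain B where B: "\<forall>\<^sub>F n in \<omega>. \<exists>a\<in>A (s n). dist (g (e n)) a \<le> B * d n" by blast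
    have "\<forall>\<^sub>F n in \<omega>. \<exists>a\<in>q ` A (s n). dist (e n) a \<le> (L * B + \<bar>2 * C\<bar>) * d n"
      using B eventually_const_le[of "2 * C"]
    proof eventually_elim
      case (elim n)
      then obtain a where a: "a \<in> A (s n)" "dist (g (e n)) a \<le> B * d n" by blast
      then have "L * dist (g (e n)) a \<le> L * (B * d n)" using constants by simp
      then have "dist (e n) (q a) \<le> (L * B + \<bar>2 * C\<bar>) * d n"
        using dist_image_le[of "e n" a] elim(2) by (simp add: algebra_simps)
      with a(1) show ?case by blast
    qed
    then show ?L by blast
  qed
  then show ?thesis by (intro set_eqI) (simp add: cone_indices_iff[of d, OF pos])
qed

lemma tree_graded_image:
  assumes geo: "geodesic_subset dist (UNIV :: 'b set)"
    and tg: "tree_graded cone cdist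
      {cone_lim \<omega> (\<lambda>n. g (e n)) d (\<lambda>n. A (s n)) | s. s \<in> cone_indices \<omega> (\<lambda>n. g (e n)) d I A}"
  shows "tree_graded cone' cdist'
      {cone_lim \<omega> e d (\<lambda>n. q ` A (s n)) | s. s \<in> cone_indices \<omega> e d I (\<lambda>i. q ` A i)}"
proof -
  have "tree_graded cone' cdist' ((`) induced `
      {cone_lim \<omega> (\<lambda>n. g (e n)) d (\<lambda>n. A (s n)) | s. s \<in> cone_indices \<omega> (\<lambda>n. g (e n)) d I A})"
    by (rule tree_graded_bilipschitz[OF tg Metric_space_cone[OF om pos] geodesic_cone[OF om pos geo]
          bij_induced, of L]) (use constants induced_dist in auto)
  also have "(`) induced `
      {cone_lim \<omega> (\<lambda>n. g (e n)) d (\<lambda>n. A (s n)) | s. s \<in> cone_indices \<omega> (\<lambda>n. g (e n)) d I A} =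
      {cone_lim \<omega> e d (\<lambda>n. q ` A (s n)) | s. s \<in> cone_indices \<omega> e d I (\<lambda>i. q ` A i)}"
    unfolding cone_indices_image induced_cone_lim[symmetric] by blast
  finally show ?thesis .
qed

lemma cone_lims_meet_image:
  assumes meet: "\<And>x y. {x, y} \<subseteq> cone_lim \<omega> (\<lambda>n. g (e n)) d B \<inter> cone_lim \<omega> (\<lambda>n. g (e n)) d B' \<Longrightarrow> x = y"
    and xy: "{x, y} \<subseteq> cone_lim \<omega> e d (\<lambda>n. q ` B n) \<inter> cone_lim \<omega> e d (\<lambda>n. q ` B' n)"
  shows "x = y"
proof -
  let ?S = "cone_lim \<omega> (\<lambda>n. g (e n)) d B" and ?T = "cone_lim \<omega> (\<lambda>n. g (e n)) d B'"
  have "?S \<subseteq> cone" "?T \<subseteq> cone" by (rule cone_lim_subset[OF om pos])+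
  then have int: "induced ` ?S \<inter> induced ` ?T = induced ` (?S \<inter> ?T)"
    using inj_on_image_Int[OF bij_betw_imp_inj_on[OF bij_induced]] by blast
  have "x \<in> induced ` (?S \<inter> ?T)" "y \<in> induced ` (?S \<inter> ?T)"
    using xy unfolding induced_cone_lim[symmetric] int by simp_all
  then obtain a b where ab: "a \<in> ?S \<inter> ?T" "b \<in> ?S \<inter> ?T" and "x = induced a" "y = induced b"
    by (elim imageE)
  moreover have "a = b" by (rule meet) (use ab in simp)
  ultimately show ?thesis by simp
qed

end

lemma (in quasi_inverses) asymptotically_tree_graded_image:
  assumes geo: "geodesic_subset dist (UNIV :: 'b set)" and tg: "asymptotically_tree_graded I A"
  shows "asymptotically_tree_graded I (\<lambda>i. q ` A i)"
  unfolding asymptotically_tree_graded_def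
proof (intro allI impI)
  fix \<omega> :: "nat filter" and e :: "nat \<Rightarrow> 'b" and d :: "nat \<Rightarrow> real"
  assume *: "nonprincipal_ultrafilter \<omega> \<and> (\<forall>n. 0 < d n) \<and> filterlim d at_top \<omega>"
  then interpret quasi_inverses_cone q g L C \<omega> e d by unfold_locales auto
  note tg' = tg[unfolded asymptotically_tree_graded_def, rule_format, OF *, of "\<lambda>n. g (e n)"]
  show "tree_graded cone' cdist'
      {cone_lim \<omega> e d (\<lambda>n. q ` A (s n)) | s. s \<in> cone_indices \<omega> e d I (\<lambda>i. q ` A i)} \<and>
    (\<forall>s\<in>cone_indices \<omega> e d I (\<lambda>i. q ` A i). \<forall>t\<in>cone_indices \<omega> e d I (\<lambda>i. q ` A i).
       (\<forall>\<^sub>F n in \<omega>. s n \<noteq> t n) \<longrightarrow>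
       (\<forall>x y. {x, y} \<subseteq> cone_lim \<omega> e d (\<lambda>n. q ` A (s n)) \<inter> cone_lim \<omega> e d (\<lambda>n. q ` A (t n)) \<longrightarrow> x = y))"
  proof (intro conjI ballI impI allI)
    show "tree_graded cone' cdist'
        {cone_lim \<omega> e d (\<lambda>n. q ` A (s n)) | s. s \<in> cone_indices \<omega> e d I (\<lambda>i. q ` A i)}"
      by (rule tree_graded_image[where A = A and I = I, OF geo tg'[THEN conjunct1]])
    fix s t x y
    assume st: "s \<in> cone_indices \<omega> e d I (\<lambda>i. q ` A i)" "t \<in> cone_indices \<omega> e d I (\<lambda>i. q ` A i)"
      and ne: "\<forall>\<^sub>F n in \<omega>. s n \<noteq> t n"
      and xy: "{x, y} \<subseteq> cone_lim \<omega> e d (\<lambda>n. q ` A (s n)) \<inter> cone_lim \<omega> e d (\<lambda>n. q ` A (t n))"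
    show "x = y"
    proof (rule cone_lims_meet_image[where B = "\<lambda>n. A (s n)" and B' = "\<lambda>n. A (t n)", OF _ xy])
      fix x y
      assume "{x, y} \<subseteq> cone_lim \<omega> (\<lambda>n. g (e n)) d (\<lambda>n. A (s n)) \<inter> cone_lim \<omega> (\<lambda>n. g (e n)) d (\<lambda>n. A (t n))"
      with tg'[THEN conjunct2, THEN bspec, THEN bspec] st[unfolded cone_indices_image] ne
      show "x = y" by meson
    qed
  qed
qed

theorem theorem5p1:
  fixes A :: "'i \<Rightarrow> 'a::metric_space set" and I :: "'i set"
    and q :: "'a \<Rightarrow> 'b::metric_space"
  assumes "geodesic_subset dist (UNIV :: 'a set)"
    and "geodesic_subset dist (UNIV :: 'b set)"
    and "quasi_isometry q"
  shows "(alpha1 I A \<and> alpha2' I A \<longrightarrow>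
            alpha1 I (\<lambda>i. q ` A i) \<and>
            (\<exists>\<epsilon>. 0 < \<epsilon> \<and> \<epsilon> \<le> 1 / 2 \<and> alpha2 \<epsilon> I (\<lambda>i. q ` A i))) \<and>
         (alpha3' I A \<longrightarrow> alpha3 I (\<lambda>i. q ` A i)) \<and>
         (asymptotically_tree_graded I A \<longrightarrow> asymptotically_tree_graded I (\<lambda>i. q ` A i))"
proof -
  obtain g L C where "quasi_inverses q g L C"
    by (rule quasi_isometry_quasi_inverses[OF assms(3)])
  then interpret quasi_inverses q g L C .
  have "1 \<le> L\<^sup>2" using constants by simp
  then have "0 < 4 * L\<^sup>2" "2 \<le> 4 * L\<^sup>2" by linarith+
  then have "0 < 1 / (4 * L\<^sup>2)" "1 / (4 * L\<^sup>2) \<le> 1 / 2" by (simp_all add: divide_le_eq)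
  then show ?thesis
    using alpha1_image alpha2_image alpha3_image asymptotically_tree_graded_image[OF assms(2)] by blast
qed

end
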